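(* Fix $\beta>0$. There exist $\mu_*>0$ and $\lambda_M>0$ such that for all $\mu\in[-\mu_*,3]$ the spectrum of the operator $\mathrm{L}=\mathrm{L}_\mu$ satisfies $$\sigma(\mathrm{L})\subset\{0\}\cup\{\lambda\in\mathbb{C}:\ \Re\lambda<-\lambda_M\}.$$ Moreover, the kernel of $\mathrm{L}$ is simple (i.e. $\lambda=0$ is a simple eigenvalue of $\mathrm{L}$).
   Context: Let $\psi(z)=\operatorname{sech} z$ on $\mathbb{R}$. For real parameters $\beta>0$ and $\mu$, define on $L^2(\mathbb{R};\mathbb{C}^2)$, with domain $H^2(\mathbb{R};\mathbb{C}^2)$, the operator $$\mathrm{L}=\mathrm{L}_\mu=\begin{pmatrix}0&\mathrm{D}\\-\mathrm{C}&-\beta\end{pmatrix},\qquad \mathrm{C}=-\partial_z^2-6\psi^2+4,\qquad \mathrm{D}=-\partial_z^2-2\psi^2+\mu+1.$$ This is the linearization of the one-dimensional defocusing parametric nonlinear Schrödinger system $$U_\tau=\begin{pmatrix}0&-(\partial_z^2-2|U|^2+1-\mu)\\ \partial_z^2-2|U|^2+2&-\beta\end{pmatrix}U,\qquad U(z,\tau)\in\mathbb{R}^2,$$ about the dark-soliton steady state $\Phi_0(z)=(\tanh z,0)^t$. *)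

theory Defs
  imports "HOL-Analysis.Analysis"
begin

text \<open>Elements of the Lebesgue and Sobolev spaces are Borel representatives, and equality in these
  spaces is equality almost everywhere with respect to \<^term>\<open>lborel\<close>. All definitions below
  respect this identification.\<close>

definition ae_eq :: "(real \<Rightarrow> 'a) \<Rightarrow> (real \<Rightarrow> 'a) \<Rightarrow> bool" (infix "=\<^sub>a\<^sub>e" 50) where
  "f =\<^sub>a\<^sub>e g \<longleftrightarrow> (AE z in lborel. f z = g z)"

definition L2 :: "(real \<Rightarrow> 'a::euclidean_space) set" where
  "L2 = {f \<in> borel_measurable lborel. integrable lborel (\<lambda>z. (norm (f z))\<^sup>2)}"

definition L2_norm :: "(real \<Rightarrow> 'a::euclidean_space) \<Rightarrow> real" where
  "L2_norm f = sqrt (LINT z|lborel. (norm (f z))\<^sup>2)"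

definition test_function :: "(real \<Rightarrow> real) \<Rightarrow> bool" where
  "test_function \<phi> \<longleftrightarrow>
     (\<forall>k z. (deriv ^^ k) \<phi> differentiable at z) \<and> compact (closure {z. \<phi> z \<noteq> 0})"

definition locally_integrable :: "(real \<Rightarrow> 'a::euclidean_space) \<Rightarrow> bool" where
  "locally_integrable f \<longleftrightarrow> (\<forall>K. compact K \<longrightarrow> set_integrable lborel K f)"

definition has_weak_deriv ::
    "(real \<Rightarrow> 'a::euclidean_space) \<Rightarrow> (real \<Rightarrow> 'a) \<Rightarrow> bool" where
  "has_weak_deriv f g \<longleftrightarrow> locally_integrable f \<and> locally_integrable g \<and>
     (\<forall>\<phi>. test_function \<phi> \<longrightarrow>
        (LINT z|lborel. deriv \<phi> z *\<^sub>R f z) = - (LINT z|lborel. \<phi> z *\<^sub>R g z))"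

text \<open>The weak derivative is determined up to a null set; it is meaningful only for functions
  that have one.\<close>

definition weak_deriv :: "(real \<Rightarrow> 'a::euclidean_space) \<Rightarrow> real \<Rightarrow> 'a" where
  "weak_deriv f = (SOME g. has_weak_deriv f g)"

definition H2 :: "(real \<Rightarrow> 'a::euclidean_space) set" where
  "H2 = {f \<in> L2. \<exists>g\<in>L2. \<exists>h\<in>L2. has_weak_deriv f g \<and> has_weak_deriv g h}"

text \<open>An unbounded operator on \<^term>\<open>L2 :: (real \<Rightarrow> complex^2) set\<close> is given by its domain
  \<^term>\<open>S\<close> and a map \<^term>\<open>T\<close>, of which only the values on \<^term>\<open>S\<close> matter.\<close>

type_synonym fn2 = "real \<Rightarrow> complex^2"

definition shifted :: "(fn2 \<Rightarrow> fn2) \<Rightarrow> complex \<Rightarrow> fn2 \<Rightarrow> fn2" where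
  "shifted T w f = (\<lambda>z. T f z - w *s f z)"

definition resolvent_set :: "fn2 set \<Rightarrow> (fn2 \<Rightarrow> fn2) \<Rightarrow> complex set" where
  "resolvent_set S T = {w.
     (\<forall>f\<in>S. \<forall>g\<in>S. shifted T w f =\<^sub>a\<^sub>e shifted T w g \<longrightarrow> f =\<^sub>a\<^sub>e g) \<and>
     (\<forall>g\<in>L2. \<exists>f\<in>S. shifted T w f =\<^sub>a\<^sub>e g) \<and>
     (\<exists>K. \<forall>f\<in>S. L2_norm f \<le> K * L2_norm (shifted T w f))}"

definition spectrum :: "fn2 set \<Rightarrow> (fn2 \<Rightarrow> fn2) \<Rightarrow> complex set" where
  "spectrum S T = - resolvent_set S T"

text \<open>\<^term>\<open>power_kernel S T w n\<close> is the kernel of the \<^term>\<open>n\<close>-th power of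
  \<^term>\<open>shifted T w\<close> on the natural domain of that power.\<close>

primrec power_kernel :: "fn2 set \<Rightarrow> (fn2 \<Rightarrow> fn2) \<Rightarrow> complex \<Rightarrow> nat \<Rightarrow> fn2 set" where
  "power_kernel S T w 0 = {f \<in> L2. f =\<^sub>a\<^sub>e (\<lambda>_. 0)}"
| "power_kernel S T w (Suc n) = {f \<in> S. shifted T w f \<in> power_kernel S T w n}"

definition eigenspace :: "fn2 set \<Rightarrow> (fn2 \<Rightarrow> fn2) \<Rightarrow> complex \<Rightarrow> fn2 set" where
  "eigenspace S T w = {f \<in> S. shifted T w f =\<^sub>a\<^sub>e (\<lambda>_. 0)}"

definition generalized_eigenspace :: "fn2 set \<Rightarrow> (fn2 \<Rightarrow> fn2) \<Rightarrow> complex \<Rightarrow> fn2 set" where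
  "generalized_eigenspace S T w = (\<Union>n. power_kernel S T w n)"

definition one_dimensional :: "fn2 set \<Rightarrow> bool" where
  "one_dimensional E \<longleftrightarrow>
     (\<exists>e\<in>L2. \<not> e =\<^sub>a\<^sub>e (\<lambda>_. 0) \<and> E = {f \<in> L2. \<exists>c. f =\<^sub>a\<^sub>e (\<lambda>z. c *s e z)})"

text \<open>Geometric and algebraic multiplicity are both one.\<close>

definition simple_eigenvalue :: "fn2 set \<Rightarrow> (fn2 \<Rightarrow> fn2) \<Rightarrow> complex \<Rightarrow> bool" where
  "simple_eigenvalue S T w \<longleftrightarrow>
     one_dimensional (eigenspace S T w) \<and> one_dimensional (generalized_eigenspace S T w)"

definition \<psi> :: "real \<Rightarrow> real" where
  "\<psi> z = 1 / cosh z"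

definition op_C :: "(real \<Rightarrow> complex) \<Rightarrow> real \<Rightarrow> complex" where
  "op_C u z = - weak_deriv (weak_deriv u) z - of_real (6 * (\<psi> z)\<^sup>2) * u z + 4 * u z"

definition op_D :: "real \<Rightarrow> (real \<Rightarrow> complex) \<Rightarrow> real \<Rightarrow> complex" where
  "op_D \<mu> v z =
     - weak_deriv (weak_deriv v) z - of_real (2 * (\<psi> z)\<^sup>2) * v z + of_real (\<mu> + 1) * v z"

definition op_L :: "real \<Rightarrow> real \<Rightarrow> fn2 \<Rightarrow> fn2" where
  "op_L \<beta> \<mu> f =
     (let u = (\<lambda>z. f z $ 1); v = (\<lambda>z. f z $ 2)
      in (\<lambda>z. vector [op_D \<mu> v z, - op_C u z - of_real \<beta> * v z]))"

end

(* Since psi^2 spans the kernel of C >= 0, one solves the second row of (L - lambda)(u,v) = (g1,g2) for u up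
   to a multiple of psi^2, after the component of v along psi^2 has been read off; the multiple is then
   determined by the first row, because lambda is nonzero. With P the projection onto the complement of
   psi^2, S the inverse of C there and kappa = lambda (lambda + beta), what remains is
   (P D P + kappa P S P) w = h. Here S >= 0 is bounded, and P D P >= delta uniformly for mu >= -delta,
   although D itself is not positive: its ground state psi is not orthogonal to psi^2. So the equation
   is solvable unless kappa is real and below -delta, which forces Re lambda < -Lambda.

   The spectral gaps come from the factorizations D - mu = A* A and C = B* B with A = d + tanh,
   B = d + 2 tanh, in which A A* = 1 - d^2 and B B* = 4 - d^2 - 2 psi^2 are bounded below. Surjectivity
   is always obtained by continuation from the explicitly invertible 1 - d^2. *)

theory Submission
  imports Defs
begin

section \<open>Perturbation theory for positive symmetric operators\<close>

text \<open>Complex kappa is handled by a half-plane argument. P D P and P S P are symmetric, so the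
  form of P D P + kappa P S P takes values in the cone spanned by 1 and kappa. Unless kappa is on
  the negative real axis, a factor z with Re z > 0 moves this cone into the closed right half-plane
  and keeps the contribution of P D P strictly positive. For real kappa \<ge> -delta the bound S
  \<le> 1/2 still leaves half of the gap. As Im kappa = Im lambda (2 Re lambda + beta), a real kappa
  with Re lambda > -beta/2 means a real lambda, and then lambda \<ge> -Lambda gives kappa \<ge>
  -Lambda beta.

  The gap of D on the complement of psi^2 is bounded below by the squared cosine of the angle
  between psi and psi^2; half of it is spent on negative mu.

  Simplicity of the kernel rests on the damping: if L (u, v) = (a psi^2, 0), the second row C u +
  beta v = 0 tested with psi^2 makes v orthogonal to psi^2; then the form of D vanishes at v, so v =
  0 and a = 0. This excludes Jordan chains as well.\<close>

lemma id_plus_surj_step: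
  fixes X :: "'a::banach \<Rightarrow> 'a"
  assumes X: "bounded_linear X" and b: "\<And>q. norm (X q) \<le> b * norm q" "b \<ge> 0"
    and K: "\<And>q. norm q \<le> K * norm (q + t *\<^sub>R X q)"
    and surj: "\<And>h. \<exists>q. q + t *\<^sub>R X q = h"
    and s: "\<bar>s\<bar> * b * K < 1" and K0: "K \<ge> 0"
  shows "\<exists>q. q + (t + s) *\<^sub>R X q = h"
proof -
  interpret X: bounded_linear X by fact
  define R where "R h = (SOME q. q + t *\<^sub>R X q = h)" for h
  have R: "R h + t *\<^sub>R X (R h) = h" for h
    unfolding R_def using someI_ex[OF surj[of h]] .
  have Rd: "norm (R h - R h') \<le> K * norm (h - h')" for h h'
  proof -
    have "(R h - R h') + t *\<^sub>R X (R h - R h') = h - h'"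
      using R[of h] R[of h'] by (simp add: X.diff algebra_simps)
    then show ?thesis using K[of "R h - R h'"] by simp
  qed
  \<comment> \<open>The equation at \<open>t + s\<close> is the fixed point equation of
    \<open>\<Phi>\<close>: the increment is moved to the right-hand side and the inverse
    \<open>R\<close> at \<open>t\<close>, Lipschitz with constant \<open>K\<close>, is
    applied.\<close>
  define \<Phi> where "\<Phi> q = R (h - s *\<^sub>R X q)" for q
  have "\<exists>!x. \<Phi> x = x"
  proof (rule banach_fix_type[where c = "\<bar>s\<bar> * b * K"])
    show "0 \<le> \<bar>s\<bar> * b * K" using b K0 by simp
    show "\<forall>x y. dist (\<Phi> x) (\<Phi> y) \<le> \<bar>s\<bar> * b * K * dist x y"
    proof (intro allI)
      fix x y
      have "norm (\<Phi> x - \<Phi> y) \<le> K * norm (s *\<^sub>R X (y - x))"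
        unfolding \<Phi>_def by (rule order_trans[OF Rd]) (simp add: X.diff algebra_simps)
      also have "\<dots> = K * (\<bar>s\<bar> * norm (X (y - x)))" by simp
      also have "\<dots> \<le> K * (\<bar>s\<bar> * (b * norm (y - x)))"
        using b K0 by (intro mult_left_mono) auto
      finally show "dist (\<Phi> x) (\<Phi> y) \<le> \<bar>s\<bar> * b * K * dist x y"
        by (simp add: dist_norm norm_minus_commute mult_ac)
    qed
  qed (use s in auto)
  then obtain q where q: "\<Phi> q = q" by auto
  have "q + t *\<^sub>R X q = h - s *\<^sub>R X q" using R[of "h - s *\<^sub>R X q"] q unfolding \<Phi>_def by simp
  then have "q + (t + s) *\<^sub>R X q = h" by (simp add: algebra_simps)
  then show ?thesis by blast
qed

text \<open>Method of continuity: the bound \<open>K\<close> does not depend on \<open>t\<close>, so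
  the admissible step length does not shrink and finitely many steps of length \<open>1 / n\<close>
  with \<open>n > b * K\<close> lead from \<open>t = 0\<close> to \<open>t = 1\<close>.\<close>

lemma id_plus_surj:
  fixes X :: "'a::banach \<Rightarrow> 'a"
  assumes X: "bounded_linear X"
    and K: "\<And>t q. 0 \<le> t \<Longrightarrow> t \<le> 1 \<Longrightarrow> norm q \<le> K * norm (q + t *\<^sub>R X q)" and K0: "K \<ge> 0"
  shows "\<exists>q. q + X q = h"
proof -
  interpret X: bounded_linear X by fact
  obtain b where b: "\<And>q. norm (X q) \<le> b * norm q" "b \<ge> 0"
    using X.nonneg_bounded by (metis mult.commute)
  obtain n :: nat where n: "real n > b * K" using reals_Archimedean2 by blast
  then have n0: "n > 0" using b(2) K0 by (metis gr0I mult_nonneg_nonneg not_le of_nat_0)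
  have "\<exists>q. q + (real i / real n) *\<^sub>R X q = h" if "i \<le> n" for i h
    using that
  proof (induction i arbitrary: h)
    case (Suc i)
    have "\<exists>q. q + (real i / real n + 1 / real n) *\<^sub>R X q = h"
    proof (rule id_plus_surj_step[OF X b K])
      show "\<bar>1 / real n\<bar> * b * K < 1" using n n0 by (simp add: field_simps)
    qed (use Suc K0 in auto)
    then show ?case by (simp add: add_divide_distrib add.commute)
  qed auto
  from this[of n h] n0 show ?thesis by simp
qed

lemma coercive_norm_bound:
  assumes "c * (f \<bullet> f) \<le> g \<bullet> f"
  shows "c * norm f \<le> norm g"
proof -
  have "(c * norm f) * norm f \<le> norm g * norm f"
    using assms norm_cauchy_schwarz[of g f]
    by (simp add: power2_norm_eq_inner[symmetric] power2_eq_square mult_ac)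
  then show ?thesis by (cases "f = 0") auto
qed

text \<open>Models an unbounded operator, to be instantiated with 1 - d^2 on H^2; values of
  \<open>N\<close> outside \<open>X\<close> are irrelevant. Surjectivity together with
  \<open>N_pos\<close> yields a bounded inverse, the substitute for self-adjointness.\<close>

locale pos_op =
  fixes X :: "'h::{real_inner,banach} set" and N :: "'h \<Rightarrow> 'h"
  assumes sub: "subspace X"
    and N_add: "\<And>f g. f \<in> X \<Longrightarrow> g \<in> X \<Longrightarrow> N (f + g) = N f + N g"
    and N_scale: "\<And>f c. f \<in> X \<Longrightarrow> N (c *\<^sub>R f) = c *\<^sub>R N f"
    and N_surj: "\<And>h. \<exists>f\<in> X. N f = h"
    and N_sym: "\<And>f g. f \<in> X \<Longrightarrow> g \<in> X \<Longrightarrow> N f \<bullet> g = f \<bullet> N g"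
    and N_pos: "\<And>f. f \<in> X \<Longrightarrow> N f \<bullet> f \<ge> f \<bullet> f"
begin

lemma dom_add: "f \<in> X \<Longrightarrow> g \<in> X \<Longrightarrow> f + g \<in> X"
  and dom_scale: "f \<in> X \<Longrightarrow> c *\<^sub>R f \<in> X"
  and dom_diff: "f \<in> X \<Longrightarrow> g \<in> X \<Longrightarrow> f - g \<in> X"
  and dom_minus: "f \<in> X \<Longrightarrow> - f \<in> X"
  and dom_0: "0 \<in> X"
  using sub by (auto simp: subspace_add subspace_scale subspace_diff subspace_neg subspace_0)

lemma N_diff: "f \<in> X \<Longrightarrow> g \<in> X \<Longrightarrow> N (f - g) = N f - N g"
  using N_add[of f "(-1) *\<^sub>R g"] N_scale[of g "-1"] dom_minus[of g] by simp

lemma N_norm: "f \<in> X \<Longrightarrow> norm f \<le> norm (N f)"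
  using coercive_norm_bound[of 1 f "N f"] N_pos[of f] by simp

text \<open>The a priori bound makes solutions unique, and uniqueness makes the pointwise chosen
  \<open>R\<close> linear.\<close>

lemma inverse_bounded_linear:
  assumes B: "bounded_linear B" and K: "\<And>f. f \<in> X \<Longrightarrow> norm f \<le> K * norm (N f + B f)"
    and surj: "\<And>h. \<exists>f\<in> X. N f + B f = h"
  shows "\<exists>R. bounded_linear R \<and> (\<forall>h. R h \<in> X \<and> N (R h) + B (R h) = h) \<and> (\<forall>f\<in>X. R (N f + B f) = f)"
proof -
  interpret B: bounded_linear B by fact
  define R where "R h = (SOME f. f \<in> X \<and> N f + B f = h)" for h
  have R: "R h \<in> X \<and> N (R h) + B (R h) = h" for h
    unfolding R_def by (rule someI_ex) (use surj[of h] in auto)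
  then have R_dom: "R h \<in> X" for h by blast
  have inj: "f = g" if "f \<in> X" "g \<in> X" "N f + B f = N g + B g" for f g
  proof -
    have "N (f - g) + B (f - g) = (N f + B f) - (N g + B g)"
      using that(1,2) by (simp add: N_diff B.diff)
    also have "\<dots> = 0" using that(3) by simp
    finally have "N (f - g) + B (f - g) = 0" .
    then show ?thesis using K[of "f - g"] dom_diff[OF that(1,2)] by simp
  qed
  have "bounded_linear R"
  proof
    show "R (x + y) = R x + R y" for x y
    proof (rule inj)
      have "N (R x + R y) + B (R x + R y) = (N (R x) + B (R x)) + (N (R y) + B (R y))"
        by (simp add: N_add B.add R_dom algebra_simps)
      then show "N (R (x + y)) + B (R (x + y)) = N (R x + R y) + B (R x + R y)" using R by simp
    qed (use R dom_add in auto)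
    show "R (c *\<^sub>R x) = c *\<^sub>R R x" for c x
    proof (rule inj)
      have "N (c *\<^sub>R R x) + B (c *\<^sub>R R x) = c *\<^sub>R (N (R x) + B (R x))"
        by (simp add: N_scale B.scaleR scaleR_add_right R_dom)
      then show "N (R (c *\<^sub>R x)) + B (R (c *\<^sub>R x)) = N (c *\<^sub>R R x) + B (c *\<^sub>R R x)" using R by simp
    qed (use R dom_scale in auto)
    have "norm (R x) \<le> norm x * K" for x using K[of "R x"] R[of x] by (simp add: mult.commute)
    then show "\<exists>K. \<forall>x. norm (R x) \<le> norm x * K" by blast
  qed
  moreover have "R (N f + B f) = f" if "f \<in> X" for f by (rule inj) (use that R in auto)
  ultimately show ?thesis using R by blast
qed

text \<open>With \<open>G\<close> the bounded inverse of \<open>N\<close> and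
  \<open>f = G q\<close>, the equation becomes \<open>q + B (G q) = h\<close>, a bounded
  perturbation of the identity. The bound on \<open>G q\<close> carries over to \<open>q\<close>
  because \<open>q\<close> is the right-hand side minus \<open>t *\<^sub>R B (G q)\<close>.\<close>

lemma perturbation_surj:
  assumes B: "bounded_linear B" and K0: "K \<ge> 0"
    and K: "\<And>t f. 0 \<le> t \<Longrightarrow> t \<le> 1 \<Longrightarrow> f \<in> X \<Longrightarrow> norm f \<le> K * norm (N f + t *\<^sub>R B f)"
  shows "\<exists>f\<in> X. N f + B f = h"
proof -
  interpret B: bounded_linear B by fact
  obtain G where G: "bounded_linear G" "\<And>h. G h \<in> X" "\<And>h. N (G h) = h"
    using inverse_bounded_linear[of "\<lambda>_. 0" 1] N_norm N_surj bounded_linear_zero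
    by auto
  obtain b where b: "\<And>q. norm (B q) \<le> b * norm q" "b \<ge> 0"
    using B.nonneg_bounded by (metis mult.commute)
  have "\<exists>q. q + B (G q) = h"
  proof (rule id_plus_surj[where K = "1 + b * K"])
    show "bounded_linear (\<lambda>q. B (G q))" using bounded_linear_compose[OF B G(1)] .
    fix t :: real and q assume t: "0 \<le> t" "t \<le> 1"
    have Gq: "norm (G q) \<le> K * norm (q + t *\<^sub>R B (G q))" using K[OF t G(2)[of q]] G(3) by simp
    have "norm q \<le> norm (q + t *\<^sub>R B (G q)) + norm (t *\<^sub>R B (G q))"
      by (metis add_diff_cancel_right' norm_triangle_ineq4)
    also have "norm (t *\<^sub>R B (G q)) \<le> 1 * (b * norm (G q))"
      using t b by (simp only: norm_scaleR) (intro mult_mono, auto)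
    also have "\<dots> \<le> b * (K * norm (q + t *\<^sub>R B (G q)))" using Gq b by (simp add: mult_left_mono)
    finally show "norm q \<le> (1 + b * K) * norm (q + t *\<^sub>R B (G q))" by (simp add: algebra_simps)
  qed (use b K0 in auto)
  then obtain q where "q + B (G q) = h" ..
  then show ?thesis using G by (metis)
qed

text \<open>\<open>N + t B\<close> is a convex combination of \<open>N\<close> and
  \<open>N + B\<close>, hence coercive for all \<open>t\<close> with the smaller of the two
  constants 1 and \<open>c\<close>.\<close>

lemma coercive_perturbation_surj:
  assumes B: "bounded_linear B" and c: "c > 0"
    and pos: "\<And>f. f \<in> X \<Longrightarrow> c * (f \<bullet> f) \<le> (N f + B f) \<bullet> f"
  shows "\<exists>f\<in> X. N f + B f = h"
proof (rule perturbation_surj[OF B])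
  define c' where "c' = min c 1"
  have c': "c' > 0" using c by (simp add: c'_def)
  show "0 \<le> 1 / c'" using c' by simp
  fix t :: real and f assume t: "0 \<le> t" "t \<le> 1" and f: "f \<in> X"
  have "c' * (f \<bullet> f) = (1 - t) * (c' * (f \<bullet> f)) + t * (c' * (f \<bullet> f))" by (simp add: algebra_simps)
  also have "\<dots> \<le> (1 - t) * (N f \<bullet> f) + t * ((N f + B f) \<bullet> f)"
  proof (intro add_mono mult_left_mono)
    have "c' * (f \<bullet> f) \<le> 1 * (f \<bullet> f)" by (rule mult_right_mono) (auto simp: c'_def)
    then show "c' * (f \<bullet> f) \<le> N f \<bullet> f" using N_pos[OF f] by simp
    have "c' * (f \<bullet> f) \<le> c * (f \<bullet> f)" by (rule mult_right_mono) (auto simp: c'_def)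
    then show "c' * (f \<bullet> f) \<le> (N f + B f) \<bullet> f" using pos[OF f] by simp
  qed (use t in auto)
  also have "\<dots> = (N f + t *\<^sub>R B f) \<bullet> f" by (simp add: inner_add_left algebra_simps)
  finally have "c' * norm f \<le> norm (N f + t *\<^sub>R B f)" by (rule coercive_norm_bound)
  then show "norm f \<le> 1 / c' * norm (N f + t *\<^sub>R B f)" using c' by (simp add: field_simps)
qed

end

lemma pos_op_prod:
  assumes "pos_op X N"
  shows "pos_op (X \<times> X) (map_prod N N)"
proof -
  interpret pos_op X N by fact
  show ?thesis
  proof
    show "subspace (X \<times> X)" using sub by (simp add: subspace_Times)
    show "\<exists>f\<in> X \<times> X. map_prod N N f = h" for h
      using N_surj[of "fst h"] N_surj[of "snd h"] by (cases h) fastforce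
    show "map_prod N N f \<bullet> f \<ge> f \<bullet> f" if "f \<in> X \<times> X" for f
      using that N_pos[of "fst f"] N_pos[of "snd f"] by (cases f) (auto intro: add_mono)
  qed (auto simp: N_add N_scale N_sym inner_prod_def)
qed

text \<open>Elements of the complexification of a real Hilbert space are pairs (real part, imaginary part).\<close>

definition cmul :: "complex \<Rightarrow> 'a::real_vector \<times> 'a \<Rightarrow> 'a \<times> 'a" where
  "cmul c p = (Re c *\<^sub>R fst p - Im c *\<^sub>R snd p, Im c *\<^sub>R fst p + Re c *\<^sub>R snd p)"

definition cvec :: "complex \<Rightarrow> 'a::real_vector \<Rightarrow> 'a \<times> 'a" where
  "cvec c x = (Re c *\<^sub>R x, Im c *\<^sub>R x)"

text \<open>Pairing with a real vector, hence complex linear in \<open>p\<close> without any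
  conjugation; it is applied to the real vectors \<open>e\<close> and \<open>D e\<close>.\<close>

definition cip :: "'a::real_inner \<times> 'a \<Rightarrow> 'a \<Rightarrow> complex" where
  "cip p x = Complex (fst p \<bullet> x) (snd p \<bullet> x)"

lemma cmul_add_right: "cmul c (p + q) = cmul c p + cmul c q"
  and cmul_diff_right: "cmul c (p - q) = cmul c p - cmul c q"
  and cmul_minus_right: "cmul c (- p) = - cmul c p"
  and cmul_0_right [simp]: "cmul c 0 = 0"
  and cmul_0_left [simp]: "cmul 0 p = 0"
  and cmul_1 [simp]: "cmul 1 p = p"
  and cmul_cmul: "cmul c (cmul d p) = cmul (c * d) p"
  by (auto simp: cmul_def prod_eq_iff algebra_simps)

lemma cvec_0 [simp]: "cvec 0 x = 0"
  and cmul_cvec: "cmul c (cvec d x) = cvec (c * d) x"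
  by (auto simp: cmul_def cvec_def prod_eq_iff algebra_simps)

lemma cip_add: "cip (p + q) x = cip p x + cip q x"
  and cip_diff: "cip (p - q) x = cip p x - cip q x"
  and cip_minus: "cip (- p) x = - cip p x"
  and cip_0 [simp]: "cip 0 x = 0"
  and cip_cmul: "cip (cmul c p) x = c * cip p x"
  and cip_cvec: "cip (cvec c y) x = c * of_real (y \<bullet> x)"
  by (auto simp: cip_def cmul_def cvec_def complex_eq_iff algebra_simps)

lemma norm_cmul: "norm (cmul c p) = cmod c * norm p"
  for p :: "'a::real_inner \<times> 'a"
proof -
  have "(norm (cmul c p))^2 = (cmod c * norm p)^2"
    unfolding power_mult_distrib cmod_power2 power2_norm_eq_inner
    by (cases p) (simp add: cmul_def inner_diff_left inner_diff_right
      inner_add_left inner_add_right algebra_simps inner_commute power2_eq_square)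
  then show ?thesis by (simp add: power2_eq_iff_nonneg)
qed

lemma bounded_linear_cmul: "bounded_linear (cmul c :: 'a::real_normed_vector \<times> 'a \<Rightarrow> _)"
  unfolding cmul_def
  by (intro bounded_linear_Pair bounded_linear_sub bounded_linear_add
      bounded_linear_compose[OF bounded_linear_scaleR_right] bounded_linear_fst bounded_linear_snd)

lemma bounded_linear_cvec: "bounded_linear (\<lambda>c. cvec c (x::'a::real_normed_vector))"
  unfolding cvec_def
  by (intro bounded_linear_Pair bounded_linear_compose[OF bounded_linear_scaleR_left]
      bounded_linear_Re bounded_linear_Im)

lemma bounded_linear_cip: "bounded_linear (\<lambda>p. cip p (x::'a::real_inner))"
proof -
  have "cip p x = of_real (fst p \<bullet> x) + \<i> * of_real (snd p \<bullet> x)" for p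
    by (simp add: cip_def complex_eq_iff)
  moreover have "bounded_linear (\<lambda>p. of_real (fst p \<bullet> x) + \<i> * of_real (snd p \<bullet> x) :: complex)"
    by (intro bounded_linear_add bounded_linear_compose[OF bounded_linear_of_real]
       bounded_linear_compose[OF bounded_linear_mult_right]
       bounded_linear_compose[OF bounded_linear_inner_left] bounded_linear_fst bounded_linear_snd)
  ultimately show ?thesis by simp
qed

lemma bounded_linear_map_prod:
  assumes "bounded_linear f" "bounded_linear g"
  shows "bounded_linear (map_prod f g)"
  unfolding map_prod_def split_beta
  by (intro bounded_linear_Pair bounded_linear_compose[OF assms(1)] bounded_linear_compose[OF assms(2)]
      bounded_linear_fst bounded_linear_snd)

text \<open>The inner product on pairs is the real part of the hermitian one. The hermitian form of
  a symmetric \<open>Z\<close> is real, so only the real part of the factor \<open>c\<close>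
  survives.\<close>

lemma inner_cmul_symmetric:
  assumes "Z (fst p) \<bullet> snd p = fst p \<bullet> Z (snd p)"
  shows "cmul c (map_prod Z Z p) \<bullet> p = Re c * (map_prod Z Z p \<bullet> p)"
  using assms by (cases p) (simp add: cmul_def inner_prod_def algebra_simps inner_commute)

section \<open>Operators C and D with spectral gaps on the complement of a kernel vector\<close>

locale gap_ops = pos_op X N for X :: "'h::{real_inner,banach} set" and N +
  fixes A B :: "'h \<Rightarrow> 'h" and e :: 'h and \<gamma> \<delta> :: real
  assumes A: "bounded_linear A" and A_sym: "\<And>f g. A f \<bullet> g = f \<bullet> A g"
    and B: "bounded_linear B" and B_sym: "\<And>f g. B f \<bullet> g = f \<bullet> B g"
    and e_dom: "e \<in> X" and e_norm: "e \<bullet> e = 1" and e_ker: "N e + A e = 0"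
    and gap_C: "\<And>f. f \<in> X \<Longrightarrow> f \<bullet> e = 0 \<Longrightarrow> \<gamma> * (f \<bullet> f) \<le> (N f + A f) \<bullet> f"
    and gap_D: "\<And>f. f \<in> X \<Longrightarrow> f \<bullet> e = 0 \<Longrightarrow> \<delta> * (f \<bullet> f) \<le> (N f + B f) \<bullet> f"
    and \<gamma>: "\<gamma> > 0" and \<delta>: "\<delta> > 0" "\<delta> \<le> 1"
begin

sublocale A: bounded_linear A by (rule A)
sublocale B: bounded_linear B by (rule B)

definition C where "C f = N f + A f"
definition D where "D f = N f + B f"
definition P where "P f = f - (f \<bullet> e) *\<^sub>R e"
text \<open>PDP padded by the identity on the span of \<open>e\<close>, so that it is coercive on
  all of \<open>X\<close>. The assumption \<open>\<delta> \<le> 1\<close> ensures that the padding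
  keeps the lower bound \<open>\<delta>\<close>.\<close>

definition Y where "Y f = P (D (P f)) + (f \<bullet> e) *\<^sub>R e"

lemma C_add: "f \<in> X \<Longrightarrow> g \<in> X \<Longrightarrow> C (f + g) = C f + C g"
  and C_diff: "f \<in> X \<Longrightarrow> g \<in> X \<Longrightarrow> C (f - g) = C f - C g"
  and C_scale: "f \<in> X \<Longrightarrow> C (c *\<^sub>R f) = c *\<^sub>R C f"
  and C_sym: "f \<in> X \<Longrightarrow> g \<in> X \<Longrightarrow> C f \<bullet> g = f \<bullet> C g"
  unfolding C_def by (auto simp: N_add N_diff N_scale A.add A.diff A.scaleR inner_add_left
      inner_add_right N_sym A_sym algebra_simps)

lemma C_e [simp]: "C e = 0"
  by (simp add: C_def e_ker)

lemma D_add: "f \<in> X \<Longrightarrow> g \<in> X \<Longrightarrow> D (f + g) = D f + D g"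
  and D_diff: "f \<in> X \<Longrightarrow> g \<in> X \<Longrightarrow> D (f - g) = D f - D g"
  and D_scale: "f \<in> X \<Longrightarrow> D (c *\<^sub>R f) = c *\<^sub>R D f"
  and D_sym: "f \<in> X \<Longrightarrow> g \<in> X \<Longrightarrow> D f \<bullet> g = f \<bullet> D g"
  unfolding D_def by (auto simp: N_add N_diff N_scale B.add B.diff B.scaleR inner_add_left
      inner_add_right N_sym B_sym algebra_simps)

lemma P_dom: "f \<in> X \<Longrightarrow> P f \<in> X"
  unfolding P_def by (intro dom_diff dom_scale e_dom)

lemma P_orth [simp]: "P f \<bullet> e = 0"
  by (simp add: P_def inner_diff_left e_norm)

lemma P_sym: "P f \<bullet> g = f \<bullet> P g"
  by (simp add: P_def inner_diff_left inner_diff_right inner_commute)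

lemma P_bounded: "bounded_linear P"
  unfolding P_def by (intro bounded_linear_sub bounded_linear_ident
    bounded_linear_compose[OF bounded_linear_scaleR_left] bounded_linear_inner_left)

lemma norm_split: "f \<bullet> f = P f \<bullet> P f + (f \<bullet> e)^2"
  by (simp add: P_def inner_diff_left inner_diff_right inner_commute e_norm power2_eq_square)

lemma e_nonzero: "e \<noteq> 0" using e_norm by auto

text \<open>Testing the second equation with \<open>e\<close> removes \<open>C u\<close>, so
  \<open>v\<close> is orthogonal to \<open>e\<close>; the first equation then makes the form of
  \<open>D\<close> vanish at \<open>v\<close>, and \<open>gap_D\<close> gives \<open>v = 0\<close>.
  The right-hand side \<open>a *\<^sub>R e\<close> covers both the kernel (\<open>a = 0\<close>) and
  the next link of a Jordan chain.\<close>

lemma kernel_chain: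
  assumes "u \<in> X" "v \<in> X" "\<beta> \<noteq> 0" "D v = a *\<^sub>R e" "C u + \<beta> *\<^sub>R v = 0"
  shows "v = 0" "a = 0" "u = (u \<bullet> e) *\<^sub>R e"
proof -
  have "(C u + \<beta> *\<^sub>R v) \<bullet> e = \<beta> * (v \<bullet> e)"
    using C_sym[OF assms(1) e_dom] by (simp add: inner_add_left)
  then have ve: "v \<bullet> e = 0" using assms by simp
  then have "\<delta> * (v \<bullet> v) \<le> 0"
    using gap_D[OF assms(2) ve] assms(4) by (simp add: D_def inner_commute)
  then show v: "v = 0" using \<delta> by (simp add: mult_le_0_iff) (metis inner_ge_zero inner_eq_zero_iff antisym)
  then have "a *\<^sub>R e = 0" using D_scale[OF dom_0, of 0] assms(4) by simp
  then show "a = 0" using e_nonzero by simp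
  have "C (P u) = 0" using assms(5) v by (simp add: P_def C_diff C_scale dom_scale e_dom assms)
  then have "\<gamma> * (P u \<bullet> P u) \<le> 0"
    using gap_C[OF P_dom[OF assms(1)]] by (simp add: C_def)
  then have "P u = 0" using \<gamma> by (simp add: mult_le_0_iff) (metis inner_ge_zero inner_eq_zero_iff antisym)
  then show "u = (u \<bullet> e) *\<^sub>R e" by (simp add: P_def)
qed

text \<open>Adding \<open>\<gamma>\<close> times the projection onto \<open>e\<close> makes
  \<open>C\<close> coercive on the whole domain with constant \<open>\<gamma>\<close>.
  \<open>S\<close> is the inverse of this sum, which on the complement of \<open>e\<close> inverts
  \<open>C\<close> itself.\<close>

lemma reduced_inverse:
  obtains S where "bounded_linear S" "\<And>h. S h \<in> X" "\<And>h. h \<bullet> e = 0 \<Longrightarrow> S h \<bullet> e = 0"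
    "\<And>h. h \<bullet> e = 0 \<Longrightarrow> C (S h) = h" "\<And>h k. S h \<bullet> k = h \<bullet> S k"
    "\<And>h. 0 \<le> S h \<bullet> h" "\<And>h. S h \<bullet> h \<le> (h \<bullet> h) / \<gamma>"
proof -
  define A' where "A' f = A f + (\<gamma> * (f \<bullet> e)) *\<^sub>R e" for f
  have A': "bounded_linear A'"
    unfolding A'_def by (intro bounded_linear_add A bounded_linear_compose[OF bounded_linear_scaleR_left]
      bounded_linear_compose[OF bounded_linear_mult_right] bounded_linear_inner_left)
  have E: "N f + A' f = C f + (\<gamma> * (f \<bullet> e)) *\<^sub>R e" for f by (simp add: A'_def C_def)
  have Csplit: "C f \<bullet> f = C (P f) \<bullet> P f" if "f \<in> X" for f
  proof -
    have "C (P f) = C f" using that by (simp add: P_def C_diff C_scale dom_scale e_dom)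
    moreover have "C f \<bullet> e = 0" using C_sym[OF that e_dom] by simp
    ultimately show ?thesis by (simp add: P_def inner_diff_right)
  qed
  have coer: "\<gamma> * (f \<bullet> f) \<le> (N f + A' f) \<bullet> f" if "f \<in> X" for f
  proof -
    have "\<gamma> * (P f \<bullet> P f) \<le> C (P f) \<bullet> P f" using gap_C[OF P_dom[OF that]] by (simp add: C_def)
    moreover have "(N f + A' f) \<bullet> f = C f \<bullet> f + \<gamma> * (f \<bullet> e)^2"
      unfolding E by (simp add: inner_add_left power2_eq_square) (simp add: inner_commute)
    ultimately show ?thesis
      unfolding norm_split[of f] Csplit[OF that] by (simp add: algebra_simps)
  qed
  have bd: "norm f \<le> (1 / \<gamma>) * norm (N f + A' f)" if "f \<in> X" for f
    using coercive_norm_bound[OF coer[OF that]] \<gamma> by (simp add: field_simps)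
  obtain S where S: "bounded_linear S" "\<And>h. S h \<in> X" "\<And>h. N (S h) + A' (S h) = h"
      "\<And>f. f \<in> X \<Longrightarrow> S (N f + A' f) = f"
    using inverse_bounded_linear[OF A' bd coercive_perturbation_surj[OF A' \<gamma> coer]] by blast
  have Seq: "C (S h) + (\<gamma> * (S h \<bullet> e)) *\<^sub>R e = h" for h using S(3)[of h] unfolding E .
  have Se: "\<gamma> * (S h \<bullet> e) = h \<bullet> e" for h
  proof -
    have "h \<bullet> e = (C (S h) + (\<gamma> * (S h \<bullet> e)) *\<^sub>R e) \<bullet> e" unfolding Seq ..
    also have "\<dots> = \<gamma> * (S h \<bullet> e)"
      using C_sym[OF S(2)[of h] e_dom] by (simp add: inner_add_left e_norm)
    finally show ?thesis by simp
  qed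
  have low: "\<gamma> * (S h \<bullet> S h) \<le> S h \<bullet> h" for h
    using coer[OF S(2)[of h]] S(3)[of h] by (simp add: inner_commute)
  show thesis
  proof (rule that[OF S(1,2)])
    show Se0: "S h \<bullet> e = 0" if "h \<bullet> e = 0" for h using Se[of h] that \<gamma> by simp
    show "C (S h) = h" if "h \<bullet> e = 0" for h using Seq[of h] Se0[OF that] by simp
    show "S h \<bullet> k = h \<bullet> S k" for h k
    proof -
      have "S h \<bullet> k = S h \<bullet> (C (S k) + (\<gamma> * (S k \<bullet> e)) *\<^sub>R e)" unfolding Seq ..
      also have "\<dots> = (C (S h) + (\<gamma> * (S h \<bullet> e)) *\<^sub>R e) \<bullet> S k"
        using C_sym[OF S(2)[of h] S(2)[of k]] by (simp add: inner_add_left inner_add_right inner_commute)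
      finally show ?thesis unfolding Seq .
    qed
    show "0 \<le> S h \<bullet> h" for h
      by (rule order_trans[OF _ low]) (use \<gamma> in auto)
    show "S h \<bullet> h \<le> (h \<bullet> h) / \<gamma>" for h
    proof -
      have "\<gamma> * norm (S h) \<le> norm h"
        using low[of h] by (intro coercive_norm_bound) (simp add: inner_commute)
      then have "\<gamma> * norm (S h) * norm h \<le> norm h * norm h" by (intro mult_right_mono) auto
      moreover have "\<gamma> * (S h \<bullet> h) \<le> \<gamma> * (norm (S h) * norm h)"
        using \<gamma> norm_cauchy_schwarz[of "S h" h] by (intro mult_left_mono) auto
      ultimately have "\<gamma> * (S h \<bullet> h) \<le> h \<bullet> h"
        by (simp add: power2_norm_eq_inner[symmetric] power2_eq_square mult_ac)
      then show ?thesis using \<gamma> by (simp add: field_simps)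
    qed
  qed
qed

text \<open>Since \<open>e\<close> lies in the domain, the terms by which the compression differs
  from \<open>N\<close> involve \<open>N\<close> only through \<open>N e\<close> and
  \<open>N f \<bullet> e = f \<bullet> N e\<close>, and these are bounded in \<open>f\<close>. The
  formula for \<open>B'\<close> is the expansion of \<open>P (D (P f))\<close> with that
  replacement.\<close>

lemma PDP_perturbation:
  obtains B' where "bounded_linear B'" "\<And>f. f \<in> X \<Longrightarrow> N f + B' f = P (D (P f)) + (f \<bullet> e) *\<^sub>R e"
proof -
  define B' where "B' f = B f - (f \<bullet> e) *\<^sub>R D e
     - (f \<bullet> N e + B f \<bullet> e - (f \<bullet> e) * (D e \<bullet> e) - f \<bullet> e) *\<^sub>R e" for f
  have "bounded_linear B'"
    unfolding B'_def by (intro bounded_linear_add bounded_linear_sub B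
      bounded_linear_compose[OF bounded_linear_scaleR_left] bounded_linear_inner_left
      bounded_linear_compose[OF bounded_linear_mult_left] bounded_linear_compose[OF bounded_linear_inner_left])
  moreover have "N f + B' f = P (D (P f)) + (f \<bullet> e) *\<^sub>R e" if "f \<in> X" for f
  proof -
    have "D (P f) = N f + B f - (f \<bullet> e) *\<^sub>R D e"
      by (simp add: P_def D_diff D_scale dom_scale e_dom that) (simp add: D_def)
    then have "P (D (P f)) = N f + B f - (f \<bullet> e) *\<^sub>R D e
        - ((N f + B f - (f \<bullet> e) *\<^sub>R D e) \<bullet> e) *\<^sub>R e"
      unfolding P_def[of "D (P f)"] by simp
    moreover have "N f \<bullet> e = f \<bullet> N e" by (rule N_sym[OF that e_dom])
    ultimately show ?thesis
      by (simp add: B'_def inner_add_left inner_diff_left scaleR_add_left scaleR_diff_left)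
  qed
  ultimately show ?thesis using that by blast
qed

text \<open>Multiplied by z, the complexified operator PDP + \<kappa>PSP is coercive along the whole homotopy from N.\<close>

lemma reduced_system_inverse:
  assumes S: "bounded_linear S" "\<And>h k. S h \<bullet> k = h \<bullet> S k" "\<And>h. 0 \<le> S h \<bullet> h"
      "\<And>h. S h \<bullet> h \<le> (h \<bullet> h) / \<gamma>"
    and z: "Re z > 0" "Re (z * \<kappa>) \<ge> - (Re z * \<delta> * \<gamma> / 2)"
  obtains W where "bounded_linear W" "\<And>h. W h \<in> X \<times> X"
    "\<And>h. map_prod Y Y (W h)
        + cmul \<kappa> (map_prod (P \<circ> S \<circ> P) (P \<circ> S \<circ> P) (W h)) = h"
    "\<And>w. w \<in> X \<times> X \<Longrightarrow> W (map_prod Y Y w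
        + cmul \<kappa> (map_prod (P \<circ> S \<circ> P) (P \<circ> S \<circ> P) w)) = w"
proof -
  interpret NN: pos_op "X \<times> X" "map_prod N N" by (rule pos_op_prod) unfold_locales
  obtain B' where B': "bounded_linear B'"
    and B'eq: "\<And>f. f \<in> X \<Longrightarrow> N f + B' f = P (D (P f)) + (f \<bullet> e) *\<^sub>R e"
    by (rule PDP_perturbation, rule that)
  define PSP where "PSP = P \<circ> S \<circ> P"
  have PSP: "bounded_linear PSP"
    unfolding PSP_def comp_def
    by (intro bounded_linear_compose[OF P_bounded] bounded_linear_compose[OF S(1)] P_bounded)
  have PSP_sym: "PSP f \<bullet> g = f \<bullet> PSP g" for f g by (simp add: PSP_def P_sym S(2))
  have PSP_pos: "0 \<le> PSP f \<bullet> f" for f using S(3)[of "P f"] by (simp add: PSP_def P_sym)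
  have PSP_le: "PSP f \<bullet> f \<le> (f \<bullet> f) / \<gamma>" for f
  proof -
    have "PSP f \<bullet> f = S (P f) \<bullet> P f" by (simp add: PSP_def P_sym)
    also have "\<dots> \<le> (P f \<bullet> P f) / \<gamma>" by (rule S(4))
    also have "\<dots> \<le> (f \<bullet> f) / \<gamma>" using norm_split[of f] \<gamma> by (intro divide_right_mono) auto
    finally show ?thesis .
  qed
  have Y_sym: "Y f \<bullet> g = f \<bullet> Y g" if "f \<in> X" "g \<in> X" for f g
  proof -
    have "P (D (P f)) \<bullet> g = P f \<bullet> D (P g)" using D_sym P_dom that by (simp add: P_sym)
    also have "\<dots> = f \<bullet> P (D (P g))" by (simp add: P_sym)
    finally show ?thesis by (simp add: Y_def inner_add_left inner_add_right inner_commute)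
  qed
  have Y_pos: "\<delta> * (f \<bullet> f) \<le> Y f \<bullet> f" if "f \<in> X" for f
  proof -
    have "\<delta> * (P f \<bullet> P f) \<le> D (P f) \<bullet> P f" using gap_D[OF P_dom[OF that]] by (simp add: D_def)
    moreover have "\<delta> * (f \<bullet> e)^2 \<le> 1 * (f \<bullet> e)^2" using \<delta> by (intro mult_right_mono) auto
    moreover have "Y f \<bullet> f = D (P f) \<bullet> P f + (f \<bullet> e)^2"
      by (simp add: Y_def inner_add_left P_sym power2_eq_square) (simp add: inner_commute)
    ultimately show ?thesis unfolding norm_split[of f] by (simp add: algebra_simps)
  qed
  define BB where "BB w = map_prod B' B' w + cmul \<kappa> (map_prod PSP PSP w)" for w
  have BB: "bounded_linear BB"
    unfolding BB_def by (intro bounded_linear_add bounded_linear_map_prod B' PSP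
      bounded_linear_compose[OF bounded_linear_cmul])
  \<comment> \<open>The first term contributes \<open>Re z * \<delta>\<close>. By
    \<open>PSP_le\<close> and the lower bound on \<open>Re (z * \<kappa>)\<close> the second one
    costs at most half of this.\<close>
  define c where "c = Re z * \<delta> / 2"
  have c: "c > 0" using z \<delta> by (simp add: c_def)
  have coer: "norm w \<le> (cmod z / c) * norm (map_prod N N w + t *\<^sub>R BB w)"
    if t: "0 \<le> t" "t \<le> 1" and w: "w \<in> X \<times> X" for t w
  proof -
    \<comment> \<open>The homotopy from \<open>N\<close> to \<open>N + B'\<close> is the segment
      from \<open>N\<close> to \<open>Y\<close>, and both ends are at least
      \<open>\<delta>\<close>.\<close>
    define Z where "Z f = (1 - t) *\<^sub>R N f + t *\<^sub>R Y f" for f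
    have w': "fst w \<in> X" "snd w \<in> X" using w by auto
    have eq: "map_prod N N w + t *\<^sub>R BB w = map_prod Z Z w + cmul (of_real t * \<kappa>) (map_prod PSP PSP w)"
    proof -
      have "N f + t *\<^sub>R B' f = Z f" if "f \<in> X" for f
      proof -
        have B'f: "B' f = Y f - N f" using B'eq[OF that] unfolding Y_def by (metis add_diff_cancel_left')
        show ?thesis unfolding Z_def B'f by (simp add: algebra_simps)
      qed
      then show ?thesis using w'
        by (cases w) (simp add: BB_def cmul_def algebra_simps)
    qed
    have Zpos: "\<delta> * (f \<bullet> f) \<le> Z f \<bullet> f" if "f \<in> X" for f
    proof -
      have "\<delta> * (f \<bullet> f) \<le> 1 * (f \<bullet> f)" using \<delta> by (intro mult_right_mono) auto
      then have 1: "\<delta> * (f \<bullet> f) \<le> N f \<bullet> f" using N_pos[OF that] by simp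
      have "\<delta> * (f \<bullet> f) = (1 - t) * (\<delta> * (f \<bullet> f)) + t * (\<delta> * (f \<bullet> f))" by (simp add: algebra_simps)
      also have "\<dots> \<le> (1 - t) * (N f \<bullet> f) + t * (Y f \<bullet> f)"
        by (intro add_mono mult_left_mono 1 Y_pos that) (use t in auto)
      finally show ?thesis by (simp add: Z_def inner_add_left)
    qed
    have "Z (fst w) \<bullet> snd w = fst w \<bullet> Z (snd w)"
      using w' by (simp add: Z_def inner_add_left inner_add_right N_sym Y_sym)
    then have 1: "cmul z (map_prod Z Z w) \<bullet> w = Re z * (map_prod Z Z w \<bullet> w)"
      by (rule inner_cmul_symmetric)
    have 2: "cmul (z * (of_real t * \<kappa>)) (map_prod PSP PSP w) \<bullet> w
        = t * Re (z * \<kappa>) * (map_prod PSP PSP w \<bullet> w)"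
      by (subst inner_cmul_symmetric) (auto simp: PSP_sym algebra_simps)
    have PS: "0 \<le> map_prod PSP PSP w \<bullet> w" "map_prod PSP PSP w \<bullet> w \<le> (w \<bullet> w) / \<gamma>"
      using PSP_pos PSP_le by (cases w; simp add: add_divide_distrib add_mono)+
    have "Re z * (\<delta> * (w \<bullet> w)) \<le> Re z * (map_prod Z Z w \<bullet> w)"
    proof (rule mult_left_mono)
      show "\<delta> * (w \<bullet> w) \<le> map_prod Z Z w \<bullet> w"
        using Zpos[OF w'(1)] Zpos[OF w'(2)] by (cases w) (simp add: algebra_simps)
    qed (use z in simp)
    moreover have "t * Re (z * \<kappa>) * (map_prod PSP PSP w \<bullet> w) \<ge> - (c * (w \<bullet> w))"
    proof -
      have "- (c * \<gamma>) \<le> t * Re (z * \<kappa>)"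
      proof (cases "Re (z * \<kappa>) \<ge> 0")
        case True
        then show ?thesis using t c \<gamma> by (smt (verit) mult_nonneg_nonneg)
      next
        case False
        then have "t * Re (z * \<kappa>) \<ge> 1 * Re (z * \<kappa>)" using t by (intro mult_right_mono_neg) auto
        then show ?thesis using z(2) by (simp add: c_def mult_ac)
      qed
      then have "- (c * \<gamma>) * (map_prod PSP PSP w \<bullet> w) \<le> t * Re (z * \<kappa>) * (map_prod PSP PSP w \<bullet> w)"
        using PS by (intro mult_right_mono)
      moreover have "(c * \<gamma>) * (map_prod PSP PSP w \<bullet> w) \<le> (c * \<gamma>) * ((w \<bullet> w) / \<gamma>)"
        using PS c \<gamma> by (intro mult_left_mono) auto
      ultimately show ?thesis using \<gamma> by simp
    qed
    moreover have "Re z * (\<delta> * (w \<bullet> w)) = 2 * (c * (w \<bullet> w))" by (simp add: c_def)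
    ultimately have "c * (w \<bullet> w) \<le> cmul z (map_prod N N w + t *\<^sub>R BB w) \<bullet> w"
      unfolding eq cmul_add_right cmul_cmul inner_add_left 1 2 by linarith
    then have "c * norm w \<le> cmod z * norm (map_prod N N w + t *\<^sub>R BB w)"
      unfolding norm_cmul[symmetric] by (rule coercive_norm_bound)
    then show ?thesis using c by (simp add: field_simps)
  qed
  have K: "norm w \<le> (cmod z / c) * norm (map_prod N N w + BB w)" if "w \<in> X \<times> X" for w
    using coer[of 1 w] that by simp
  have surj: "\<exists>w\<in>X \<times> X. map_prod N N w + BB w = h" for h
    by (rule NN.perturbation_surj[OF BB _ coer]) (use c in auto)
  obtain W where W: "bounded_linear W" "\<And>h. W h \<in> X \<times> X" "\<And>h. map_prod N N (W h) + BB (W h) = h"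
      "\<And>f. f \<in> X \<times> X \<Longrightarrow> W (map_prod N N f + BB f) = f"
    using NN.inverse_bounded_linear[OF BB K surj] by blast
  have eq: "map_prod N N w + BB w = map_prod Y Y w + cmul \<kappa> (map_prod PSP PSP w)"
    if "w \<in> X \<times> X" for w
    using that by (auto simp: BB_def Y_def B'eq[symmetric])
  show thesis
    by (rule that[OF W(1,2)]) (use W(2-4) eq in \<open>auto simp: PSP_def[symmetric]\<close>)
qed

section \<open>The complexified block system and its resolvent\<close>

abbreviation "cC \<equiv> map_prod C C"
abbreviation "cD \<equiv> map_prod D D"

text \<open>\<^term>\<open>system l m\<close> is L - l for m = l + \<beta>, acting on complexified pairs.\<close>

definition "system l m x = (cD (snd x) - cmul l (fst x), - cC (fst x) - cmul m (snd x))"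

lemma cip_cC: "f \<in> X \<times> X \<Longrightarrow> cip (cC f) e = 0"
  using C_sym[OF _ e_dom] by (auto simp: cip_def complex_eq_iff)

lemma cip_cD: "f \<in> X \<times> X \<Longrightarrow> cip (cD f) e = cip f (D e)"
  using D_sym[OF _ e_dom] by (auto simp: cip_def)

lemma cip_e: "cip (cvec c e) e = c"
  by (simp add: cip_cvec e_norm)

lemma map_prod_P: "map_prod P P f = f - cvec (cip f e) e"
  by (cases f) (simp add: P_def cvec_def cip_def)

lemma cip_P: "cip (map_prod P P f) e = 0"
  by (simp add: map_prod_P cip_diff cip_e)

lemma cvec_dom: "x \<in> X \<Longrightarrow> cvec c x \<in> X \<times> X"
  by (simp add: cvec_def dom_scale)

lemma cmul_dom: "f \<in> X \<times> X \<Longrightarrow> cmul c f \<in> X \<times> X"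
  by (auto simp: cmul_def intro!: dom_add dom_diff dom_scale)

lemma cdom_add: "f \<in> X \<times> X \<Longrightarrow> g \<in> X \<times> X \<Longrightarrow> f + g \<in> X \<times> X"
  and cdom_diff: "f \<in> X \<times> X \<Longrightarrow> g \<in> X \<times> X \<Longrightarrow> f - g \<in> X \<times> X"
  by (auto intro!: dom_add dom_diff)

lemma cC_lin: "f \<in> X \<times> X \<Longrightarrow> g \<in> X \<times> X \<Longrightarrow> cC (f + g) = cC f + cC g"
    "f \<in> X \<times> X \<Longrightarrow> g \<in> X \<times> X \<Longrightarrow> cC (f - g) = cC f - cC g"
    "f \<in> X \<times> X \<Longrightarrow> cC (cmul c f) = cmul c (cC f)" "cC (cvec c e) = 0"
  by (auto simp: cmul_def cvec_def C_add C_diff C_scale dom_scale e_dom zero_prod_def)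

lemma cD_lin: "f \<in> X \<times> X \<Longrightarrow> g \<in> X \<times> X \<Longrightarrow> cD (f + g) = cD f + cD g"
    "f \<in> X \<times> X \<Longrightarrow> g \<in> X \<times> X \<Longrightarrow> cD (f - g) = cD f - cD g"
    "f \<in> X \<times> X \<Longrightarrow> cD (cmul c f) = cmul c (cD f)" "cD (cvec c e) = cvec c (D e)"
  by (auto simp: cmul_def cvec_def D_add D_diff D_scale dom_scale e_dom)

lemma system_diff:
  assumes "x \<in> (X \<times> X) \<times> (X \<times> X)" "y \<in> (X \<times> X) \<times> (X \<times> X)"
  shows "system l m (x - y) = system l m x - system l m y"
  using assms by (auto simp: system_def C_diff D_diff cmul_diff_right prod_eq_iff simp del: map_prod_simp)

text \<open>Division by \<open>m\<close> yields the component of \<open>v\<close> along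
  \<open>e\<close>, division by \<open>l\<close> that of \<open>u\<close>; the components orthogonal
  to \<open>e\<close> come from \<open>W\<close> and \<open>S\<close>. The solution is assembled
  from bounded linear maps, so that \<open>sol\<close> and \<open>inj\<close> together give the
  resolvent estimate as well.\<close>

theorem resolvent:
  assumes l: "l \<noteq> 0" and m: "m \<noteq> 0"
    and z: "Re z > 0" "Re (z * (l * m)) \<ge> - (Re z * \<delta> * \<gamma> / 2)"
  shows "(\<forall>g. \<exists>x \<in> (X \<times> X) \<times> (X \<times> X). system l m x = g) \<and>
    (\<exists>K. \<forall>x \<in> (X \<times> X) \<times> (X \<times> X). norm x \<le> K * norm (system l m x))"
proof -
  let ?X = "X \<times> X"
  obtain S where S: "bounded_linear S" "\<And>h. S h \<in> X" "\<And>h. h \<bullet> e = 0 \<Longrightarrow> S h \<bullet> e = 0"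
    "\<And>h. h \<bullet> e = 0 \<Longrightarrow> C (S h) = h" "\<And>h k. S h \<bullet> k = h \<bullet> S k"
    "\<And>h. 0 \<le> S h \<bullet> h" "\<And>h. S h \<bullet> h \<le> (h \<bullet> h) / \<gamma>"
    by (rule reduced_inverse, rule that)
  let ?Y = "\<lambda>w. map_prod Y Y w
        + cmul (l * m) (map_prod (P \<circ> S \<circ> P) (P \<circ> S \<circ> P) w)"
  obtain W where W: "bounded_linear W" "\<And>h. W h \<in> ?X" "\<And>h. ?Y (W h) = h"
      "\<And>w. w \<in> ?X \<Longrightarrow> W (?Y w) = w"
    by (rule reduced_system_inverse[OF S(1,5-7) z], rule that)
  define cS where "cS = map_prod S S"
  define cP where "cP = map_prod P P"
  have cS: "bounded_linear cS" "\<And>h. cS h \<in> ?X" and cP: "bounded_linear cP"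
    using S by (auto simp: cS_def cP_def intro: bounded_linear_map_prod P_bounded)
  interpret S: bounded_linear S by (rule S(1))
  interpret cS: bounded_linear cS by (rule cS)
  interpret cP: bounded_linear cP by (rule cP)
  have cS_cmul: "cS (cmul c f) = cmul c (cS f)" for c f
    by (cases f) (simp add: cS_def cmul_def S.add S.diff S.scaleR)
  have cS_e: "cip (cS h) e = 0" "cC (cS h) = h" if "cip h e = 0" for h
    using that S(3,4)[of "fst h"] S(3,4)[of "snd h"]
    by (cases h; simp add: cip_def cS_def complex_eq_iff)+
  have Yeq: "?Y w = cP (cD (cP w)) + cvec (cip w e) e + cmul (l * m) (cP (cS (cP w)))" for w
    by (cases w) (simp add: Y_def cP_def cS_def cvec_def cip_def)
  have cP_e: "cip (cP f) e = 0" for f unfolding cP_def by (rule cip_P)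
  have cP_id: "cP f = f" if "cip f e = 0" for f
    using that by (simp add: cP_def map_prod_P)
  have cPeq: "cP f = f - cvec (cip f e) e" for f by (simp add: cP_def map_prod_P)
  have Y_e: "cip (?Y w) e = cip w e" for w
    unfolding Yeq by (simp add: cip_add cip_cmul cP_e cip_e)
  \<comment> \<open>The second row paired with \<open>e\<close> loses \<open>C u\<close> and
    determines the component of \<open>v\<close> along \<open>e\<close>.\<close>
  define a where "a g = - cip (snd g) e / m" for g :: "('h \<times> 'h) \<times> ('h \<times> 'h)"
  define k0 where "k0 g = - cP (snd g)" for g :: "('h \<times> 'h) \<times> ('h \<times> 'h)"
  \<comment> \<open>Right-hand side of the projected first row after inserting v = a e + w and the
    part S (k0 - m w) of u orthogonal to e: the known terms are collected here, the terms in w form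
    \<open>?Y\<close>.\<close>
  define h where "h g = cP (fst g + cmul l (cS (k0 g)) - cvec (a g) (D e))" for g
  define w where "w g = W (h g)" for g
  define v where "v g = cvec (a g) e + w g" for g
  define k where "k g = k0 g - cmul m (w g)" for g
  define \<alpha> where "\<alpha> g = (cip (v g) (D e) - cip (fst g) e) / l" for g
  define u where "u g = cS (k g) + cvec (\<alpha> g) e" for g
  note bl = bounded_linear_add bounded_linear_sub bounded_linear_minus bounded_linear_ident
    bounded_linear_fst bounded_linear_snd bounded_linear_compose[OF bounded_linear_cip]
    bounded_linear_compose[OF bounded_linear_cmul] bounded_linear_compose[OF bounded_linear_cvec]
    bounded_linear_compose[OF cS(1)] bounded_linear_compose[OF cP] bounded_linear_compose[OF W(1)]
    bounded_linear_compose[OF bounded_linear_divide]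
  have a: "bounded_linear a" unfolding a_def by (intro bl)
  have k0: "bounded_linear k0" unfolding k0_def by (intro bl)
  have h: "bounded_linear h" unfolding h_def by (intro bl a k0)
  have w: "bounded_linear w" unfolding w_def by (intro bl h)
  have v: "bounded_linear v" unfolding v_def by (intro bl w a)
  have k: "bounded_linear k" unfolding k_def by (intro bl w k0)
  have \<alpha>: "bounded_linear \<alpha>" unfolding \<alpha>_def by (intro bl v)
  have u: "bounded_linear u" unfolding u_def by (intro bl k \<alpha>)
  have dom: "w g \<in> ?X" "v g \<in> ?X" "u g \<in> ?X" for g
    unfolding w_def v_def u_def by (intro W cdom_add cvec_dom e_dom cS)+
  \<comment> \<open>By \<open>Y_e\<close> the padded operator preserves the component along
    \<open>e\<close>, and \<open>h g\<close> has none.\<close>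
  have we: "cip (w g) e = 0" for g
    using Y_e[of "w g"] W(3)[of "h g"] by (simp add: w_def h_def cP_e)
  have k0e: "cip (k0 g) e = 0" for g by (simp add: k0_def cip_minus cP_e)
  have ke: "cip (k g) e = 0" for g by (simp add: k_def k0e we cip_diff cip_cmul)
  have sol: "system l m (u g, v g) = g" for g
  proof -
    have "cC (u g) = k g"
      using cS_e(2)[OF ke, of g] by (simp add: u_def cC_lin cS cvec_dom e_dom del: map_prod_simp)
    then have "- cC (u g) - cmul m (v g) = cP (snd g) - cmul m (cvec (a g) e)"
      by (simp add: k_def k0_def v_def cmul_add_right)
    also have "cmul m (cvec (a g) e) = - cvec (cip (snd g) e) e"
      using m by (simp add: cmul_cvec a_def) (simp add: cvec_def)
    finally have 2: "- cC (u g) - cmul m (v g) = snd g" by (simp add: cPeq)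
    \<comment> \<open>Residual of the first row without the summand \<alpha> e of u. The reduced
      equation makes it a multiple of \<open>e\<close>, and \<alpha> is chosen to cancel that
      multiple.\<close>
    define r where "r = cD (v g) - cmul l (cS (k g)) - fst g"
    have cDv: "cD (v g) = cvec (a g) (D e) + cD (w g)"
      unfolding v_def using dom e_dom by (simp add: cD_lin cvec_dom del: map_prod_simp)
    have "h g = cP (cD (w g)) + cmul (l * m) (cP (cS (w g)))"
      using W(3)[of "h g"] unfolding Yeq w_def[symmetric] by (simp add: we cP_id)
    also have "cmul (l * m) (cP (cS (w g))) = cP (cmul (l * m) (cS (w g)))"
      by (simp add: cPeq cip_cmul cmul_diff_right cmul_cvec)
    finally have "cP (cD (w g) + cmul (l * m) (cS (w g))) = cP (fst g + cmul l (cS (k0 g)) - cvec (a g) (D e))"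
      by (simp add: h_def cP.add)
    then have "cP ((cD (w g) + cmul (l * m) (cS (w g))) - (fst g + cmul l (cS (k0 g)) - cvec (a g) (D e))) = 0"
      by (simp only: cP.diff) simp
    also have "(cD (w g) + cmul (l * m) (cS (w g))) - (fst g + cmul l (cS (k0 g)) - cvec (a g) (D e)) = r"
      by (simp add: r_def cDv k_def cS.diff cS_cmul cmul_diff_right cmul_cmul algebra_simps del: map_prod_simp)
    finally have "r = cvec (cip r e) e" by (simp add: cPeq)
    also have "cip r e = l * \<alpha> g"
      using l by (simp add: r_def cip_diff cip_cD dom cip_cmul cS_e ke \<alpha>_def del: map_prod_simp)
    finally have "cD (v g) - cmul l (u g) = fst g"
      by (simp add: r_def u_def cmul_add_right cmul_cvec algebra_simps del: map_prod_simp)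
    with 2 show ?thesis by (simp add: system_def)
  qed
  have inj: "x = 0" if x: "x \<in> ?X \<times> ?X" "system l m x = 0" for x
  proof -
    obtain p q where pq: "x = (p, q)" "p \<in> ?X" "q \<in> ?X" using x by blast
    have "(cD q - cmul l p, - cC p - cmul m q) = (0, 0)"
      using x(2) by (simp add: system_def pq(1) zero_prod_def del: map_prod_simp)
    then have 1: "cD q = cmul l p" and 2: "cC p = - cmul m q"
      by (simp_all del: map_prod_simp add: neg_eq_iff_add_eq_0 eq_neg_iff_add_eq_0 add.commute)
    have "m * cip q e = 0" using cip_cC[OF pq(2)] unfolding 2 by (simp add: cip_minus cip_cmul)
    then have qe: "cip q e = 0" using m by simp
    \<comment> \<open>\<open>C p\<close> is \<open>- m q\<close> while \<open>C (S q) = q\<close>,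
      so the sum \<open>y\<close> lies in the kernel of \<open>C\<close>.\<close>
    have pS: "cP p = - cmul m (cS q)"
    proof -
      define y where "y = p + cmul m (cS q)"
      have y: "y \<in> ?X" unfolding y_def by (intro cdom_add pq cmul_dom cS)
      have "cC y = 0" unfolding y_def
        using cS_e(2)[OF qe] 2 by (simp add: cC_lin pq cmul_dom cS del: map_prod_simp)
      \<comment> \<open>\<open>kernel_chain\<close> with \<open>v = 0\<close>,
        \<open>\<beta> = 1\<close> and \<open>a = 0\<close> identifies the kernel of
        \<open>C\<close> with the span of \<open>e\<close>.\<close>
      have *: "P f = 0" if "f \<in> X" "C f = 0" for f
        using kernel_chain(3)[of f 0 1 0] that dom_0 D_scale[OF dom_0, of 0] by (simp add: P_def)
      have "cP y = 0" using *[of "fst y"] *[of "snd y"] y \<open>cC y = 0\<close>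
        by (cases y) (simp add: cP_def zero_prod_def)
      moreover have "cP y = cP p + cmul m (cS q)"
        unfolding y_def using cS_e(1)[OF qe] by (simp add: cP.add) (simp add: cPeq cip_cmul)
      ultimately show ?thesis by (simp add: eq_neg_iff_add_eq_0)
    qed
    have "cP (cD q) = cmul l (cP p)" unfolding 1 by (simp add: cPeq cmul_diff_right cip_cmul cmul_cvec)
    then have "cP (cD q) + cmul (l * m) (cS q) = 0"
      by (simp add: pS cmul_minus_right cmul_cmul)
    then have "?Y q = 0" unfolding Yeq using qe cS_e(1)[OF qe] by (simp add: cP_id)
    then have "q = 0" using W(4)[OF pq(3)] linear_0[OF bounded_linear.linear[OF W(1)]] by simp
    moreover from this have "cmul l p = 0" using 1 cD_lin(4)[of 0] by simp
    then have "cmul (1 / l) (cmul l p) = 0" by simp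
    then have "p = 0" using l by (simp add: cmul_cmul)
    ultimately show ?thesis using pq by (simp add: zero_prod_def)
  qed
  have uv: "bounded_linear (\<lambda>g. (u g, v g))" by (intro bounded_linear_Pair u v)
  obtain K where K: "\<And>g. norm (u g, v g) \<le> norm g * K" using bounded_linear.bounded[OF uv] by blast
  have "norm x \<le> K * norm (system l m x)" if "x \<in> ?X \<times> ?X" for x
  proof -
    let ?y = "(u (system l m x), v (system l m x))"
    have y: "?y \<in> ?X \<times> ?X" using dom by simp
    have "system l m (x - ?y) = 0" unfolding system_diff[OF that y] sol by simp
    moreover have "x - ?y \<in> ?X \<times> ?X"
      using that dom cdom_diff[of "fst x" "fst ?y"] cdom_diff[of "snd x" "snd ?y"]
      by (simp add: mem_Times_iff)
    ultimately have "x = ?y" using inj by fastforce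
    then show ?thesis using K[of "system l m x"] by (simp add: mult.commute)
  qed
  moreover have "\<exists>x\<in>?X \<times> ?X. system l m x = g" for g using sol[of g] dom by blast
  ultimately show ?thesis by blast
qed

end

section \<open>Weak derivatives on the real line\<close>

definition smooth :: "(real \<Rightarrow> real) \<Rightarrow> bool" where
  "smooth f \<longleftrightarrow> (\<forall>k z. (deriv ^^ k) f differentiable at z)"

text \<open>Replaces formulas for iterated derivatives: each use picks a class of functions large
  enough to be closed under \<open>deriv\<close>.\<close>

lemma smooth_coinduct:
  assumes "f \<in> P" and "\<And>f z. f \<in> P \<Longrightarrow> f differentiable at z" and "\<And>f. f \<in> P \<Longrightarrow> deriv f \<in> P"
  shows "smooth f"
proof -
  have "(deriv ^^ k) f \<in> P" for k by (induction k) (auto simp: assms)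
  then show ?thesis unfolding smooth_def using assms(2) by blast
qed

lemma smooth_differentiable: "smooth f \<Longrightarrow> f differentiable at z"
  unfolding smooth_def by (metis funpow_0)

lemma smooth_deriv: "smooth f \<Longrightarrow> smooth (deriv f)"
  unfolding smooth_def by (metis comp_apply funpow_Suc_right)

lemma smooth_has_deriv: "smooth f \<Longrightarrow> (f has_real_derivative deriv f z) (at z)"
  using smooth_differentiable[of f z] by (simp add: DERIV_deriv_iff_real_differentiable)

lemma smooth_antideriv:
  assumes "\<And>z. (f has_real_derivative g z) (at z)" "smooth g"
  shows "smooth f"
proof -
  have "deriv f = g" using assms(1) by (intro ext DERIV_imp_deriv)
  moreover have "f differentiable at z" for z
    using assms(1)[of z] real_differentiable_def by blast
  ultimately have "(deriv ^^ k) f differentiable at z" for k z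
    using assms(2) by (cases k) (simp_all add: smooth_def funpow_Suc_right del: funpow.simps)
  then show ?thesis by (simp add: smooth_def)
qed

lemma smooth_continuous: "smooth f \<Longrightarrow> continuous_on S f"
  by (meson continuous_at_imp_continuous_on differentiable_imp_continuous_within smooth_differentiable)

lemma smooth_mult:
  assumes "smooth f" "smooth g"
  shows "smooth (\<lambda>x. f x * g x)"
proof (rule smooth_coinduct)
  \<comment> \<open>Single products are not closed under differentiation. By the Leibniz rule finite
    sums of products are; they are encoded as lists of pairs of factors.\<close>
  let ?P = "{h. \<exists>fs. (\<forall>(f, g)\<in>set fs. smooth f \<and> smooth g) \<and> h = (\<lambda>x. \<Sum>(f, g)\<leftarrow>fs. f x * g x)}"
  show "(\<lambda>x. f x * g x) \<in> ?P" using assms by (auto intro!: exI[of _ "[(f, g)]"])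
  have *: "((\<lambda>x. \<Sum>(f, g)\<leftarrow>fs. f x * g x) has_real_derivative
      (\<Sum>(f, g)\<leftarrow>concat (map (\<lambda>(f, g). [(deriv f, g), (f, deriv g)]) fs). f z * g z)) (at z)"
    if "\<forall>(f, g)\<in>set fs. smooth f \<and> smooth g" for fs z
    using that
    by (induction fs) (auto intro!: derivative_eq_intros smooth_has_deriv)
  fix h assume "h \<in> ?P"
  then obtain fs where fs: "\<forall>(f, g)\<in>set fs. smooth f \<and> smooth g"
    and h: "h = (\<lambda>x. \<Sum>(f, g)\<leftarrow>fs. f x * g x)" by blast
  show "h differentiable at z" for z
    using *[OF fs, of z] real_differentiable_def unfolding h by blast
  have "deriv h = (\<lambda>z. \<Sum>(f, g)\<leftarrow>concat (map (\<lambda>(f, g). [(deriv f, g), (f, deriv g)]) fs). f z * g z)"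
    unfolding h using *[OF fs] by (intro ext DERIV_imp_deriv)
  moreover have "\<forall>(f, g)\<in>set (concat (map (\<lambda>(f, g). [(deriv f, g), (f, deriv g)]) fs)). smooth f \<and> smooth g"
    using fs by (auto intro: smooth_deriv)
  ultimately show "deriv h \<in> ?P" by blast
qed

lemma smooth_affine:
  assumes "smooth f"
  shows "smooth (\<lambda>x. c * f (p * x + q))"
proof (rule smooth_coinduct)
  let ?P = "{\<lambda>x. c * f (p * x + q) |c f. smooth f}"
  show "(\<lambda>x. c * f (p * x + q)) \<in> ?P" using assms by blast
  have *: "((\<lambda>x. c * f (p * x + q)) has_real_derivative (c * p) * deriv f (p * z + q)) (at z)"
    if "smooth f" for c f z
    by (auto intro!: derivative_eq_intros DERIV_chain2[where f = f] smooth_has_deriv that)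
  fix h assume "h \<in> ?P"
  then obtain c f where f: "smooth f" and h: "h = (\<lambda>x. c * f (p * x + q))" by blast
  show "h differentiable at z" for z
    using *[OF f, of c z] real_differentiable_def unfolding h by blast
  have "deriv h = (\<lambda>z. (c * p) * deriv f (p * z + q))"
    unfolding h using *[OF f] by (intro ext DERIV_imp_deriv)
  then show "deriv h \<in> ?P" using smooth_deriv[OF f] by blast
qed

lemma smooth_scale: "smooth f \<Longrightarrow> smooth (\<lambda>x. c * f x)"
  using smooth_affine[of f c 1 0] by simp

lemma smooth_add:
  assumes "smooth f" "smooth g"
  shows "smooth (\<lambda>x. f x + g x)"
proof (rule smooth_coinduct)
  let ?P = "{\<lambda>x. f x + g x |f g. smooth f \<and> smooth g}"
  show "(\<lambda>x. f x + g x) \<in> ?P" using assms by blast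
  fix h assume "h \<in> ?P"
  then obtain f g where f: "smooth f" "smooth g" and h: "h = (\<lambda>x. f x + g x)" by blast
  have *: "(h has_real_derivative deriv f z + deriv g z) (at z)" for z
    unfolding h by (intro derivative_intros smooth_has_deriv f)
  then show "h differentiable at z" for z using real_differentiable_def by blast
  have "deriv h = (\<lambda>z. deriv f z + deriv g z)" using * by (intro ext DERIV_imp_deriv)
  then show "deriv h \<in> ?P" using smooth_deriv f by blast
qed

definition flat :: "real \<Rightarrow> real" where
  "flat x = (if x > 0 then exp (- (1 / x)) else 0)"

lemma poly_exp_decay: "((\<lambda>y::real. poly p y * exp (- y)) \<longlongrightarrow> 0) at_top"
proof -
  have "((\<lambda>y. \<Sum>i\<le>degree p. coeff p i * (y ^ i / exp y)) \<longlongrightarrow> (\<Sum>i\<le>degree p. coeff p i * 0)) at_top"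
    by (intro tendsto_sum tendsto_mult tendsto_const tendsto_power_div_exp_0)
  then show ?thesis
    by (simp add: poly_altdef exp_minus sum_distrib_left sum_distrib_right divide_inverse mult_ac)
qed

lemma smooth_flat: "smooth flat"
proof (rule smooth_coinduct)
  \<comment> \<open>With y = 1/x the derivative of p(y) exp(-y) is y^2 (p(y) - p'(y)) exp(-y),
    because dy/dx = -y^2. So the family is closed under \<open>deriv\<close>, and
    \<open>[:0, 0, 1:]\<close> is the factor y^2.\<close>
  define E where "E p x = (if x > 0 then poly p (1 / x) * exp (- (1 / x)) else 0)" for p and x :: real
  have "flat = E 1" by (auto simp: flat_def E_def)
  then show "flat \<in> range E" by blast
  have *: "(E p has_real_derivative E ([:0, 0, 1:] * (p - pderiv p)) x) (at x)" for p x
  proof -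
    consider "x > 0" | "x < 0" | "x = 0" by linarith
    then show ?thesis
    proof cases
      case 1
      have "((\<lambda>x. poly p (1 / x) * exp (- (1 / x))) has_real_derivative E ([:0, 0, 1:] * (p - pderiv p)) x) (at x)"
        using 1 by (auto intro!: derivative_eq_intros simp: E_def field_simps power2_eq_square)
      then show ?thesis
        by (rule has_field_derivative_transform_within_open[where S = "{0<..}"])
          (use 1 in \<open>auto simp: E_def\<close>)
    next
      case 2
      have "((\<lambda>_. 0) has_real_derivative E ([:0, 0, 1:] * (p - pderiv p)) x) (at x)"
        using 2 by (simp add: E_def)
      then show ?thesis
        by (rule has_field_derivative_transform_within_open[where S = "{..<0}"])
          (use 2 in \<open>auto simp: E_def\<close>)
    next
      case 3
      \<comment> \<open>The difference quotient at 0 is y p(y) exp(-y) with y = 1/h, which is why p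
        is multiplied by \<open>[:0, 1:]\<close>.\<close>
      have "((\<lambda>h. poly ([:0, 1:] * p) (inverse h) * exp (- (inverse h))) \<longlongrightarrow> 0) (at_right 0)"
        by (rule filterlim_compose[OF poly_exp_decay filterlim_inverse_at_top_right])
      then have "((\<lambda>h. E p h / h) \<longlongrightarrow> 0) (at_right 0)"
        by (rule Lim_transform_eventually)
          (auto simp: E_def eventually_at_filter field_simps)
      moreover have "((\<lambda>h. E p h / h) \<longlongrightarrow> 0) (at_left 0)"
        by (rule Lim_transform_eventually[OF tendsto_const])
          (auto simp: E_def eventually_at_filter)
      ultimately have "((\<lambda>h. E p h / h) \<longlongrightarrow> 0) (at 0)"
        by (simp add: filterlim_at_split)
      then show ?thesis using 3 by (simp add: DERIV_def E_def)
    qed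
  qed
  fix h assume "h \<in> range E"
  then obtain p where h: "h = E p" by blast
  show "h differentiable at z" for z using *[of p z] real_differentiable_def unfolding h by blast
  have "deriv h = E ([:0, 0, 1:] * (p - pderiv p))" unfolding h using * by (intro ext DERIV_imp_deriv)
  then show "deriv h \<in> range E" by blast
qed

lemma flat_bounds: "0 \<le> flat x" "flat x \<le> 1"
  by (auto simp: flat_def)

lemma test_function_iff:
  "test_function \<phi> \<longleftrightarrow> smooth \<phi> \<and> (\<exists>R. \<forall>x. R < \<bar>x\<bar> \<longrightarrow> \<phi> x = 0)"
proof -
  have "compact (closure {z. \<phi> z \<noteq> 0}) \<longleftrightarrow> (\<exists>R. \<forall>x. R < \<bar>x\<bar> \<longrightarrow> \<phi> x = 0)"
    by (auto simp: compact_closure bounded_iff not_less[symmetric])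
  then show ?thesis by (simp add: test_function_def smooth_def)
qed

text \<open>Increasing \<open>n\<close> steepens both flanks inside a fixed support: the values stay
  below 1 and tend to the indicator of the open interval, as dominated convergence requires.\<close>

definition bump :: "real \<Rightarrow> real \<Rightarrow> nat \<Rightarrow> real \<Rightarrow> real" where
  "bump a b n x = flat (real n * (x - a)) * flat (real n * (b - x))"

lemma bump_smooth: "smooth (bump a b n)"
proof -
  have "smooth (\<lambda>x. (1 * flat (real n * x + - real n * a)) * (1 * flat (- real n * x + real n * b)))"
    by (intro smooth_mult smooth_affine smooth_flat)
  then show ?thesis unfolding bump_def by (simp add: algebra_simps)
qed

lemma bump_outside: "x \<notin> {a..b} \<Longrightarrow> bump a b n x = 0"
  by (auto simp: bump_def flat_def zero_less_mult_iff)

lemma bump_test: "test_function (bump a b n)"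
  unfolding test_function_iff
  by (intro conjI bump_smooth exI[of _ "max \<bar>a\<bar> \<bar>b\<bar>"] allI impI bump_outside) auto

lemma bump_bounds: "0 \<le> bump a b n x" "bump a b n x \<le> 1"
  using flat_bounds by (auto simp: bump_def intro: mult_le_one)

lemma bump_limit: "(\<lambda>n. bump a b n x) \<longlonglongrightarrow> indicator {a<..<b} x"
proof (cases "x \<in> {a<..<b}")
  case True
  have *: "(\<lambda>n. flat (real n * c)) \<longlonglongrightarrow> 1" if "c > 0" for c
  proof -
    have "(\<lambda>n. exp (- (inverse (real n) / c))) \<longlonglongrightarrow> exp (- (0 / c))"
      using that by (intro tendsto_intros lim_inverse_n) auto
    moreover have "eventually (\<lambda>n. exp (- (inverse (real n) / c)) = flat (real n * c)) sequentially"
      using eventually_gt_at_top[of 0] by eventually_elim (use that in \<open>auto simp: flat_def field_simps\<close>)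
    ultimately show ?thesis by (simp add: Lim_transform_eventually)
  qed
  show ?thesis unfolding bump_def using True tendsto_mult[OF *[of "x - a"] *[of "b - x"]] by simp
next
  case False
  then have "bump a b n x = 0" for n
    by (auto simp: bump_def flat_def zero_less_mult_iff not_less)
  with False show ?thesis by simp
qed

section \<open>Locally integrable functions and their antiderivatives\<close>

lemma locally_integrable_iff:
  "locally_integrable f \<longleftrightarrow> (\<forall>a b. set_integrable lborel {a..b} f)"
proof
  assume *: "\<forall>a b. set_integrable lborel {a..b} f"
  show "locally_integrable f"
    unfolding locally_integrable_def
  proof (intro allI impI)
    fix K :: "real set" assume "compact K"
    then obtain r where "K \<subseteq> {- r..r}"
      using compact_imp_bounded[of K] bounded_subset_cbox_symmetric[of K] by auto
    then show "set_integrable lborel K f"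
      using set_integrable_subset[of lborel "{-r..r}" f K] * \<open>compact K\<close>
      by (simp add: borel_compact)
  qed
qed (simp add: locally_integrable_def)

lemma locally_integrable_set: "locally_integrable f \<Longrightarrow> set_integrable lborel {a..b} f"
  by (simp add: locally_integrable_iff)

lemma locally_integrable_measurable:
  fixes f :: "real \<Rightarrow> 'a::euclidean_space"
  assumes "locally_integrable f"
  shows "f \<in> borel_measurable borel"
proof (rule borel_measurable_LIMSEQ_metric)
  show "(\<lambda>x. indicator {- real n..real n} x *\<^sub>R f x) \<in> borel_measurable borel" for n
    using locally_integrable_set[OF assms, of "- real n" "real n"]
    unfolding set_integrable_def by (auto dest: borel_measurable_integrable)
  show "(\<lambda>n. indicator {- real n..real n} x *\<^sub>R f x) \<longlonglongrightarrow> f x" for x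
  proof (rule tendsto_eventually)
    obtain m where "\<bar>x\<bar> \<le> real m" using real_arch_simple by blast
    then show "\<forall>\<^sub>F n in sequentially. indicator {- real n..real n} x *\<^sub>R f x = f x"
      by (intro eventually_sequentiallyI[of m]) (auto simp: indicator_def)
  qed
qed

lemma locally_integrable_add:
  "locally_integrable f \<Longrightarrow> locally_integrable g \<Longrightarrow> locally_integrable (\<lambda>x. f x + g x)"
  by (simp add: locally_integrable_iff set_integral_add)

lemma locally_integrable_diff:
  "locally_integrable f \<Longrightarrow> locally_integrable g \<Longrightarrow> locally_integrable (\<lambda>x. f x - g x)"
  by (simp add: locally_integrable_iff set_integral_diff)

lemma locally_integrable_continuous:
  "continuous_on UNIV f \<Longrightarrow> locally_integrable f"
  unfolding locally_integrable_iff set_integrable_def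
  by (auto intro!: borel_integrable_compact continuous_on_subset[of UNIV f])

lemma locally_integrable_mult_continuous:
  fixes f k :: "real \<Rightarrow> real"
  assumes "continuous_on UNIV f" "locally_integrable k"
  shows "locally_integrable (\<lambda>x. f x * k x)"
  unfolding locally_integrable_iff
proof (intro allI)
  fix a b
  have [measurable]: "f \<in> borel_measurable borel" "k \<in> borel_measurable borel"
    using assms by (auto intro: borel_measurable_continuous_onI locally_integrable_measurable)
  have "bounded (f ` {a..b})"
    using assms(1) by (intro compact_imp_bounded compact_continuous_image) (auto intro: continuous_on_subset)
  then obtain B where B: "\<And>x. x \<in> {a..b} \<Longrightarrow> \<bar>f x\<bar> \<le> B"
    unfolding bounded_iff real_norm_def by blast
  show "set_integrable lborel {a..b} (\<lambda>x. f x * k x)"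
    unfolding set_integrable_def
  proof (rule Bochner_Integration.integrable_bound)
    show "integrable lborel (\<lambda>x. B * (indicator {a..b} x *\<^sub>R k x))"
      using locally_integrable_set[OF assms(2), of a b] by (simp add: set_integrable_def)
    show "AE x in lborel. norm (indicator {a..b} x *\<^sub>R (f x * k x)) \<le> norm (B * (indicator {a..b} x *\<^sub>R k x))"
    proof (intro AE_I2)
      fix x show "norm (indicator {a..b} x *\<^sub>R (f x * k x)) \<le> norm (B * (indicator {a..b} x *\<^sub>R k x))"
        using B[of x] by (cases "x \<in> {a..b}") (auto simp: abs_mult intro!: mult_right_mono)
    qed
  qed simp
qed

lemma locally_integrable_cong_AE:
  fixes f g :: "real \<Rightarrow> 'a::euclidean_space"
  assumes "AE x in lborel. f x = g x" "locally_integrable f" "g \<in> borel_measurable borel"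
  shows "locally_integrable g"
  unfolding locally_integrable_iff set_integrable_def
proof (intro allI)
  fix a b
  show "integrable lborel (\<lambda>x. indicat_real {a..b} x *\<^sub>R g x)"
    using locally_integrable_set[OF assms(2), of a b] unfolding set_integrable_def
    by (rule integrable_cong_AE_imp) (use assms in auto)
qed

text \<open>Truncation to \<open>{- real n..real n}\<close> makes the function integrable; its set
  integrals then vanish on all Borel sets, since intervals generate these.\<close>

lemma AE_zero_of_set_integrals:
  fixes k :: "real \<Rightarrow> real"
  assumes k: "locally_integrable k" and 0: "\<And>a b. a \<le> b \<Longrightarrow> (LINT x:{a..b}|lborel. k x) = 0"
  shows "AE x in lborel. k x = 0"
proof -
  have "AE x in lborel. indicator {- real n..real n} x *\<^sub>R k x = 0" for n
  proof (rule sigma_finite_measure.density_zero[OF lborel.sigma_finite_measure_axioms])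
    let ?k = "\<lambda>x. indicat_real {- real n..real n} x *\<^sub>R k x"
    show int: "integrable lborel ?k"
      using locally_integrable_set[OF k] by (simp add: set_integrable_def)
    have si: "set_integrable lborel A ?k" if "A \<in> sets borel" for A
      unfolding set_integrable_def by (rule integrable_mult_indicator[OF _ int]) (use that in simp)
    fix A assume "A \<in> sets (lborel :: real measure)"
    then have "A \<in> sets borel" by simp
    then show "(LINT x:A|lborel. ?k x) = 0"
    proof (induction rule: borel_set_induct)
      case empty
      then show ?case by (simp add: set_lebesgue_integral_def)
    next
      case (interval a b)
      have "(LINT x:{a..b}|lborel. ?k x) = (LINT x:{max a (- real n)..min b (real n)}|lborel. k x)"
        unfolding set_lebesgue_integral_def
        by (rule Bochner_Integration.integral_cong) (auto simp: indicator_def)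
      also have "\<dots> = 0"
        using 0 by (cases "max a (- real n) \<le> min b (real n)") (auto simp: set_lebesgue_integral_def)
      finally show ?case .
    next
      case (compl A)
      have "(LINT x|lborel. ?k x) = (LINT x:{- real n..real n}|lborel. k x)"
        by (simp add: set_lebesgue_integral_def)
      also have "\<dots> = 0" by (rule 0) simp
      finally have "(LINT x:UNIV|lborel. ?k x) = 0" by (simp add: set_lebesgue_integral_def)
      moreover have "(LINT x:A \<union> - A|lborel. ?k x) = (LINT x:A|lborel. ?k x) + (LINT x:-A|lborel. ?k x)"
        by (intro set_integral_Un si) (use compl in auto)
      ultimately show ?case using compl by simp
    next
      case (union A)
      have "(LINT x:(\<Union>i. A i)|lborel. ?k x) = (\<Sum>i. LINT x:A i|lborel. ?k x)"
      proof (rule lebesgue_integral_countable_add)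
        show "set_integrable lborel (\<Union>i. A i) ?k" by (rule si) (use union in auto)
      qed (use union in \<open>auto simp: disjoint_family_on_def\<close>)
      then show ?case using union by simp
    qed
  qed
  then have "AE x in lborel. \<forall>n. indicator {- real n..real n} x *\<^sub>R k x = 0"
    unfolding AE_all_countable by blast
  then show ?thesis
  proof eventually_elim
    case (elim x)
    obtain n where "\<bar>x\<bar> \<le> real n" using real_arch_simple by blast
    then show ?case using elim[rule_format, of n] by (auto simp: indicator_def)
  qed
qed

text \<open>Local absolute continuity in integral form. \<open>F\<close> is an actual continuous
  function, while \<open>f\<close> matters only up to null sets.\<close>

definition antideriv :: "(real \<Rightarrow> real) \<Rightarrow> (real \<Rightarrow> real) \<Rightarrow> bool" where
  "antideriv F f \<longleftrightarrow> locally_integrable f \<and> (\<forall>a b. a \<le> b \<longrightarrow> F b - F a = (LINT x:{a..b}|lborel. f x))"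

lemma antiderivD:
  assumes "antideriv F f"
  shows "locally_integrable f" "a \<le> b \<Longrightarrow> F b - F a = (LINT x:{a..b}|lborel. f x)"
  using assms by (auto simp: antideriv_def)

lemma set_integral_combine:
  fixes f :: "real \<Rightarrow> real"
  assumes "locally_integrable f" "a \<le> b" "b \<le> c"
  shows "(LINT x:{a..c}|lborel. f x) = (LINT x:{a..b}|lborel. f x) + (LINT x:{b..c}|lborel. f x)"
proof -
  have "(LINT x:{a..b} \<union> {b..c}|lborel. f x) = (LINT x:{a..b}|lborel. f x) + (LINT x:{b..c}|lborel. f x)"
  proof (rule set_integral_Un_AE)
    have "AE x in lborel. x \<noteq> b" by (rule AE_lborel_singleton)
    then show "AE x in lborel. \<not> (x \<in> {a..b} \<and> x \<in> {b..c})" by eventually_elim auto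
  qed (use assms locally_integrable_set in auto)
  then show ?thesis using assms by (simp add: ivl_disj_un_two_touch)
qed

lemma antideriv_exists:
  assumes "locally_integrable f"
  obtains F where "antideriv F f"
proof -
  define F where "F x = (if x \<ge> 0 then LINT x:{0..x}|lborel. f x else - (LINT x:{x..0}|lborel. f x))" for x
  have "F b - F a = (LINT x:{a..b}|lborel. f x)" if "a \<le> b" for a b
  proof -
    consider "0 \<le> a" | "a < 0" "0 \<le> b" | "b < 0" using that by linarith
    then show ?thesis
    proof cases
      case 1 then show ?thesis using that set_integral_combine[OF assms, of 0 a b] by (simp add: F_def)
    next
      case 2 then show ?thesis using that set_integral_combine[OF assms, of a 0 b] by (simp add: F_def)
    next
      case 3 then show ?thesis using that set_integral_combine[OF assms, of a b 0] by (simp add: F_def)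
    qed
  qed
  then have "antideriv F f" using assms unfolding antideriv_def by blast
  then show ?thesis by (rule that)
qed

lemma antideriv_integral:
  assumes "antideriv F f" "a \<le> y"
  shows "F a + integral {a..y} f = F y"
proof -
  have "F y - F a = (LINT t:{a..y}|lborel. f t)" by (rule antiderivD(2)[OF assms])
  also have "\<dots> = integral {a..y} f"
    by (intro set_borel_integral_eq_integral locally_integrable_set antiderivD(1)[OF assms(1)])
  finally show ?thesis by simp
qed

lemma antideriv_continuous:
  assumes "antideriv F f"
  shows "continuous_on UNIV F"
proof -
  have "isCont F x" for x
  proof -
    have "f integrable_on {x - 1..x + 1}"
      by (intro set_borel_integral_eq_integral locally_integrable_set antiderivD(1)[OF assms])
    then have "continuous_on {x - 1..x + 1} (\<lambda>y. F (x - 1) + integral {x - 1..y} f)"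
      by (intro continuous_intros indefinite_integral_continuous_1)
    then have "continuous_on {x - 1..x + 1} F"
      by (rule continuous_on_eq) (simp add: antideriv_integral[OF assms])
    then show ?thesis by (rule continuous_on_interior) auto
  qed
  then show ?thesis by (simp add: continuous_at_imp_continuous_on)
qed

lemma antideriv_C1:
  assumes "\<And>x. (F has_real_derivative f x) (at x)" "continuous_on UNIV f"
  shows "antideriv F f"
  unfolding antideriv_def
proof (intro conjI allI impI locally_integrable_continuous assms)
  fix a b :: real assume "a \<le> b"
  then have "(LINT x|lborel. f x * indicator {a..b} x) = F b - F a"
    using assms by (intro integral_FTC_Icc_real) (auto simp: continuous_on_eq_continuous_at)
  then show "F b - F a = (LINT x:{a..b}|lborel. f x)"
    by (simp add: set_lebesgue_integral_def mult.commute)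
qed

lemma antideriv_smooth: "smooth f \<Longrightarrow> antideriv f (deriv f)"
  by (intro antideriv_C1 smooth_has_deriv smooth_continuous smooth_deriv)

lemma antideriv_cong_AE:
  assumes "antideriv F f" "AE x in lborel. f x = g x" "g \<in> borel_measurable borel"
  shows "antideriv F g"
  unfolding antideriv_def
proof (intro conjI allI impI)
  show "locally_integrable g" using locally_integrable_cong_AE assms antiderivD by blast
  fix a b :: real assume "a \<le> b"
  have [measurable]: "f \<in> borel_measurable borel" using assms antiderivD locally_integrable_measurable by blast
  have "(LINT x:{a..b}|lborel. f x) = (LINT x:{a..b}|lborel. g x)"
    unfolding set_lebesgue_integral_def
    by (rule integral_cong_AE) (use assms in auto)
  then show "F b - F a = (LINT x:{a..b}|lborel. g x)" using antiderivD(2)[OF assms(1) \<open>a \<le> b\<close>] by simp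
qed

lemma antideriv_zero:
  assumes "antideriv F f" "AE x in lborel. f x = 0"
  shows "F x = F y"
proof -
  have "antideriv F (\<lambda>_. 0)" using antideriv_cong_AE[OF assms] by simp
  then have "a \<le> b \<Longrightarrow> F b = F a" for a b
    using antiderivD(2)[of F "\<lambda>_. 0" a b] by (simp add: set_lebesgue_integral_def)
  then show ?thesis by (metis linear)
qed

text \<open>Integration by parts for functions vanishing at \<^term>\<open>a\<close>: both sides are the integral of
  \<^term>\<open>f x * g y\<close> over a square, cut along its diagonal.\<close>

lemma Fubini_triangle:
  fixes f g :: "real \<Rightarrow> real"
  assumes f: "locally_integrable f" and g: "locally_integrable g" and ab: "a \<le> b"
  shows "(LINT x:{a..b}|lborel. f x) * (LINT y:{a..b}|lborel. g y) =
    (LINT x:{a..b}|lborel. f x * (LINT y:{a..x}|lborel. g y)) +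
    (LINT y:{a..b}|lborel. (LINT x:{a..y}|lborel. f x) * g y)"
proof -
  define f' where "f' x = indicator {a..b} x * f x" for x
  define g' where "g' x = indicator {a..b} x * g x" for x
  have int: "integrable lborel f'" "integrable lborel g'"
    using locally_integrable_set[OF f, of a b] locally_integrable_set[OF g, of a b]
    by (simp_all add: f'_def[abs_def] g'_def[abs_def] set_integrable_def)
  have [measurable]: "f' \<in> borel_measurable borel" "g' \<in> borel_measurable borel"
    using int by (auto dest: borel_measurable_integrable)
  have int2: "integrable (lborel \<Otimes>\<^sub>M lborel) (\<lambda>(x, y). f' x * g' y)"
  proof (rule lborel_pair.Fubini_integrable)
    show "integrable lborel (\<lambda>x. LINT y|lborel. norm (case (x, y) of (x, y) \<Rightarrow> f' x * g' y))"
      using int by (simp add: abs_mult)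
    show "AE x in lborel. integrable lborel (\<lambda>y. case (x, y) of (x, y) \<Rightarrow> f' x * g' y)"
      using int by simp
  qed measurable
  define p where "p = (\<lambda>(x, y). indicator {..x} y * (f' x * g' y))"
  define q where "q = (\<lambda>(x, y). indicator {..<y} x * (f' x * g' y))"
  have pq: "integrable (lborel \<Otimes>\<^sub>M lborel) p" "integrable (lborel \<Otimes>\<^sub>M lborel) q"
  proof -
    show "integrable (lborel \<Otimes>\<^sub>M lborel) p"
      by (rule Bochner_Integration.integrable_bound[OF int2])
        (auto simp: p_def split_beta' indicator_def abs_mult)
    show "integrable (lborel \<Otimes>\<^sub>M lborel) q"
      by (rule Bochner_Integration.integrable_bound[OF int2])
        (auto simp: q_def split_beta' indicator_def abs_mult)
  qed
  have "(LINT x|lborel. f' x) * (LINT y|lborel. g' y) = (LINT x|lborel. LINT y|lborel. f' x * g' y)"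
    by simp
  also have "\<dots> = (LINT z|(lborel \<Otimes>\<^sub>M lborel). (\<lambda>(x, y). f' x * g' y) z)"
    using lborel_pair.integral_fst'[OF int2] by simp
  also have "\<dots> = (LINT z|(lborel \<Otimes>\<^sub>M lborel). p z + q z)"
    by (rule Bochner_Integration.integral_cong) (auto simp: p_def q_def indicator_def)
  also have "\<dots> = (LINT z|(lborel \<Otimes>\<^sub>M lborel). p z) + (LINT z|(lborel \<Otimes>\<^sub>M lborel). q z)"
    using pq by simp
  also have "(LINT z|(lborel \<Otimes>\<^sub>M lborel). p z) = (LINT x|lborel. LINT y|lborel. p (x, y))"
    using lborel_pair.integral_fst'[OF pq(1)] by simp
  also have "\<dots> = (LINT x:{a..b}|lborel. f x * (LINT y:{a..x}|lborel. g y))"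
    unfolding set_lebesgue_integral_def
  proof (rule Bochner_Integration.integral_cong)
    fix x
    have "(LINT y|lborel. p (x, y)) = (LINT y|lborel. f' x * (indicator {a..x} y *\<^sub>R g y))"
      by (rule Bochner_Integration.integral_cong) (auto simp: p_def f'_def g'_def indicator_def)
    then show "(LINT y|lborel. p (x, y)) = indicator {a..b} x *\<^sub>R (f x * (LINT y|lborel. indicator {a..x} y *\<^sub>R g y))"
      by (simp add: f'_def)
  qed simp
  also have "(LINT z|(lborel \<Otimes>\<^sub>M lborel). q z) = (LINT y|lborel. LINT x|lborel. q (x, y))"
    using lborel_pair.integral_snd[of "\<lambda>x y. q (x, y)"] pq(2) by simp
  also have "\<dots> = (LINT y:{a..b}|lborel. (LINT x:{a..y}|lborel. f x) * g y)"
    unfolding set_lebesgue_integral_def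
  proof (rule Bochner_Integration.integral_cong)
    fix y
    have "(LINT x|lborel. q (x, y)) = (LINT x|lborel. (indicator {a..y} x *\<^sub>R f x) * g' y)"
    proof (rule integral_cong_AE)
      have "AE x in lborel. x \<noteq> y" by (rule AE_lborel_singleton)
      then show "AE x in lborel. q (x, y) = (indicator {a..y} x *\<^sub>R f x) * g' y"
        by eventually_elim (auto simp: q_def f'_def g'_def indicator_def)
      show "(\<lambda>x. q (x, y)) \<in> borel_measurable lborel" unfolding q_def by simp
      have "f \<in> borel_measurable borel" by (rule locally_integrable_measurable[OF f])
      then show "(\<lambda>x. (indicator {a..y} x *\<^sub>R f x) * g' y) \<in> borel_measurable lborel" by simp
    qed
    then show "(LINT x|lborel. q (x, y)) = indicator {a..b} y *\<^sub>R ((LINT x|lborel. indicator {a..y} x *\<^sub>R f x) * g y)"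
      by (simp add: g'_def)
  qed simp
  finally show ?thesis
    by (simp add: f'_def[abs_def] g'_def[abs_def] set_lebesgue_integral_def)
qed

text \<open>The product rule without pointwise derivatives: the increments F - F(a) and G - G(a)
  vanish at the left end, \<open>Fubini_triangle\<close> applies to them, and the boundary constants
  are restored afterwards.\<close>

lemma antideriv_mult:
  assumes F: "antideriv F f" and G: "antideriv G g"
  shows "antideriv (\<lambda>x. F x * G x) (\<lambda>x. f x * G x + F x * g x)"
  unfolding antideriv_def
proof (intro conjI allI impI)
  note f = antiderivD(1)[OF F] and g = antiderivD(1)[OF G]
  have fG: "locally_integrable (\<lambda>x. f x * G x)"
    using locally_integrable_mult_continuous[OF antideriv_continuous[OF G] f] by (simp add: mult.commute)
  have Fg: "locally_integrable (\<lambda>x. F x * g x)"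
    by (rule locally_integrable_mult_continuous[OF antideriv_continuous[OF F] g])
  show "locally_integrable (\<lambda>x. f x * G x + F x * g x)" by (rule locally_integrable_add[OF fG Fg])
  fix a b :: real assume ab: "a \<le> b"
  have "(LINT x:{a..b}|lborel. f x * (LINT y:{a..x}|lborel. g y)) = (LINT x:{a..b}|lborel. f x * G x - G a * f x)"
    by (rule set_lebesgue_integral_cong) (auto simp flip: antiderivD(2)[OF G] simp: algebra_simps)
  also have "\<dots> = (LINT x:{a..b}|lborel. f x * G x) - G a * (F b - F a)"
    using locally_integrable_set[OF f] locally_integrable_set[OF fG]
    by (subst set_integral_diff) (auto simp: antiderivD(2)[OF F ab])
  finally have 1: "(LINT x:{a..b}|lborel. f x * (LINT y:{a..x}|lborel. g y)) = (LINT x:{a..b}|lborel. f x * G x) - G a * (F b - F a)" .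
  have "(LINT y:{a..b}|lborel. (LINT x:{a..y}|lborel. f x) * g y) = (LINT x:{a..b}|lborel. F x * g x - F a * g x)"
    by (rule set_lebesgue_integral_cong) (auto simp flip: antiderivD(2)[OF F] simp: algebra_simps)
  also have "\<dots> = (LINT x:{a..b}|lborel. F x * g x) - F a * (G b - G a)"
    using locally_integrable_set[OF g] locally_integrable_set[OF Fg]
    by (subst set_integral_diff) (auto simp: antiderivD(2)[OF G ab])
  finally have 2: "(LINT y:{a..b}|lborel. (LINT x:{a..y}|lborel. f x) * g y) = (LINT x:{a..b}|lborel. F x * g x) - F a * (G b - G a)" .
  have "(F b - F a) * (G b - G a) = (LINT x:{a..b}|lborel. f x * G x) - G a * (F b - F a)
      + ((LINT x:{a..b}|lborel. F x * g x) - F a * (G b - G a))"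
    using Fubini_triangle[OF f g ab] 1 2 by (simp add: antiderivD(2)[OF F ab] antiderivD(2)[OF G ab])
  moreover have "(LINT x:{a..b}|lborel. f x * G x + F x * g x) = (LINT x:{a..b}|lborel. f x * G x) + (LINT x:{a..b}|lborel. F x * g x)"
    using locally_integrable_set[OF fG] locally_integrable_set[OF Fg] by (intro set_integral_add)
  ultimately show "F b * G b - F a * G a = (LINT x:{a..b}|lborel. f x * G x + F x * g x)"
    by (simp add: algebra_simps)
qed

lemma antideriv_DERIV:
  assumes F: "antideriv F f" and f: "continuous_on UNIV f"
  shows "(F has_real_derivative f x) (at x)"
proof -
  have "((\<lambda>y. F (x - 1) + integral {x - 1..y} f) has_real_derivative 0 + f x) (at x within {x - 1..x + 1})"
    using f by (intro derivative_intros integral_has_real_derivative) (auto intro: continuous_on_subset)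
  then have "((\<lambda>y. F (x - 1) + integral {x - 1..y} f) has_real_derivative f x) (at x within {x - 1..x + 1})"
    by simp
  then have "(F has_real_derivative f x) (at x within {x - 1..x + 1})"
    by (rule has_field_derivative_transform_within[OF _ zero_less_one]) (simp_all add: antideriv_integral[OF F])
  then show ?thesis by (simp add: at_within_Icc_at)
qed

section \<open>Test functions and the du Bois-Reymond lemma\<close>

lemma test_deriv_zero:
  assumes "\<forall>x. R < \<bar>x\<bar> \<longrightarrow> \<phi> x = 0" "R < \<bar>x\<bar>"
  shows "deriv \<phi> x = (0::real)"
proof -
  have "((\<lambda>_. 0) has_real_derivative 0) (at x)" by simp
  then have "(\<phi> has_real_derivative 0) (at x)"
  proof (rule has_field_derivative_transform_within_open)
    show "open {y. R < \<bar>y\<bar>}" by (intro open_Collect_less continuous_intros)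
  qed (use assms in auto)
  then show ?thesis by (rule DERIV_imp_deriv)
qed

lemma test_deriv: "test_function \<phi> \<Longrightarrow> test_function (deriv \<phi>)"
  unfolding test_function_iff using smooth_deriv test_deriv_zero by blast

lemma integral_restrict:
  fixes \<phi> k :: "real \<Rightarrow> real"
  assumes "\<And>x. R < \<bar>x\<bar> \<Longrightarrow> \<phi> x = 0"
  shows "(LINT x|lborel. \<phi> x * k x :: real) = (LINT x:{-R..R}|lborel. \<phi> x * k x)"
  unfolding set_lebesgue_integral_def
proof (rule Bochner_Integration.integral_cong)
  fix x show "\<phi> x * k x = indicat_real {- R..R} x *\<^sub>R (\<phi> x * k x)"
  proof (cases "R < \<bar>x\<bar>")
    case False
    then have "x \<in> {-R..R}" by auto
    then show ?thesis by simp
  qed (use assms in simp)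
qed simp

lemma test_integrable:
  assumes "test_function \<phi>" "locally_integrable k"
  shows "integrable lborel (\<lambda>x. \<phi> x * k x :: real)"
proof -
  obtain R where R: "\<forall>x. R < \<bar>x\<bar> \<longrightarrow> \<phi> x = 0" and \<phi>: "smooth \<phi>"
    using assms by (auto simp: test_function_iff)
  have "locally_integrable (\<lambda>x. \<phi> x * k x)"
    by (intro locally_integrable_mult_continuous smooth_continuous \<phi> assms)
  then have "integrable lborel (\<lambda>x. indicator {-R..R} x *\<^sub>R (\<phi> x * k x))"
    using locally_integrable_set unfolding set_integrable_def by blast
  also have "(\<lambda>x. indicator {-R..R} x *\<^sub>R (\<phi> x * k x)) = (\<lambda>x. \<phi> x * k x)"
  proof
    fix x show "indicator {-R..R} x *\<^sub>R (\<phi> x * k x) = \<phi> x * k x"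
      using R by (cases "R < \<bar>x\<bar>") (auto simp: indicator_def)
  qed
  finally show ?thesis .
qed

lemma antideriv_has_weak_deriv:
  assumes F: "antideriv F f"
  shows "has_weak_deriv F f"
  unfolding has_weak_deriv_def
proof (intro conjI allI impI)
  show lF: "locally_integrable F" by (intro locally_integrable_continuous antideriv_continuous[OF F])
  show lf: "locally_integrable f" using antiderivD[OF F] by blast
  fix \<phi> assume \<phi>: "test_function \<phi>"
  then obtain R where R: "\<forall>x. R < \<bar>x\<bar> \<longrightarrow> \<phi> x = 0" and sm: "smooth \<phi>" by (auto simp: test_function_iff)
  \<comment> \<open>\<open>R\<close> may be negative and controls only points strictly beyond it;
    \<open>r\<close> is positive and the test function vanishes at the end points \<open>r\<close>
    and \<open>-r\<close> themselves.\<close>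
  define r where "r = \<bar>R\<bar> + 1"
  have r: "\<phi> x = 0" "deriv \<phi> x = 0" if "r \<le> \<bar>x\<bar>" for x
    using R test_deriv_zero[OF R, of x] that by (auto simp: r_def)
  have P: "antideriv (\<lambda>x. \<phi> x * F x) (\<lambda>x. deriv \<phi> x * F x + \<phi> x * f x)"
    by (rule antideriv_mult[OF antideriv_smooth[OF sm] F])
  have "(LINT x|lborel. deriv \<phi> x * F x) + (LINT x|lborel. \<phi> x * f x)
      = (LINT x:{-r..r}|lborel. deriv \<phi> x * F x) + (LINT x:{-r..r}|lborel. \<phi> x * f x)"
    using r by (subst (1 2) integral_restrict[of r]) auto
  also have "\<dots> = (LINT x:{-r..r}|lborel. deriv \<phi> x * F x + \<phi> x * f x)"
    by (rule set_integral_add(2)[symmetric])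
       (intro locally_integrable_set locally_integrable_mult_continuous smooth_continuous smooth_deriv sm lF lf)+
  also have "\<dots> = \<phi> r * F r - \<phi> (-r) * F (-r)"
    using antiderivD(2)[OF P, of "-r" r] by (simp add: r_def)
  also have "\<dots> = 0" using r[of r] r[of "-r"] by (simp add: r_def)
  finally show "(LINT x|lborel. deriv \<phi> x *\<^sub>R F x) = - (LINT x|lborel. \<phi> x *\<^sub>R f x)" by simp
qed

lemma bump_integral_limit:
  assumes k: "locally_integrable k"
  shows "(\<lambda>n. LINT x|lborel. bump a b n x * k x) \<longlonglongrightarrow> (LINT x:{a..b}|lborel. k x)"
proof -
  have [measurable]: "k \<in> borel_measurable borel" by (rule locally_integrable_measurable[OF k])
  have "(\<lambda>n. LINT x|lborel. bump a b n x * k x) \<longlonglongrightarrow> (LINT x|lborel. indicator {a..b} x * k x)"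
  proof (rule integral_dominated_convergence)
    show "integrable lborel (\<lambda>x. indicator {a..b} x * \<bar>k x\<bar>)"
      using set_integrable_abs[OF locally_integrable_set[OF k]] by (simp add: set_integrable_def)
    show "AE x in lborel. (\<lambda>n. bump a b n x * k x) \<longlonglongrightarrow> indicator {a..b} x * k x"
    proof -
      have "AE x in lborel. x \<noteq> a" "AE x in lborel. x \<noteq> b" by (rule AE_lborel_singleton)+
      then show ?thesis
      proof eventually_elim
        case (elim x)
        then have "indicator {a<..<b} x = (indicator {a..b} x :: real)" by (auto simp: indicator_def)
        then show ?case using bump_limit[of a b x] by (intro tendsto_intros) simp
      qed
    qed
    show "AE x in lborel. norm (bump a b n x * k x) \<le> indicator {a..b} x * \<bar>k x\<bar>" for n
    proof (intro AE_I2)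
      fix x
      show "norm (bump a b n x * k x) \<le> indicator {a..b} x * \<bar>k x\<bar>"
        using bump_bounds[of a b n x] bump_outside[of x a b n]
        by (cases "x \<in> {a..b}") (auto simp: abs_mult mult_left_le_one_le)
    qed
    show "(\<lambda>x. bump a b n x * k x) \<in> borel_measurable lborel" for n
      using borel_measurable_integrable[OF test_integrable[OF bump_test k]] .
  qed simp
  then show ?thesis by (simp add: set_lebesgue_integral_def)
qed

lemma AE_zero_of_test:
  assumes k: "locally_integrable k" and 0: "\<And>\<phi>. test_function \<phi> \<Longrightarrow> (LINT x|lborel. \<phi> x * k x) = (0::real)"
  shows "AE x in lborel. k x = 0"
proof (rule AE_zero_of_set_integrals[OF k])
  fix a b :: real
  show "(LINT x:{a..b}|lborel. k x) = 0"
    using bump_integral_limit[OF k, of a b] unfolding 0[OF bump_test] by (simp add: LIMSEQ_const_iff)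
qed

text \<open>A primitive normalized to vanish at \<open>-r\<close> is zero to the left of the
  support; the vanishing total integral makes it zero to the right as well.\<close>

lemma test_primitive:
  assumes \<eta>: "test_function \<eta>" and 0: "(LINT x|lborel. \<eta> x) = 0"
  obtains \<phi> where "test_function \<phi>" "deriv \<phi> = \<eta>"
proof -
  obtain R where R: "\<forall>x. R < \<bar>x\<bar> \<longrightarrow> \<eta> x = 0" and sm: "smooth \<eta>"
    using \<eta> by (auto simp: test_function_iff)
  define r where "r = \<bar>R\<bar> + 1"
  have r: "\<eta> x = 0" if "r \<le> \<bar>x\<bar>" for x using R that by (auto simp: r_def)
  obtain \<Phi> where \<Phi>: "antideriv \<Phi> \<eta>"
    using antideriv_exists[OF locally_integrable_continuous[OF smooth_continuous[OF sm]]] .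
  define \<phi> where "\<phi> x = \<Phi> x - \<Phi> (-r)" for x
  have d: "(\<phi> has_real_derivative \<eta> x) (at x)" for x
    unfolding \<phi>_def using antideriv_DERIV[OF \<Phi> smooth_continuous[OF sm], of x]
    by (auto intro!: derivative_eq_intros)
  have "\<phi> x = 0" if x: "r < \<bar>x\<bar>" for x
  proof (cases "x \<ge> 0")
    case True
    then have "\<phi> x = (LINT t:{-r..x}|lborel. \<eta> t)"
      using antiderivD(2)[OF \<Phi>, of "-r" x] x by (simp add: \<phi>_def r_def)
    also have "\<dots> = (LINT t|lborel. \<eta> t)"
      unfolding set_lebesgue_integral_def
    proof (rule Bochner_Integration.integral_cong)
      fix t show "indicator {-r..x} t *\<^sub>R \<eta> t = \<eta> t"
        using r[of t] True x by (cases "r \<le> \<bar>t\<bar>") (auto simp: indicator_def)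
    qed simp
    finally show ?thesis using 0 by simp
  next
    case False
    then have "- \<phi> x = (LINT t:{x..-r}|lborel. \<eta> t)"
      using antiderivD(2)[OF \<Phi>, of x "-r"] x by (simp add: \<phi>_def)
    also have "\<dots> = (LINT t:{x..-r}|lborel. 0)"
      by (rule set_lebesgue_integral_cong) (use r x False in \<open>auto simp: r_def\<close>)
    finally show ?thesis by (simp add: set_lebesgue_integral_def)
  qed
  then have "test_function \<phi>"
    unfolding test_function_iff using smooth_antideriv[OF d sm] by blast
  moreover have "deriv \<phi> = \<eta>" using d by (intro ext DERIV_imp_deriv)
  ultimately show ?thesis by (rule that)
qed

lemma test_function_lincomb:
  "test_function f \<Longrightarrow> test_function g \<Longrightarrow> test_function (\<lambda>x. c * f x + d * g x)"
  unfolding test_function_iff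
proof (elim conjE exE, intro conjI)
  fix R R' assume "smooth f" "smooth g" "\<forall>x. R < \<bar>x\<bar> \<longrightarrow> f x = 0" "\<forall>x. R' < \<bar>x\<bar> \<longrightarrow> g x = 0"
  then show "smooth (\<lambda>x. c * f x + d * g x)" "\<exists>R. \<forall>x. R < \<bar>x\<bar> \<longrightarrow> c * f x + d * g x = 0"
    by (auto intro!: smooth_add smooth_scale exI[of _ "max R R'"])
qed

text \<open>For test functions \<eta> and \<eta>' with integrals I and I', the function I' \<eta> - I \<eta>' has integral
  zero, hence a primitive that is a test function. So integrating against h is proportional to integrating.\<close>

lemma du_Bois_Reymond:
  assumes h: "locally_integrable h"
    and 0: "\<And>\<phi>. test_function \<phi> \<Longrightarrow> (LINT x|lborel. deriv \<phi> x * h x) = (0::real)"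
  shows "AE x in lborel. h x = (LINT x:{0..1}|lborel. h x)"
proof -
  define I where "I \<eta> = (LINT x|lborel. \<eta> x)" for \<eta> :: "real \<Rightarrow> real"
  define J where "J \<eta> = (LINT x|lborel. \<eta> x * h x)" for \<eta> :: "real \<Rightarrow> real"
  have one: "locally_integrable (\<lambda>x. 1::real)" by (intro locally_integrable_continuous) simp
  have IJ: "I \<eta>' * J \<eta> = I \<eta> * J \<eta>'" if t: "test_function \<eta>" "test_function \<eta>'" for \<eta> \<eta>'
  proof -
    let ?x = "\<lambda>x. I \<eta>' * \<eta> x + (- I \<eta>) * \<eta>' x"
    note i = test_integrable[OF t(1) one] test_integrable[OF t(2) one]
    have "I ?x = 0" using i by (simp add: I_def)
    then obtain \<phi> where \<phi>: "test_function \<phi>" "deriv \<phi> = ?x"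
      using test_primitive[OF test_function_lincomb[OF t]] unfolding I_def by blast
    have "J ?x = 0" using 0[OF \<phi>(1)] unfolding J_def \<phi>(2) .
    moreover have "J ?x = (LINT x|lborel. I \<eta>' * (\<eta> x * h x) - I \<eta> * (\<eta>' x * h x))"
      unfolding J_def by (simp add: algebra_simps)
    moreover have "\<dots> = I \<eta>' * J \<eta> - I \<eta> * J \<eta>'"
      using test_integrable[OF t(1) h] test_integrable[OF t(2) h] by (simp add: J_def)
    ultimately show ?thesis by simp
  qed
  define c where "c = (LINT x:{0..1}|lborel. h x)"
  have I: "(\<lambda>n. I (bump a b n)) \<longlonglongrightarrow> b - a" if "a \<le> b" for a b
    using bump_integral_limit[OF one, of a b] that by (simp add: I_def set_lebesgue_integral_def)
  have J: "(\<lambda>n. J (bump a b n)) \<longlonglongrightarrow> (LINT x:{a..b}|lborel. h x)" for a b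
    using bump_integral_limit[OF h, of a b] by (simp add: J_def)
  \<comment> \<open>The limit of \<open>IJ\<close> for bumps on \<open>{a..b}\<close> and on
    \<open>{0..1}\<close>; the unit interval identifies the constant of proportionality as
    \<open>c\<close>.\<close>
  have int: "(LINT x:{a..b}|lborel. h x) = (b - a) * c" if "a \<le> b" for a b
  proof (rule LIMSEQ_unique)
    have "(\<lambda>n. I (bump 0 1 n) * J (bump a b n)) \<longlonglongrightarrow> (1 - 0) * (LINT x:{a..b}|lborel. h x)"
      by (intro tendsto_mult I J) simp
    then show "(\<lambda>n. I (bump 0 1 n) * J (bump a b n)) \<longlonglongrightarrow> (LINT x:{a..b}|lborel. h x)" by simp
    have "(\<lambda>n. I (bump a b n) * J (bump 0 1 n)) \<longlonglongrightarrow> (b - a) * c"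
      unfolding c_def by (intro tendsto_mult I J that)
    then show "(\<lambda>n. I (bump 0 1 n) * J (bump a b n)) \<longlonglongrightarrow> (b - a) * c"
      by (simp only: IJ[OF bump_test bump_test, of 0 1])
  qed
  have lc: "locally_integrable (\<lambda>x. c)" by (intro locally_integrable_continuous) simp
  have "AE x in lborel. h x - c = 0"
  proof (rule AE_zero_of_set_integrals)
    show "locally_integrable (\<lambda>x. h x - c)" by (intro locally_integrable_diff h lc)
    fix a b :: real assume ab: "a \<le> b"
    have "(LINT x:{a..b}|lborel. h x - c) = (LINT x:{a..b}|lborel. h x) - (LINT x:{a..b}|lborel. c)"
      by (intro set_integral_diff locally_integrable_set h lc)
    also have "(LINT x:{a..b}|lborel. c) = (b - a) * c"
      using ab by (simp add: set_lebesgue_integral_def)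
    finally show "(LINT x:{a..b}|lborel. h x - c) = 0" using int[OF ab] by simp
  qed
  then show ?thesis by (simp add: c_def)
qed

section \<open>Calculus of weak derivatives\<close>

lemma has_weak_deriv_cong_AE:
  fixes f g :: "real \<Rightarrow> 'a::euclidean_space"
  assumes d: "has_weak_deriv f g" and ae: "AE x in lborel. f x = f' x" "AE x in lborel. g x = g' x"
    and m: "f' \<in> borel_measurable borel" "g' \<in> borel_measurable borel"
  shows "has_weak_deriv f' g'"
  unfolding has_weak_deriv_def
proof (intro conjI allI impI)
  have l: "locally_integrable f" "locally_integrable g" using d by (auto simp: has_weak_deriv_def)
  then show "locally_integrable f'" "locally_integrable g'"
    using locally_integrable_cong_AE ae m by blast+
  fix \<phi> assume \<phi>: "test_function \<phi>"
  have [measurable]: "\<phi> \<in> borel_measurable borel" "deriv \<phi> \<in> borel_measurable borel"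
    using \<phi> smooth_continuous smooth_deriv
    by (auto simp: test_function_iff intro!: borel_measurable_continuous_onI)
  have [measurable]: "f \<in> borel_measurable borel" "g \<in> borel_measurable borel"
    using l locally_integrable_measurable by blast+
  have "(LINT z|lborel. deriv \<phi> z *\<^sub>R f' z) = (LINT z|lborel. deriv \<phi> z *\<^sub>R f z)"
    by (rule integral_cong_AE) (use m ae in auto)
  also have "\<dots> = - (LINT z|lborel. \<phi> z *\<^sub>R g z)" using d \<phi> by (simp add: has_weak_deriv_def)
  also have "(LINT z|lborel. \<phi> z *\<^sub>R g z) = (LINT z|lborel. \<phi> z *\<^sub>R g' z)"
    by (rule integral_cong_AE) (use m ae in auto)
  finally show "(LINT z|lborel. deriv \<phi> z *\<^sub>R f' z) = - (LINT z|lborel. \<phi> z *\<^sub>R g' z)" .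
qed

text \<open>If \<open>G\<close> is any antiderivative of \<open>g\<close>, then \<open>f - G\<close>
  has weak derivative zero and is constant by \<open>du_Bois_Reymond\<close>. Product rules for weak
  derivatives thereby reduce to \<open>antideriv_mult\<close>.\<close>

lemma has_weak_deriv_antideriv:
  assumes d: "has_weak_deriv f g"
  obtains F where "antideriv F g" "AE x in lborel. f x = F x"
proof -
  have l: "locally_integrable f" "locally_integrable g" using d by (auto simp: has_weak_deriv_def)
  obtain G where G: "antideriv G g" using antideriv_exists[OF l(2)] .
  have lG: "locally_integrable G" by (intro locally_integrable_continuous antideriv_continuous[OF G])
  define c where "c = (LINT x:{0..1}|lborel. f x - G x)"
  have "AE x in lborel. f x - G x = c"
    unfolding c_def
  proof (rule du_Bois_Reymond)
    show "locally_integrable (\<lambda>x. f x - G x)" by (intro locally_integrable_diff l lG)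
    fix \<phi> assume \<phi>: "test_function \<phi>"
    have "(LINT x|lborel. deriv \<phi> x * (f x - G x)) = (LINT x|lborel. deriv \<phi> x * f x) - (LINT x|lborel. deriv \<phi> x * G x)"
      using test_integrable[OF test_deriv[OF \<phi>] l(1)] test_integrable[OF test_deriv[OF \<phi>] lG]
      by (simp add: right_diff_distrib)
    then show "(LINT x|lborel. deriv \<phi> x * (f x - G x)) = 0"
      using d antideriv_has_weak_deriv[OF G] \<phi> by (simp add: has_weak_deriv_def)
  qed
  moreover have "antideriv (\<lambda>x. G x + c) g" using G by (simp add: antideriv_def)
  ultimately show ?thesis by (intro that[of "\<lambda>x. G x + c"]) (auto simp: algebra_simps)
qed

lemma has_weak_deriv_unique_real:
  assumes "has_weak_deriv f g" "has_weak_deriv f g'"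
  shows "AE x in lborel. g x = (g' x :: real)"
proof -
  have l: "locally_integrable g" "locally_integrable g'" using assms by (auto simp: has_weak_deriv_def)
  have "AE x in lborel. g x - g' x = 0"
  proof (rule AE_zero_of_test)
    show "locally_integrable (\<lambda>x. g x - g' x)" by (intro locally_integrable_diff l)
    fix \<phi> assume \<phi>: "test_function \<phi>"
    show "(LINT x|lborel. \<phi> x * (g x - g' x)) = 0"
      using test_integrable[OF \<phi> l(1)] test_integrable[OF \<phi> l(2)] assms \<phi>
      by (simp add: right_diff_distrib has_weak_deriv_def)
  qed
  then show ?thesis by simp
qed

lemma has_weak_deriv_mult:
  assumes "has_weak_deriv f f'" "\<And>x. (a has_real_derivative a' x) (at x)" "continuous_on UNIV a'"
  shows "has_weak_deriv (\<lambda>x. a x * f x) (\<lambda>x. a' x * f x + a x * f' x)"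
proof -
  obtain F where F: "antideriv F f'" and ae: "AE x in lborel. f x = F x"
    using has_weak_deriv_antideriv[OF assms(1)] .
  have [measurable]: "f \<in> borel_measurable borel" "f' \<in> borel_measurable borel"
    using assms(1) by (auto simp: has_weak_deriv_def intro: locally_integrable_measurable)
  have "continuous_on UNIV a" using assms(2) by (meson DERIV_continuous_on has_field_derivative_at_within)
  then have [measurable]: "a \<in> borel_measurable borel" "a' \<in> borel_measurable borel"
    using assms(3) by (auto intro: borel_measurable_continuous_onI)
  have "has_weak_deriv (\<lambda>x. a x * F x) (\<lambda>x. a' x * F x + a x * f' x)"
    by (intro antideriv_has_weak_deriv antideriv_mult antideriv_C1 assms F)
  then show ?thesis
    by (rule has_weak_deriv_cong_AE) (use ae in \<open>auto\<close>)
qed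

lemma has_weak_deriv_zero:
  assumes "has_weak_deriv f (\<lambda>_. 0)"
  shows "\<exists>c::real. AE x in lborel. f x = c"
proof -
  obtain F where F: "antideriv F (\<lambda>_. 0)" and ae: "AE x in lborel. f x = F x"
    using has_weak_deriv_antideriv[OF assms] .
  have e: "F x = F 0" for x using antideriv_zero[OF F] by simp
  from ae have "AE x in lborel. f x = F 0" by eventually_elim (metis e)
  then show ?thesis by blast
qed

text \<open>Test against the cutoffs \<^term>\<open>bump (-1) 1 1 (x / n)\<close>, whose derivatives are of size
  \<^term>\<open>1 / n\<close>.\<close>

lemma integral_derivative_zero:
  assumes H: "has_weak_deriv H h" and int: "integrable lborel H" "integrable lborel h"
  shows "(LINT x|lborel. h x) = (0::real)"
proof -
  define \<phi> where "\<phi> = bump (-1) 1 1"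
  have \<phi>: "test_function \<phi>" and sm: "smooth \<phi>" by (simp_all add: \<phi>_def bump_test bump_smooth)
  \<comment> \<open>The bump is not normalized: the cutoffs tend to the constant
    \<open>\<phi> 0\<close>, which is divided out at the end.\<close>
  have \<phi>0: "\<phi> 0 \<noteq> 0" by (simp add: \<phi>_def bump_def flat_def)
  have cont: "continuous_on UNIV \<phi>" "continuous_on UNIV (deriv \<phi>)"
    using sm smooth_continuous smooth_deriv by blast+
  obtain R where R: "\<forall>x. R < \<bar>x\<bar> \<longrightarrow> deriv \<phi> x = 0"
    using test_deriv[OF \<phi>] by (auto simp: test_function_iff)
  have "bounded (deriv \<phi> ` {-R..R})"
    using cont by (intro compact_imp_bounded compact_continuous_image) (auto intro: continuous_on_subset)
  then obtain B0 where B0: "\<And>x. x \<in> {-R..R} \<Longrightarrow> \<bar>deriv \<phi> x\<bar> \<le> B0"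
    unfolding bounded_iff real_norm_def by blast
  have B: "\<bar>deriv \<phi> x\<bar> \<le> \<bar>B0\<bar>" for x
    using R B0[of x] by (cases "R < \<bar>x\<bar>") (auto simp: not_less abs_le_iff)
  \<comment> \<open>\<open>Suc n\<close> keeps the scale nonzero and at least 1, so the derivatives
    of the cutoffs are dominated uniformly in \<open>n\<close>.\<close>
  define \<rho> where "\<rho> n x = \<phi> (x / real (Suc n))" for n x
  have \<rho>_def': "\<rho> n = (\<lambda>x. 1 * \<phi> ((1 / real (Suc n)) * x + 0))" for n by (simp add: \<rho>_def fun_eq_iff)
  have d\<rho>: "deriv (\<rho> n) x = deriv \<phi> (x / real (Suc n)) / real (Suc n)" for n x
  proof (rule DERIV_imp_deriv)
    have "((\<lambda>x. x / real (Suc n)) has_real_derivative 1 / real (Suc n)) (at x)"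
      by (auto intro!: derivative_eq_intros)
    then show "(\<rho> n has_real_derivative deriv \<phi> (x / real (Suc n)) / real (Suc n)) (at x)"
      unfolding \<rho>_def using DERIV_chain2[OF smooth_has_deriv[OF sm]] by fastforce
  qed
  have \<rho>: "test_function (\<rho> n)" for n
    unfolding test_function_iff
  proof
    show "smooth (\<rho> n)" unfolding \<rho>_def' by (intro smooth_affine sm)
    have "\<rho> n x = 0" if "real (Suc n) < \<bar>x\<bar>" for x
      unfolding \<rho>_def \<phi>_def using that by (intro bump_outside) (auto simp: field_simps abs_if split: if_splits)
    then show "\<exists>R. \<forall>x. R < \<bar>x\<bar> \<longrightarrow> \<rho> n x = 0" by blast
  qed
  have [measurable]: "\<phi> \<in> borel_measurable borel" "deriv \<phi> \<in> borel_measurable borel"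
    using cont by (auto intro: borel_measurable_continuous_onI)
  have [measurable]: "H \<in> borel_measurable borel" "h \<in> borel_measurable borel"
    using int by (auto dest: borel_measurable_integrable)
  have "(\<lambda>n. LINT x|lborel. \<rho> n x * h x) \<longlonglongrightarrow> (LINT x|lborel. \<phi> 0 * h x)"
  proof (rule integral_dominated_convergence)
    show "integrable lborel (\<lambda>x. \<bar>h x\<bar>)" using int by simp
    show "AE x in lborel. (\<lambda>n. \<rho> n x * h x) \<longlonglongrightarrow> \<phi> 0 * h x"
    proof (intro AE_I2 tendsto_mult tendsto_const)
      fix x
      have "(\<lambda>n. x / real (Suc n)) \<longlonglongrightarrow> 0"
        by (rule LIMSEQ_Suc[OF lim_const_over_n])
      moreover have "isCont \<phi> 0" using cont by (simp add: continuous_on_eq_continuous_at)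
      ultimately show "(\<lambda>n. \<rho> n x) \<longlonglongrightarrow> \<phi> 0" unfolding \<rho>_def by (rule isCont_tendsto_compose[rotated])
    qed
    show "AE x in lborel. norm (\<rho> n x * h x) \<le> \<bar>h x\<bar>" for n
      using bump_bounds[of "-1" 1 1] by (auto simp: \<rho>_def \<phi>_def abs_mult intro!: mult_left_le_one_le)
  qed (unfold \<rho>_def, measurable)
  moreover have "(\<lambda>n. LINT x|lborel. deriv (\<rho> n) x * H x) \<longlonglongrightarrow> (LINT x|(lborel::real measure). (0::real))"
  proof (rule integral_dominated_convergence)
    show "integrable lborel (\<lambda>x. \<bar>B0\<bar> * \<bar>H x\<bar>)" using int by simp
    have b: "\<bar>deriv (\<rho> n) x\<bar> \<le> \<bar>B0\<bar> * inverse (real (Suc n))" for n x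
      using B[of "x / real (Suc n)"] unfolding d\<rho> abs_divide by (simp add: divide_inverse mult_right_mono)
    show "AE x in lborel. (\<lambda>n. deriv (\<rho> n) x * H x) \<longlonglongrightarrow> 0"
    proof (intro AE_I2 tendsto_mult_left_zero)
      fix x
      have "(\<lambda>n. \<bar>B0\<bar> * inverse (real (Suc n))) \<longlonglongrightarrow> \<bar>B0\<bar> * 0"
        by (intro tendsto_intros LIMSEQ_inverse_real_of_nat)
      then show "(\<lambda>n. deriv (\<rho> n) x) \<longlonglongrightarrow> 0"
        by (intro Lim_null_comparison[of "\<lambda>n. deriv (\<rho> n) x"]) (use b in auto)
    qed
    show "AE x in lborel. norm (deriv (\<rho> n) x * H x) \<le> \<bar>B0\<bar> * \<bar>H x\<bar>" for n
    proof (intro AE_I2)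
      fix x
      have "\<bar>B0\<bar> * inverse (real (Suc n)) \<le> \<bar>B0\<bar> * 1" by (intro mult_left_mono) (auto simp: inverse_le_1_iff)
      then show "norm (deriv (\<rho> n) x * H x) \<le> \<bar>B0\<bar> * \<bar>H x\<bar>"
        using b[of n x] by (simp only: real_norm_def abs_mult) (intro mult_right_mono, auto)
    qed
  qed (unfold d\<rho>, measurable)
  moreover have "(LINT x|lborel. deriv (\<rho> n) x * H x) = - (LINT x|lborel. \<rho> n x * h x)" for n
    using H \<rho>[of n] by (simp add: has_weak_deriv_def)
  ultimately have "(\<lambda>n. LINT x|lborel. \<rho> n x * h x) \<longlonglongrightarrow> 0"
    using tendsto_minus by fastforce
  then have "(LINT x|lborel. \<phi> 0 * h x) = 0"
    using LIMSEQ_unique \<open>(\<lambda>n. LINT x|lborel. \<rho> n x * h x) \<longlonglongrightarrow> (LINT x|lborel. \<phi> 0 * h x)\<close> by blast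
  then show ?thesis using \<phi>0 int by simp
qed

lemma has_weak_deriv_by_parts:
  assumes f: "has_weak_deriv f f'" and g: "has_weak_deriv g g'"
    and int: "integrable lborel (\<lambda>x. f x * g x)" "integrable lborel (\<lambda>x. f' x * g x)" "integrable lborel (\<lambda>x. f x * g' x)"
  shows "(LINT x|lborel. f' x * g x) = - (LINT x|lborel. f x * g' x :: real)"
proof -
  obtain F where F: "antideriv F f'" and fF: "AE x in lborel. f x = F x"
    using has_weak_deriv_antideriv[OF f] .
  obtain G where G: "antideriv G g'" and gG: "AE x in lborel. g x = G x"
    using has_weak_deriv_antideriv[OF g] .
  have [measurable]: "f \<in> borel_measurable borel" "f' \<in> borel_measurable borel"
     "g \<in> borel_measurable borel" "g' \<in> borel_measurable borel"
    using f g by (auto simp: has_weak_deriv_def intro: locally_integrable_measurable)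
  have "has_weak_deriv (\<lambda>x. F x * G x) (\<lambda>x. f' x * G x + F x * g' x)"
    by (intro antideriv_has_weak_deriv antideriv_mult F G)
  then have "has_weak_deriv (\<lambda>x. f x * g x) (\<lambda>x. f' x * g x + f x * g' x)"
    by (rule has_weak_deriv_cong_AE) (use fF gG in \<open>auto elim: eventually_elim2\<close>)
  then have "(LINT x|lborel. f' x * g x + f x * g' x) = 0"
    by (rule integral_derivative_zero) (use int in auto)
  then show ?thesis using int by simp
qed

section \<open>Weak derivatives of vector-valued and of reflected functions\<close>

lemma test_integrable_vec:
  fixes f :: "real \<Rightarrow> 'a::euclidean_space"
  assumes \<phi>: "test_function \<phi>" and f: "locally_integrable f"
  shows "integrable lborel (\<lambda>x. \<phi> x *\<^sub>R f x)"
proof -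
  have c: "continuous_on UNIV \<phi>" using \<phi> by (auto simp: test_function_iff intro: smooth_continuous)
  have m: "\<phi> \<in> borel_measurable borel" "f \<in> borel_measurable borel"
    using c locally_integrable_measurable[OF f] by (auto intro: borel_measurable_continuous_onI)
  have "locally_integrable (\<lambda>x. norm (f x))"
    using f by (simp add: locally_integrable_iff set_integrable_norm)
  then have "integrable lborel (\<lambda>x. \<phi> x * norm (f x))" by (rule test_integrable[OF \<phi>])
  then show ?thesis by (rule Bochner_Integration.integrable_bound) (use m in auto)
qed

lemma locally_integrable_linear:
  assumes "bounded_linear T" "locally_integrable f"
  shows "locally_integrable (\<lambda>x. T (f x))"
  unfolding locally_integrable_iff
proof (intro allI)
  fix a b
  have "integrable lborel (\<lambda>x. T (indicator {a..b} x *\<^sub>R f x))"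
    by (rule integrable_bounded_linear[OF assms(1) locally_integrable_set[OF assms(2), unfolded set_integrable_def]])
  then show "set_integrable lborel {a..b} (\<lambda>x. T (f x))"
    by (simp add: set_integrable_def linear_scale[OF bounded_linear.linear[OF assms(1)]])
qed

lemma has_weak_deriv_linear:
  assumes T: "bounded_linear T" and d: "has_weak_deriv f g"
  shows "has_weak_deriv (\<lambda>x. T (f x)) (\<lambda>x. T (g x))"
  unfolding has_weak_deriv_def
proof (intro conjI allI impI)
  have l: "locally_integrable f" "locally_integrable g" using d by (auto simp: has_weak_deriv_def)
  then show "locally_integrable (\<lambda>x. T (f x))" "locally_integrable (\<lambda>x. T (g x))"
    using T locally_integrable_linear by blast+
  fix \<phi> assume \<phi>: "test_function \<phi>"
  have s: "c *\<^sub>R T x = T (c *\<^sub>R x)" for c x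
    by (simp add: linear_scale[OF bounded_linear.linear[OF T]])
  have "(LINT z|lborel. deriv \<phi> z *\<^sub>R T (f z)) = T (LINT z|lborel. deriv \<phi> z *\<^sub>R f z)"
    unfolding s by (intro integral_bounded_linear T test_integrable_vec test_deriv \<phi> l)
  also have "\<dots> = T (- (LINT z|lborel. \<phi> z *\<^sub>R g z))" using d \<phi> by (simp add: has_weak_deriv_def)
  also have "\<dots> = - T (LINT z|lborel. \<phi> z *\<^sub>R g z)" by (rule linear_neg[OF bounded_linear.linear[OF T]])
  also have "T (LINT z|lborel. \<phi> z *\<^sub>R g z) = (LINT z|lborel. \<phi> z *\<^sub>R T (g z))"
    unfolding s by (intro integral_bounded_linear[symmetric] T test_integrable_vec \<phi> l)
  finally show "(LINT z|lborel. deriv \<phi> z *\<^sub>R T (f z)) = - (LINT z|lborel. \<phi> z *\<^sub>R T (g z))" .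
qed

lemma has_weak_deriv_add:
  assumes "has_weak_deriv f f'" "has_weak_deriv g g'"
  shows "has_weak_deriv (\<lambda>x. f x + g x) (\<lambda>x. f' x + g' x)"
  unfolding has_weak_deriv_def
proof (intro conjI allI impI)
  have l: "locally_integrable f" "locally_integrable g" "locally_integrable f'" "locally_integrable g'"
    using assms by (auto simp: has_weak_deriv_def)
  then show "locally_integrable (\<lambda>x. f x + g x)" "locally_integrable (\<lambda>x. f' x + g' x)"
    by (auto intro: locally_integrable_add)
  fix \<phi> assume \<phi>: "test_function \<phi>"
  show "(LINT z|lborel. deriv \<phi> z *\<^sub>R (f z + g z)) = - (LINT z|lborel. \<phi> z *\<^sub>R (f' z + g' z))"
    using assms \<phi> l test_deriv[OF \<phi>]
    by (simp add: scaleR_add_right test_integrable_vec has_weak_deriv_def)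
qed

lemma lborel_integral_reflect: "(LINT x|lborel. f (- x)) = (LINT x|lborel. f x)" for f :: "real \<Rightarrow> real"
  using lborel_integral_real_affine[of "-1" f 0] by simp

lemma lborel_integrable_reflect: "integrable lborel (\<lambda>x. f (- x)) \<longleftrightarrow> integrable lborel (f :: real \<Rightarrow> real)"
  using lborel_integrable_real_affine_iff[of "-1" f 0] by simp

lemma locally_integrable_reflect:
  assumes f: "locally_integrable f"
  shows "locally_integrable (\<lambda>x. f (- x) :: real)"
  unfolding locally_integrable_iff set_integrable_def
proof (intro allI)
  fix a b
  have "integrable lborel (\<lambda>x. indicator {-b..-a} (- x) *\<^sub>R f (- x))"
    using locally_integrable_set[OF f] by (subst lborel_integrable_reflect) (simp add: set_integrable_def)
  also have "(\<lambda>x. indicator {-b..-a} (- x) *\<^sub>R f (- x)) = (\<lambda>x. indicator {a..b} x *\<^sub>R f (- x))"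
    by (auto simp: indicator_def fun_eq_iff)
  finally show "integrable lborel (\<lambda>x. indicator {a..b} x *\<^sub>R f (- x))" .
qed

lemma has_weak_deriv_reflect:
  assumes d: "has_weak_deriv f g"
  shows "has_weak_deriv (\<lambda>x. f (- x)) (\<lambda>x. - g (- x) :: real)"
  unfolding has_weak_deriv_def
proof (intro conjI allI impI)
  have l: "locally_integrable f" "locally_integrable g" using d by (auto simp: has_weak_deriv_def)
  show "locally_integrable (\<lambda>x. f (- x))" "locally_integrable (\<lambda>x. - g (- x))"
    using locally_integrable_reflect[OF l(1)]
      locally_integrable_linear[OF bounded_linear_minus[OF bounded_linear_ident] locally_integrable_reflect[OF l(2)]]
    by simp_all
  fix \<phi> assume "test_function \<phi>"
  then obtain R where R: "\<forall>x. R < \<bar>x\<bar> \<longrightarrow> \<phi> x = 0" and sm: "smooth \<phi>" by (auto simp: test_function_iff)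
  have "smooth (\<lambda>x. 1 * \<phi> ((- 1) * x + 0))" by (rule smooth_affine[OF sm])
  then have t: "test_function (\<lambda>x. \<phi> (- x))" using R by (auto simp: test_function_iff intro!: exI[of _ R])
  have "((\<lambda>x. \<phi> (- x)) has_real_derivative - deriv \<phi> (- x)) (at x)" for x
    using DERIV_mirror[of \<phi> "deriv \<phi> (- x)" x] smooth_has_deriv[OF sm, of "- x"] by simp
  then have e: "deriv (\<lambda>x. \<phi> (- x)) x = - deriv \<phi> (- x)" for x by (rule DERIV_imp_deriv)
  have "(LINT x|lborel. deriv (\<lambda>x. \<phi> (- x)) x *\<^sub>R f x) = - (LINT x|lborel. \<phi> (- x) *\<^sub>R g x)"
    using d t unfolding has_weak_deriv_def by blast
  then have "(LINT x|lborel. deriv \<phi> (- x) * f x) = (LINT x|lborel. \<phi> (- x) * g x)"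
    unfolding e by simp
  then show "(LINT x|lborel. deriv \<phi> x *\<^sub>R f (- x)) = - (LINT x|lborel. \<phi> x *\<^sub>R - g (- x))"
    using lborel_integral_reflect[of "\<lambda>x. deriv \<phi> x * f (- x)"] lborel_integral_reflect[of "\<lambda>x. \<phi> x * g (- x)"]
    by simp
qed

section \<open>The Hilbert space of square integrable real functions\<close>

lemma L2_linear:
  assumes T: "bounded_linear T" and f: "f \<in> L2"
  shows "(\<lambda>x. T (f x)) \<in> L2"
proof -
  obtain K where K: "\<And>x. norm (T x) \<le> norm x * K" "K > 0" using bounded_linear.pos_bounded[OF T] by blast
  have [measurable]: "f \<in> borel_measurable borel" using f by (simp add: L2_def)
  have m: "(\<lambda>x. T (f x)) \<in> borel_measurable borel"
    by (rule measurable_compose[OF _ borel_measurable_continuous_onI])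
       (auto intro: linear_continuous_on T)
  have "integrable lborel (\<lambda>x. (norm (T (f x)))^2)"
  proof (rule Bochner_Integration.integrable_bound)
    show "integrable lborel (\<lambda>x. K^2 * (norm (f x))^2)" using f by (simp add: L2_def)
    show "AE x in lborel. norm ((norm (T (f x)))^2) \<le> norm (K^2 * (norm (f x))^2)"
    proof (intro AE_I2)
      fix x
      have "(norm (T (f x)))^2 \<le> (norm (f x) * K)^2" by (intro power_mono K) simp
      then show "norm ((norm (T (f x)))^2) \<le> norm (K^2 * (norm (f x))^2)"
        by (simp add: power_mult_distrib mult.commute)
    qed
  qed (use m in simp)
  then show ?thesis using m by (simp add: L2_def)
qed

lemma L2_add:
  fixes f g :: "real \<Rightarrow> 'a::euclidean_space"
  assumes "f \<in> L2" "g \<in> L2"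
  shows "(\<lambda>x. f x + g x) \<in> L2"
proof -
  have m: "f \<in> borel_measurable borel" "g \<in> borel_measurable borel" using assms by (auto simp: L2_def)
  have "integrable lborel (\<lambda>x. (norm (f x + g x))^2)"
  proof (rule Bochner_Integration.integrable_bound)
    show "integrable lborel (\<lambda>x. 2 * (norm (f x))^2 + 2 * (norm (g x))^2)" using assms by (simp add: L2_def)
    show "AE x in lborel. norm ((norm (f x + g x))^2) \<le> norm (2 * (norm (f x))^2 + 2 * (norm (g x))^2)"
    proof (intro AE_I2)
      fix x
      have "(norm (f x + g x))^2 \<le> (norm (f x) + norm (g x))^2" by (intro power_mono norm_triangle_ineq) simp
      also have "\<dots> \<le> 2 * (norm (f x))^2 + 2 * (norm (g x))^2"
        using sum_squares_bound[of "norm (f x)" "norm (g x)"] by (simp add: power2_sum)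
      finally show "norm ((norm (f x + g x))^2) \<le> norm (2 * (norm (f x))^2 + 2 * (norm (g x))^2)" by simp
    qed
  qed (use m in simp)
  then show ?thesis using m by (simp add: L2_def)
qed

lemma L2_minus: "f \<in> L2 \<Longrightarrow> (\<lambda>x. - f x) \<in> L2"
  by (rule L2_linear[OF bounded_linear_minus[OF bounded_linear_ident]])

lemma L2_diff: "f \<in> L2 \<Longrightarrow> g \<in> L2 \<Longrightarrow> (\<lambda>x. f x - g x) \<in> L2"
  using L2_add[of f "\<lambda>x. - g x"] L2_minus[of g] by simp

lemma L2_mult_left:
  fixes c :: "'a::{real_normed_algebra, euclidean_space}"
  shows "f \<in> L2 \<Longrightarrow> (\<lambda>x. c * f x) \<in> L2"
  by (rule L2_linear[OF bounded_linear_mult_right])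

lemma L2_real_iff: "f \<in> L2 \<longleftrightarrow> f \<in> borel_measurable borel \<and> integrable lborel (\<lambda>x. (f x :: real)^2)"
  by (simp add: L2_def)

lemma L2_real_mult_integrable:
  assumes "f \<in> L2" "g \<in> L2"
  shows "integrable lborel (\<lambda>x. f x * g x :: real)"
proof (rule Bochner_Integration.integrable_bound)
  show "integrable lborel (\<lambda>x. (f x)^2 + (g x)^2)" using assms by (simp add: L2_real_iff)
  show "(\<lambda>x. f x * g x) \<in> borel_measurable lborel" using assms by (auto simp: L2_real_iff)
  show "AE x in lborel. norm (f x * g x) \<le> norm ((f x)^2 + (g x)^2)"
  proof (intro AE_I2)
    fix x
    have "2 * \<bar>f x * g x\<bar> \<le> (f x)^2 + (g x)^2"
      using sum_squares_bound[of "\<bar>f x\<bar>" "\<bar>g x\<bar>"] by (simp add: abs_mult)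
    then show "norm (f x * g x) \<le> norm ((f x)^2 + (g x)^2)" by simp
  qed
qed

lemma L2_real_bounded_mult:
  assumes "f \<in> L2" "a \<in> borel_measurable borel" "\<And>x. \<bar>a x\<bar> \<le> B"
  shows "(\<lambda>x. a x * f x :: real) \<in> L2"
  unfolding L2_real_iff
proof
  show "integrable lborel (\<lambda>x. (a x * f x)^2)"
  proof (rule Bochner_Integration.integrable_bound)
    show "integrable lborel (\<lambda>x. B^2 * (f x)^2)" using assms by (simp add: L2_real_iff)
    show "AE x in lborel. norm ((a x * f x)^2) \<le> norm (B^2 * (f x)^2)"
    proof (intro AE_I2)
      fix x
      have "(a x)^2 \<le> B^2" using assms(3)[of x] by (simp add: abs_le_square_iff[symmetric])
      then show "norm ((a x * f x)^2) \<le> norm (B^2 * (f x)^2)"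
        by (simp add: power_mult_distrib mult_right_mono)
    qed
  qed (use assms in \<open>auto simp: L2_real_iff\<close>)
qed (use assms in \<open>auto simp: L2_real_iff\<close>)

lemma L2_real_abs: "f \<in> L2 \<Longrightarrow> (\<lambda>x. \<bar>f x\<bar> :: real) \<in> L2"
  by (auto simp: L2_real_iff)

lemma L2_real_0: "(\<lambda>_. 0 :: real) \<in> L2"
  by (simp add: L2_real_iff)

\<comment> \<open>In a partial quotient functions outside \<open>L2\<close> belong to no class. The
  values are real; complex functions will be pairs of classes.\<close>
quotient_type l2 = "real \<Rightarrow> real" / partial: "\<lambda>f g. f \<in> L2 \<and> g \<in> L2 \<and> f =\<^sub>a\<^sub>e g"
  by (rule part_equivpI)
    (auto simp: ae_eq_def symp_def transp_def L2_real_iff intro!: exI[of _ "\<lambda>_. 0"])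

lemma borel_L2: "f \<in> L2 \<Longrightarrow> f \<in> borel_measurable (borel :: real measure)"
  by (simp add: L2_def)

instantiation l2 :: real_vector
begin

lift_definition zero_l2 :: l2 is "\<lambda>_. 0" by (simp add: L2_real_iff ae_eq_def)
lift_definition plus_l2 :: "l2 \<Rightarrow> l2 \<Rightarrow> l2" is "\<lambda>f g x. f x + g x"
  by (auto simp: ae_eq_def intro: L2_add)
lift_definition minus_l2 :: "l2 \<Rightarrow> l2 \<Rightarrow> l2" is "\<lambda>f g x. f x - g x"
  by (auto simp: ae_eq_def intro: L2_diff)
lift_definition uminus_l2 :: "l2 \<Rightarrow> l2" is "\<lambda>f x. - f x"
  by (auto simp: ae_eq_def intro: L2_minus)
lift_definition scaleR_l2 :: "real \<Rightarrow> l2 \<Rightarrow> l2" is "\<lambda>c f x. c * f x"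
  by (auto simp: ae_eq_def intro: L2_mult_left)

instance
  by standard (transfer; simp add: ae_eq_def algebra_simps L2_add L2_mult_left
    L2_minus L2_diff L2_real_0)+

end

instantiation l2 :: real_inner
begin

lift_definition inner_l2 :: "l2 \<Rightarrow> l2 \<Rightarrow> real" is "\<lambda>f g. LINT x|lborel. f x * g x"
  by (rule integral_cong_AE) (auto simp: ae_eq_def borel_L2 intro!: borel_measurable_times)

definition "norm_l2 (f :: l2) = sqrt (f \<bullet> f)"
definition "sgn_l2 (f :: l2) = f /\<^sub>R norm f"
definition "dist_l2 (f :: l2) g = norm (f - g)"
definition [code del]: "(uniformity :: (l2 \<times> l2) filter) = (INF e\<in>{0<..}. principal {(x, y). dist x y < e})"
definition [code del]: "open (U :: l2 set) = (\<forall>x\<in>U. \<forall>\<^sub>F (x', y) in uniformity. x' = x \<longrightarrow> y \<in> U)"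

instance
proof
  fix f g h :: l2 and c :: real
  show "f \<bullet> g = g \<bullet> f" by transfer (simp add: mult.commute)
  show "(f + g) \<bullet> h = f \<bullet> h + g \<bullet> h"
    by transfer (simp add: L2_real_mult_integrable algebra_simps)
  show "(c *\<^sub>R f) \<bullet> g = c * (f \<bullet> g)" by transfer (simp add: mult.assoc)
  show "0 \<le> f \<bullet> f" by transfer simp
  show "f \<bullet> f = 0 \<longleftrightarrow> f = 0"
  proof transfer
    fix f :: "real \<Rightarrow> real" assume "f \<in> L2 \<and> f \<in> L2 \<and> f =\<^sub>a\<^sub>e f"
    then have f: "f \<in> L2" by simp
    show "(LINT x|lborel. f x * f x) = 0 \<longleftrightarrow> f \<in> L2 \<and> (\<lambda>_. 0 :: real) \<in> L2 \<and> f =\<^sub>a\<^sub>e (\<lambda>_. 0)"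
      using f L2_real_mult_integrable[OF f f] L2_real_0
      by (subst integral_nonneg_eq_0_iff_AE) (auto simp: ae_eq_def)
  qed
qed (simp_all add: norm_l2_def sgn_l2_def dist_l2_def uniformity_l2_def open_l2_def)

end

lemma abs_l2_eq_iff: "f \<in> L2 \<Longrightarrow> g \<in> L2 \<Longrightarrow> abs_l2 f = abs_l2 g \<longleftrightarrow> f =\<^sub>a\<^sub>e g"
  using Quotient_rel[OF Quotient_l2, of f g] by (auto simp: ae_eq_def)

lemma abs_l2_eqI: "f \<in> L2 \<Longrightarrow> g \<in> L2 \<Longrightarrow> AE x in lborel. f x = g x \<Longrightarrow> abs_l2 f = abs_l2 g"
  by (simp add: abs_l2_eq_iff ae_eq_def)

lemma rep_l2_L2: "rep_l2 F \<in> L2"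
  using Quotient_rep_reflp[OF Quotient_l2, of F] by simp

lemma abs_rep_l2: "abs_l2 (rep_l2 F) = F"
  by (rule Quotient_abs_rep[OF Quotient_l2])

lemma l2_cases: obtains f where "F = abs_l2 f" "f \<in> L2"
  using abs_rep_l2 rep_l2_L2 by metis

lemma rep_abs_l2: "f \<in> L2 \<Longrightarrow> AE x in lborel. rep_l2 (abs_l2 f) x = f x"
  using abs_l2_eq_iff[OF rep_l2_L2, of f "abs_l2 f"] by (simp add: abs_rep_l2 ae_eq_def)

lemma abs_l2_add: "f \<in> L2 \<Longrightarrow> g \<in> L2 \<Longrightarrow> abs_l2 f + abs_l2 g = abs_l2 (\<lambda>x. f x + g x)"
  and abs_l2_diff: "f \<in> L2 \<Longrightarrow> g \<in> L2 \<Longrightarrow> abs_l2 f - abs_l2 g = abs_l2 (\<lambda>x. f x - g x)"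
  and abs_l2_scale: "f \<in> L2 \<Longrightarrow> c *\<^sub>R abs_l2 f = abs_l2 (\<lambda>x. c * f x)"
  and abs_l2_inner: "f \<in> L2 \<Longrightarrow> g \<in> L2 \<Longrightarrow> abs_l2 f \<bullet> abs_l2 g = (LINT x|lborel. f x * g x)"
  by (simp_all add: plus_l2.abs_eq minus_l2.abs_eq uminus_l2.abs_eq scaleR_l2.abs_eq inner_l2.abs_eq ae_eq_def)

lemma abs_l2_norm: "f \<in> L2 \<Longrightarrow> (norm (abs_l2 f))^2 = (LINT x|lborel. (f x)^2)"
  unfolding power2_norm_eq_inner by (simp add: abs_l2_inner power2_eq_square)

section \<open>Completeness, with sech as a square integrable weight\<close>

lemma sech_square: "1 / (cosh x)^2 = 1 - (tanh x)^2" for x :: real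
proof -
  have "1 - (tanh x)^2 = ((cosh x)^2 - (sinh x)^2) / (cosh x)^2"
    by (simp add: tanh_def power_divide diff_divide_distrib)
  then show ?thesis by (simp add: hyperbolic_pythagoras)
qed

text \<open>\<open>tanh\<close> is a primitive with a finite limit at infinity, which settles the
  half line; evenness gives the rest.\<close>

lemma sech2_integrable: "integrable lborel (\<lambda>x::real. 1 / (cosh x)^2)"
proof -
  have m: "(\<lambda>x::real. 1 / (cosh x)^2) \<in> borel_measurable borel"
    by (intro borel_measurable_continuous_onI continuous_intros) auto
  have "(\<integral>\<^sup>+x. ennreal (1 / (cosh x)^2) * indicator {0..} x \<partial>lborel) = ennreal (1 - tanh 0)"
  proof (rule nn_integral_FTC_atLeast)
    show "(tanh has_real_derivative 1 / (cosh x)^2) (at x)" for x :: real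
    proof -
      have "(tanh has_real_derivative 1 - (tanh x)^2) (at x)"
        by (auto intro!: derivative_eq_intros)
      then show ?thesis by (simp only: sech_square)
    qed
    show "(tanh \<longlongrightarrow> (1::real)) at_top" by (rule tanh_real_at_top)
  qed (use m in auto)
  also have "(\<integral>\<^sup>+x. ennreal (1 / (cosh x)^2) * indicator {0..} x \<partial>lborel)
      = (\<integral>\<^sup>+x. ennreal (indicator {0..} x *\<^sub>R (1 / (cosh x)^2)) \<partial>(lborel :: real measure))"
    by (rule nn_integral_cong) (auto simp: indicator_def)
  finally have *: "\<dots> = ennreal (1 - tanh 0)" .
  have "integrable lborel (\<lambda>x::real. indicator {0..} x *\<^sub>R (1 / (cosh x)^2))"
  proof (rule integrableI_nonneg)
    show "(\<integral>\<^sup>+x. ennreal (indicator {0..} x *\<^sub>R (1 / (cosh x)^2)) \<partial>(lborel :: real measure)) < \<infinity>"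
      unfolding * by simp
    have "(\<lambda>x::real. 1 / (cosh x)^2) \<in> borel_measurable lborel" using m by simp
    then show "(\<lambda>x. indicator {0..} x *\<^sub>R (1 / (cosh x)^2)) \<in> borel_measurable (lborel :: real measure)"
      by (intro borel_measurable_scaleR borel_measurable_indicator) auto
  qed simp
  then have "has_bochner_integral lborel (\<lambda>x::real. 1 / (cosh x)^2)
      (2 *\<^sub>R (LINT x|lborel. indicator {0..} x *\<^sub>R (1 / (cosh x)^2)))"
    by (rule has_bochner_integral_even_function[OF has_bochner_integral_integrable]) simp
  then show ?thesis by (rule integrable.intros)
qed

lemma psi_measurable [measurable]: "\<psi> \<in> borel_measurable borel"
  unfolding \<psi>_def[abs_def] by (intro borel_measurable_continuous_onI continuous_intros) auto

lemma psi_pos: "\<psi> x > 0" and psi_le_1: "\<psi> x \<le> 1"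
  by (simp_all add: \<psi>_def cosh_real_pos cosh_real_ge_1)

lemma psi_L2: "\<psi> \<in> L2"
  unfolding L2_real_iff
proof
  have "(\<lambda>x. (\<psi> x)^2) = (\<lambda>x. 1 / (cosh x)^2)" by (simp add: \<psi>_def power_divide fun_eq_iff)
  then show "integrable lborel (\<lambda>x. (\<psi> x)^2)" using sech2_integrable by simp
qed (rule psi_measurable)

text \<open>After multiplication by the square integrable weight \<^term>\<open>\<psi>\<close>, a Cauchy sequence is Cauchy in L1
  and has a subsequence converging almost everywhere; Fatou's lemma then gives convergence in L2.\<close>

instance l2 :: complete_space
proof
  fix X :: "nat \<Rightarrow> l2" assume C: "Cauchy X"
  define x where "x n = rep_l2 (X n)" for n
  have x: "x n \<in> L2" "X n = abs_l2 (x n)" for n by (simp_all add: x_def rep_l2_L2 abs_rep_l2)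
  have [measurable]: "x n \<in> borel_measurable borel" for n using x borel_L2 by blast
  have d: "(norm (X i - X j))^2 = (LINT t|lborel. (x i t - x j t)^2)" for i j
    by (simp add: x abs_l2_diff abs_l2_norm L2_diff)
  have int: "integrable lborel (\<lambda>t. x n t * \<psi> t)" for n
    by (intro L2_real_mult_integrable x psi_L2)
  have cau: "\<exists>N. \<forall>i\<ge>N. \<forall>j\<ge>N. (LINT t|lborel. norm (x i t * \<psi> t - x j t * \<psi> t)) < e" if e: "e > 0" for e
  proof -
    let ?w = "norm (abs_l2 \<psi>) + 1"
    have w: "?w > 0" by (rule add_nonneg_pos) auto
    obtain N where N: "\<And>i j. i \<ge> N \<Longrightarrow> j \<ge> N \<Longrightarrow> dist (X i) (X j) < e / ?w"
      using C e w unfolding Cauchy_def by (metis divide_pos_pos)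
    have "(LINT t|lborel. norm (x i t * \<psi> t - x j t * \<psi> t)) < e" if ij: "i \<ge> N" "j \<ge> N" for i j
    proof -
      let ?d = "\<lambda>t. \<bar>x i t - x j t\<bar>"
      have dL: "?d \<in> L2" by (intro L2_real_abs L2_diff x)
      have "(LINT t|lborel. norm (x i t * \<psi> t - x j t * \<psi> t)) = (LINT t|lborel. ?d t * \<psi> t)"
        by (simp add: left_diff_distrib[symmetric] abs_mult psi_pos less_imp_le)
      also have "\<dots> = abs_l2 ?d \<bullet> abs_l2 \<psi>" by (simp add: abs_l2_inner dL psi_L2)
      also have "\<dots> \<le> norm (abs_l2 ?d) * norm (abs_l2 \<psi>)" by (rule norm_cauchy_schwarz)
      also have "norm (abs_l2 ?d) = dist (X i) (X j)"
        unfolding dist_norm by (rule power2_eq_imp_eq) (simp_all add: abs_l2_norm dL d)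
      also have "dist (X i) (X j) * norm (abs_l2 \<psi>) \<le> dist (X i) (X j) * ?w" by (intro mult_left_mono) auto
      also have "\<dots> < e / ?w * ?w" using N[OF ij] w by (intro mult_strict_right_mono)
      finally show ?thesis using w by simp
    qed
    then show ?thesis by blast
  qed
  obtain r where r: "strict_mono r" and ae: "AE t in lborel. Cauchy (\<lambda>n. x (r n) t * \<psi> t)"
    using cauchy_L1_AE_cauchy_subseq[OF int cau] by blast
  define f where "f t = lim (\<lambda>n. x (r n) t)" for t
  have [measurable]: "f \<in> borel_measurable borel"
    unfolding f_def[abs_def] by (rule borel_measurable_lim_metric) simp
  have lim: "AE t in lborel. (\<lambda>n. x (r n) t) \<longlonglongrightarrow> f t"
    using ae
  proof eventually_elim
    case (elim t)
    then obtain l where "(\<lambda>n. x (r n) t * \<psi> t) \<longlonglongrightarrow> l" using Cauchy_convergent convergent_def by blast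
    then have "(\<lambda>n. x (r n) t * \<psi> t / \<psi> t) \<longlonglongrightarrow> l / \<psi> t"
      using psi_pos[of t] by (intro tendsto_intros) auto
    then have "(\<lambda>n. x (r n) t) \<longlonglongrightarrow> l / \<psi> t" using psi_pos[of t] by simp
    then show ?case unfolding f_def by (metis limI)
  qed
  have key: "(\<lambda>t. f t - x (r n) t) \<in> L2 \<and> (LINT t|lborel. (f t - x (r n) t)^2) \<le> e"
    if e: "e \<ge> 0" "\<And>m. m \<ge> n \<Longrightarrow> (norm (X (r m) - X (r n)))^2 \<le> e" for n e
  proof -
    have "(\<integral>\<^sup>+t. ennreal ((f t - x (r n) t)^2) \<partial>lborel) = (\<integral>\<^sup>+t. liminf (\<lambda>m. ennreal ((x (r m) t - x (r n) t)^2)) \<partial>lborel)"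
    proof (rule nn_integral_cong_AE)
      show "AE t in lborel. ennreal ((f t - x (r n) t)^2) = liminf (\<lambda>m. ennreal ((x (r m) t - x (r n) t)^2))"
        using lim
      proof eventually_elim
        case (elim t)
        then have "(\<lambda>m. ennreal ((x (r m) t - x (r n) t)^2)) \<longlonglongrightarrow> ennreal ((f t - x (r n) t)^2)"
          by (intro tendsto_ennrealI tendsto_intros)
        then show ?case by (intro lim_imp_Liminf[symmetric]) auto
      qed
    qed
    also have "\<dots> \<le> liminf (\<lambda>m. \<integral>\<^sup>+t. ennreal ((x (r m) t - x (r n) t)^2) \<partial>lborel)"
      by (rule nn_integral_liminf) simp
    also have "(\<lambda>m. \<integral>\<^sup>+t. ennreal ((x (r m) t - x (r n) t)^2) \<partial>lborel) = (\<lambda>m. ennreal ((norm (X (r m) - X (r n)))^2))"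
    proof
      fix m
      have "integrable lborel (\<lambda>t. (x (r m) t - x (r n) t)^2)"
        using L2_diff[OF x(1) x(1)] by (simp add: L2_real_iff)
      then show "(\<integral>\<^sup>+t. ennreal ((x (r m) t - x (r n) t)^2) \<partial>lborel) = ennreal ((norm (X (r m) - X (r n)))^2)"
        unfolding d by (intro nn_integral_eq_integral) auto
    qed
    also have "liminf (\<lambda>m. ennreal ((norm (X (r m) - X (r n)))^2)) \<le> liminf (\<lambda>m. ennreal e)"
      by (rule Liminf_mono) (use e in \<open>auto intro!: eventually_sequentiallyI[of n] ennreal_leI\<close>)
    also have "\<dots> = ennreal e" by (simp add: Liminf_const)
    finally have le: "(\<integral>\<^sup>+t. ennreal ((f t - x (r n) t)^2) \<partial>lborel) \<le> ennreal e" .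
    have int: "integrable lborel (\<lambda>t. (f t - x (r n) t)^2)"
      by (rule integrableI_nonneg) (use le in \<open>auto simp: le_less_trans\<close>)
    then have "ennreal (LINT t|lborel. (f t - x (r n) t)^2) \<le> ennreal e"
      using le by (simp add: nn_integral_eq_integral)
    then show ?thesis using int e(1) by (simp add: L2_real_iff)
  qed
  have ex: "\<exists>N. \<forall>n\<ge>N. \<forall>m\<ge>n. (norm (X (r m) - X (r n)))^2 \<le> e^2" if e: "e > 0" for e
  proof -
    obtain N where N: "\<And>i j. i \<ge> N \<Longrightarrow> j \<ge> N \<Longrightarrow> dist (X i) (X j) < e"
      using C[unfolded Cauchy_def, rule_format, OF e] by blast
    have "(norm (X (r m) - X (r n)))^2 \<le> e^2" if "n \<ge> N" "m \<ge> n" for n m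
      using N[of "r m" "r n"] seq_suble[OF r, of n] seq_suble[OF r, of m] that
      by (intro power_mono) (auto simp: dist_norm)
    then show ?thesis by blast
  qed
  \<comment> \<open>\<open>key\<close> does not presuppose that \<open>f\<close> is square
    integrable: one crude bound on a tail places the difference \<open>f - x (r N1)\<close>, hence
    \<open>f\<close>, in \<open>L2\<close>.\<close>
  obtain N1 where "\<forall>n\<ge>N1. \<forall>m\<ge>n. (norm (X (r m) - X (r n)))^2 \<le> 1^2" using ex[of 1] by auto
  then have "(\<lambda>t. f t - x (r N1) t) \<in> L2" using key[of "1^2" N1] by auto
  from L2_add[OF this x(1)[of "r N1"]] have f: "f \<in> L2" by simp
  have "(X \<circ> r) \<longlonglongrightarrow> abs_l2 f"
  proof (rule LIMSEQ_I)
    fix e :: real assume e: "e > 0"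
    obtain N where N: "\<forall>n\<ge>N. \<forall>m\<ge>n. (norm (X (r m) - X (r n)))^2 \<le> (e/2)^2" using ex[of "e/2"] e by auto
    have "norm ((X \<circ> r) n - abs_l2 f) < e" if "n \<ge> N" for n
    proof -
      have "(norm (abs_l2 f - X (r n)))^2 = (LINT t|lborel. (f t - x (r n) t)^2)"
        by (simp add: x abs_l2_diff abs_l2_norm L2_diff f)
      also have "\<dots> \<le> (e/2)^2" using key[of "(e/2)^2" n] N that by simp
      finally have "norm (abs_l2 f - X (r n)) \<le> e/2" using e by (simp add: power2_le_iff_abs_le)
      then show ?thesis using e by (simp add: norm_minus_commute)
    qed
    then show "\<exists>no. \<forall>n\<ge>no. norm ((X \<circ> r) n - abs_l2 f) < e" by blast
  qed
  then have "X \<longlonglongrightarrow> abs_l2 f" using Cauchy_converges_subseq[OF C r] by blast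
  then show "convergent X" by (rule convergentI)
qed

instance l2 :: banach ..

section \<open>Weak differentiation and multiplication by tanh\<close>

text \<open>Differentiation as a graph on classes; by \<open>der_abs\<close> the choice of
  representatives is immaterial.\<close>

definition der :: "l2 \<Rightarrow> l2 \<Rightarrow> bool" where
  "der F G \<longleftrightarrow> has_weak_deriv (rep_l2 F) (rep_l2 G)"

lemma der_abs:
  assumes "f \<in> L2" "g \<in> L2"
  shows "der (abs_l2 f) (abs_l2 g) \<longleftrightarrow> has_weak_deriv f g"
proof -
  have ae: "AE x in lborel. rep_l2 (abs_l2 f) x = f x" "AE x in lborel. rep_l2 (abs_l2 g) x = g x"
    using assms by (auto intro: rep_abs_l2)
  then have ae': "AE x in lborel. f x = rep_l2 (abs_l2 f) x" "AE x in lborel. g x = rep_l2 (abs_l2 g) x"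
    by (simp_all add: eq_commute)
  have m: "f \<in> borel_measurable borel" "g \<in> borel_measurable borel"
    "rep_l2 (abs_l2 f) \<in> borel_measurable borel" "rep_l2 (abs_l2 g) \<in> borel_measurable borel"
    using assms rep_l2_L2 borel_L2 by blast+
  show ?thesis
    unfolding der_def
    using has_weak_deriv_cong_AE[OF _ ae m(1,2)] has_weak_deriv_cong_AE[OF _ ae' m(3,4)] by blast
qed

lemma derI: "has_weak_deriv f g \<Longrightarrow> f \<in> L2 \<Longrightarrow> g \<in> L2 \<Longrightarrow> der (abs_l2 f) (abs_l2 g)"
  by (simp add: der_abs)

lemma der_unique: "der F G \<Longrightarrow> der F G' \<Longrightarrow> G = G'"
  unfolding der_def using has_weak_deriv_unique_real abs_l2_eqI[OF rep_l2_L2 rep_l2_L2] abs_rep_l2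
  by metis

lemma der_add:
  assumes "der F F'" "der G G'"
  shows "der (F + G) (F' + G')"
proof -
  have "der (abs_l2 (\<lambda>x. rep_l2 F x + rep_l2 G x)) (abs_l2 (\<lambda>x. rep_l2 F' x + rep_l2 G' x))"
    using assms by (subst der_abs) (auto simp: der_def intro: has_weak_deriv_add L2_add rep_l2_L2)
  then show ?thesis by (simp add: abs_rep_l2 rep_l2_L2 flip: abs_l2_add)
qed

lemma der_scale:
  assumes "der F F'"
  shows "der (c *\<^sub>R F) (c *\<^sub>R F')"
proof -
  have "der (abs_l2 (\<lambda>x. c * rep_l2 F x)) (abs_l2 (\<lambda>x. c * rep_l2 F' x))"
    using assms has_weak_deriv_linear[OF bounded_linear_mult_right[of c]]
    by (subst der_abs) (auto simp: der_def intro: L2_mult_left rep_l2_L2)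
  then show ?thesis by (simp add: abs_rep_l2 rep_l2_L2 flip: abs_l2_scale)
qed

lemma der_minus: "der F F' \<Longrightarrow> der (- F) (- F')"
  using der_scale[of F F' "-1"] by simp

lemma der_diff: "der F F' \<Longrightarrow> der G G' \<Longrightarrow> der (F - G) (F' - G')"
  using der_add[of F F' "- G" "- G'"] der_minus by simp

lemma der_0: "der 0 0"
proof -
  have "has_weak_deriv (\<lambda>_. 0) (\<lambda>_. 0 :: real)"
    by (intro antideriv_has_weak_deriv antideriv_C1) auto
  then show ?thesis by (simp add: zero_l2.abs_eq der_abs L2_real_0)
qed

lemma der_parts:
  assumes "der F F'" "der G G'"
  shows "F' \<bullet> G = - (F \<bullet> G')"
proof -
  have i: "P \<bullet> Q = (LINT x|lborel. rep_l2 P x * rep_l2 Q x)" for P Q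
    using abs_l2_inner[OF rep_l2_L2 rep_l2_L2, of P Q] by (simp add: abs_rep_l2)
  show ?thesis
    unfolding i by (rule has_weak_deriv_by_parts)
      (use assms in \<open>auto simp: der_def intro: L2_real_mult_integrable rep_l2_L2\<close>)
qed

lemma abs_tanh_le_1: "\<bar>tanh x\<bar> \<le> (1::real)"
  using tanh_real_bounds[of x] by auto

lemma tanh_measurable [measurable]: "(tanh :: real \<Rightarrow> real) \<in> borel_measurable borel"
  by (intro borel_measurable_continuous_onI continuous_intros) auto

lemma L2_tanh: "f \<in> L2 \<Longrightarrow> (\<lambda>x. tanh x * f x) \<in> L2"
  by (rule L2_real_bounded_mult[OF _ tanh_measurable abs_tanh_le_1])

text \<open>As sech^2 = 1 - tanh^2, both potentials and the first-order factors d + k tanh can be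
  expressed through this one multiplication operator.\<close>

lift_definition tm :: "l2 \<Rightarrow> l2" is "\<lambda>f x. tanh x * f x"
  by (auto simp: ae_eq_def intro: L2_tanh)

lemma tm_abs: "f \<in> L2 \<Longrightarrow> tm (abs_l2 f) = abs_l2 (\<lambda>x. tanh x * f x)"
  by (simp add: tm.abs_eq ae_eq_def)

lemma tm_sym: "tm F \<bullet> G = F \<bullet> tm G"
  by transfer (simp add: mult_ac)

lemma tm_le: "tm F \<bullet> tm F \<le> F \<bullet> F"
proof transfer
  fix f :: "real \<Rightarrow> real" assume "f \<in> L2 \<and> f \<in> L2 \<and> f =\<^sub>a\<^sub>e f"
  then have f: "f \<in> L2" by simp
  show "(LINT x|lborel. tanh x * f x * (tanh x * f x)) \<le> (LINT x|lborel. f x * f x)"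
  proof (rule integral_mono)
    fix x :: real
    have "(tanh x)^2 \<le> 1" using abs_tanh_le_1 by (simp add: abs_square_le_1)
    then have "(tanh x)^2 * (f x)^2 \<le> 1 * (f x)^2" by (intro mult_right_mono) auto
    then show "tanh x * f x * (tanh x * f x) \<le> f x * f x" by (simp add: power2_eq_square mult_ac)
  qed (intro L2_real_mult_integrable L2_tanh f)+
qed

lemma tm_add: "tm (F + G) = tm F + tm G"
  by transfer (simp add: L2_tanh L2_add ae_eq_def distrib_left)

lemma tm_scale: "tm (c *\<^sub>R F) = c *\<^sub>R tm F"
  by transfer (simp add: L2_tanh L2_mult_left ae_eq_def)

lemma tm_bounded: "bounded_linear tm"
proof (rule bounded_linear_intro[where K = 1])
  show "norm (tm F) \<le> norm F * 1" for F
    using tm_le[of F] by (simp add: norm_eq_sqrt_inner)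
qed (simp_all add: tm_add tm_scale)

lemma tm_minus: "tm (- F) = - tm F"
  using tm_scale[of "-1" F] by simp

lemma tm_diff: "tm (F - G) = tm F - tm G"
  using tm_add[of F "- G"] by (simp add: tm_minus)

lemma DERIV_tanh: "(tanh has_real_derivative 1 - (tanh x)^2) (at x)"
  by (auto intro!: derivative_eq_intros)

lemma der_tm:
  assumes "der F F'"
  shows "der (tm F) (F - tm (tm F) + tm F')"
proof -
  let ?f = "rep_l2 F" and ?g = "rep_l2 F'"
  have "has_weak_deriv (\<lambda>x. tanh x * ?f x) (\<lambda>x. (1 - (tanh x)^2) * ?f x + tanh x * ?g x)"
    by (intro has_weak_deriv_mult assms[unfolded der_def] DERIV_tanh continuous_intros) auto
  also have "(\<lambda>x. (1 - (tanh x)^2) * ?f x + tanh x * ?g x) = (\<lambda>x. (?f x - tanh x * (tanh x * ?f x)) + tanh x * ?g x)"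
    by (simp add: fun_eq_iff algebra_simps power2_eq_square)
  finally have "der (abs_l2 (\<lambda>x. tanh x * ?f x)) (abs_l2 (\<lambda>x. (?f x - tanh x * (tanh x * ?f x)) + tanh x * ?g x))"
    by (rule derI) (intro L2_add L2_diff L2_tanh rep_l2_L2)+
  then show ?thesis
    by (simp add: abs_rep_l2 L2_tanh L2_diff rep_l2_L2 flip: abs_l2_add abs_l2_diff tm_abs)
qed

section \<open>Powers of sech as kernels of d + k tanh\<close>

definition psi_pow :: "nat \<Rightarrow> l2" where
  "psi_pow k = abs_l2 (\<lambda>x. \<psi> x ^ k)"

lemma psi_power_L2:
  assumes "k \<ge> 1"
  shows "(\<lambda>x. \<psi> x ^ k) \<in> L2"
proof -
  have "(\<lambda>x. \<psi> x ^ (k - 1) * \<psi> x) \<in> L2"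
  proof (rule L2_real_bounded_mult[OF psi_L2])
    show "\<bar>\<psi> x ^ (k - 1)\<bar> \<le> 1" for x
      using psi_pos[of x] psi_le_1[of x] by (simp add: power_le_one)
  qed simp
  also have "(\<lambda>x. \<psi> x ^ (k - 1) * \<psi> x) = (\<lambda>x. \<psi> x ^ k)"
    using assms by (cases k) (auto simp: mult.commute)
  finally show ?thesis .
qed

lemma DERIV_psi: "(\<psi> has_real_derivative - (tanh x * \<psi> x)) (at x)"
  unfolding \<psi>_def[abs_def]
  by (auto intro!: derivative_eq_intros simp: tanh_def power2_eq_square)

lemma der_psi_pow:
  assumes "k \<ge> 1"
  shows "der (psi_pow k) (- (real k *\<^sub>R tm (psi_pow k)))"
proof -
  have d: "((\<lambda>x. \<psi> x ^ k) has_real_derivative - real k * (tanh x * \<psi> x ^ k)) (at x)" for x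
    using assms DERIV_power[OF DERIV_psi, of k x] by (cases k) (simp_all add: algebra_simps)
  have c: "continuous_on UNIV \<psi>"
    by (rule DERIV_continuous_on) (rule has_field_derivative_at_within[OF DERIV_psi])
  have "antideriv (\<lambda>x. \<psi> x ^ k) (\<lambda>x. - real k * (tanh x * \<psi> x ^ k))"
    by (intro antideriv_C1 d continuous_intros c) auto
  then have "der (psi_pow k) (abs_l2 (\<lambda>x. - real k * (tanh x * \<psi> x ^ k)))"
    unfolding psi_pow_def by (intro derI antideriv_has_weak_deriv psi_power_L2 assms L2_mult_left L2_tanh)+
  also have "abs_l2 (\<lambda>x. - real k * (tanh x * \<psi> x ^ k)) = (- real k) *\<^sub>R tm (psi_pow k)"
    unfolding psi_pow_def by (simp only: tm_abs[OF psi_power_L2[OF assms]] abs_l2_scale[OF L2_tanh[OF psi_power_L2[OF assms]]])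
  finally show ?thesis by simp
qed

text \<open>For exponents 2 and 1 this is the non-orthogonality of psi and psi^2 on which the gap of
  D rests; for equal exponents it allows normalization.\<close>

lemma psi_pow_inner_pos:
  assumes "j \<ge> 1" "k \<ge> 1"
  shows "psi_pow j \<bullet> psi_pow k > 0"
proof -
  have int: "integrable lborel (\<lambda>x. \<psi> x ^ j * \<psi> x ^ k)"
    by (intro L2_real_mult_integrable psi_power_L2 assms)
  have "psi_pow j \<bullet> psi_pow k = (LINT x|lborel. \<psi> x ^ j * \<psi> x ^ k)"
    unfolding psi_pow_def by (intro abs_l2_inner psi_power_L2 assms)
  moreover have "(LINT x|lborel. \<psi> x ^ j * \<psi> x ^ k) \<noteq> 0"
  proof
    assume "(LINT x|lborel. \<psi> x ^ j * \<psi> x ^ k) = 0"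
    then have "AE x in lborel. \<psi> x ^ j * \<psi> x ^ k = 0"
      by (subst (asm) integral_nonneg_eq_0_iff_AE[OF int]) (auto simp: psi_pos less_imp_le)
    moreover have "\<psi> x \<noteq> 0" for x using psi_pos[of x] by simp
    ultimately have "AE x in (lborel :: real measure). False" by simp
    then show False using AE_iff_null_sets[of "UNIV :: real set" lborel] by (simp add: null_sets_def)
  qed
  moreover have "(LINT x|lborel. \<psi> x ^ j * \<psi> x ^ k) \<ge> 0"
    by (intro Bochner_Integration.integral_nonneg) (simp add: psi_pos less_imp_le)
  ultimately show ?thesis by simp
qed

text \<open>The equation for R says that the product of R with the k-th power of cosh has derivative zero.\<close>

lemma tm_kernel:
  assumes k: "k \<ge> 1" and d: "der R (- (real k *\<^sub>R tm R))"
  shows "\<exists>c. R = c *\<^sub>R psi_pow k"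
proof -
  let ?r = "rep_l2 R"
  have r: "?r \<in> L2" "R = abs_l2 ?r" by (simp_all add: rep_l2_L2 abs_rep_l2)
  have [measurable]: "?r \<in> borel_measurable borel" using r borel_L2 by blast
  have "(- real k) *\<^sub>R tm (abs_l2 ?r) = abs_l2 (\<lambda>x. - real k * (tanh x * ?r x))"
    by (simp only: tm_abs[OF r(1)] abs_l2_scale[OF L2_tanh[OF r(1)]])
  then have "der (abs_l2 ?r) (abs_l2 (\<lambda>x. - real k * (tanh x * ?r x)))"
    using d by (simp add: abs_rep_l2)
  then have d': "has_weak_deriv ?r (\<lambda>x. - real k * (tanh x * ?r x))"
    by (subst (asm) der_abs) (intro r L2_mult_left L2_tanh)+
  have DERIV_cosh: "(cosh has_real_derivative sinh x) (at x)" for x :: real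
    by (auto intro!: derivative_eq_intros)
  have dc: "((\<lambda>x. cosh x ^ k) has_real_derivative real k * (cosh x ^ (k - 1) * sinh x)) (at x)" for x :: real
    using DERIV_power[OF DERIV_cosh, of k x] by (simp add: algebra_simps)
  have "has_weak_deriv (\<lambda>x. cosh x ^ k * ?r x)
     (\<lambda>x. real k * (cosh x ^ (k - 1) * sinh x) * ?r x + cosh x ^ k * (- real k * (tanh x * ?r x)))"
    by (rule has_weak_deriv_mult[OF d' dc]) (intro continuous_intros)
  also have "(\<lambda>x. real k * (cosh x ^ (k - 1) * sinh x) * ?r x + cosh x ^ k * (- real k * (tanh x * ?r x))) = (\<lambda>_. 0)"
    using k by (cases k) (simp_all add: fun_eq_iff tanh_def field_simps)
  finally obtain c where c: "AE x in lborel. cosh x ^ k * ?r x = c"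
    using has_weak_deriv_zero by blast
  have "AE x in lborel. ?r x = c * \<psi> x ^ k"
    using c by eventually_elim (simp add: \<psi>_def power_divide field_simps)
  then have "R = abs_l2 (\<lambda>x. c * \<psi> x ^ k)"
    using abs_l2_eqI[OF r(1) L2_mult_left[OF psi_power_L2[OF k]]] by (simp add: abs_rep_l2)
  also have "\<dots> = c *\<^sub>R psi_pow k" by (simp add: psi_pow_def abs_l2_scale[OF psi_power_L2[OF k]])
  finally show ?thesis by blast
qed

section \<open>Solving the first-order equations y' = p - y and y' = y - p\<close>

lemma nn_integral_exp_tail: "(\<integral>\<^sup>+x. ennreal (indicator {s..} x * exp (s - x)) \<partial>lborel) = 1" for s :: real
proof -
  have "(\<integral>\<^sup>+x. ennreal (exp (s - x)) * indicator {s..} x \<partial>lborel) = ennreal (0 - (- exp (s - s)))"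
  proof (rule nn_integral_FTC_atLeast[where F = "\<lambda>x. - exp (s - x)" and T = 0])
    show "((\<lambda>x. - exp (s - x)) has_real_derivative exp (s - x)) (at x)" for x
      by (auto intro!: derivative_eq_intros)
    have "((\<lambda>x. - exp s * exp (- x)) \<longlongrightarrow> - exp s * 0) at_top"
      by (intro tendsto_intros filterlim_compose[OF exp_at_bot] filterlim_uminus_at_bot_at_top)
    then show "((\<lambda>x. - exp (s - x)) \<longlongrightarrow> 0) at_top" by (simp add: exp_diff exp_minus field_simps)
  qed auto
  also have "(\<integral>\<^sup>+x. ennreal (exp (s - x)) * indicator {s..} x \<partial>lborel)
      = (\<integral>\<^sup>+x. ennreal (indicator {s..} x * exp (s - x)) \<partial>lborel)"
    by (rule nn_integral_cong) (auto simp: indicator_def)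
  finally show ?thesis by simp
qed

lemma nn_integral_exp_head: "(\<integral>\<^sup>+s. ennreal (indicator {..x} s * exp (s - x)) \<partial>lborel) = 1" for x :: real
proof -
  have "(\<integral>\<^sup>+s. ennreal (indicator {..x} s * exp (s - x)) \<partial>lborel)
     = (\<integral>\<^sup>+s. ennreal (indicator {..x} (0 + (-1) * s) * exp (0 + (-1) * s - x)) \<partial>lborel)"
    by (subst nn_integral_real_affine[where c = "-1" and t = 0]) auto
  also have "\<dots> = (\<integral>\<^sup>+s. ennreal (indicator {-x..} s * exp (- x - s)) \<partial>lborel)"
    by (rule nn_integral_cong) (auto simp: indicator_def algebra_simps)
  finally show ?thesis using nn_integral_exp_tail[of "-x"] by simp
qed

text \<open>The solution is \<^term>\<open>y x = integral {..x} (\<lambda>s. exp (s - x) * p s)\<close>; its square is at most the average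
  of \<^term>\<open>(p s)^2\<close> against the probability density \<^term>\<open>exp (s - x)\<close> on \<^term>\<open>{..x}\<close>.\<close>

lemma first_order_solve_function:
  fixes p :: "real \<Rightarrow> real"
  assumes p: "p \<in> L2"
  shows "\<exists>y\<in>L2. has_weak_deriv y (\<lambda>x. p x - y x)"
proof -
  have [measurable]: "p \<in> borel_measurable borel" using p by (rule borel_L2)
  \<comment> \<open>The square root of the density \<open>exp (s - x)\<close> on
    \<open>{..x}\<close>: splitting the kernel as \<open>a x s * a x s\<close> lets Cauchy-Schwarz
    produce the bound \<open>y_sq\<close>.\<close>
  define a where "a x s = indicator {..x} s * exp ((s - x) / 2)" for x s :: real
  have a2: "(a x s)^2 = indicator {..x} s * exp (s - x)" for x s
    by (auto simp: a_def indicator_def power2_eq_square exp_add[symmetric])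
  have a_bound: "\<bar>a x s\<bar> \<le> 1" for x s by (auto simp: a_def indicator_def)
  have [measurable]: "a x \<in> borel_measurable borel" for x unfolding a_def[abs_def] by simp
  have aint: "integrable lborel (\<lambda>s. (a x s)^2)" and aval: "(LINT s|lborel. (a x s)^2) = 1" for x
  proof -
    have nn: "(\<integral>\<^sup>+s. ennreal ((a x s)^2) \<partial>lborel) = 1" unfolding a2 by (rule nn_integral_exp_head)
    show i: "integrable lborel (\<lambda>s. (a x s)^2)"
    proof (rule integrableI_nonneg)
      show "(\<integral>\<^sup>+s. ennreal ((a x s)^2) \<partial>lborel) < \<infinity>" unfolding nn by simp
    qed auto
    show "(LINT s|lborel. (a x s)^2) = 1" using nn_integral_eq_integral[OF i] nn by simp
  qed
  have aL: "a x \<in> L2" for x using aint by (simp add: L2_real_iff)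
  have apL: "(\<lambda>s. a x s * p s) \<in> L2" for x
    by (rule L2_real_bounded_mult[OF p _ a_bound]) simp
  define y where "y x = (LINT s|lborel. a x s * (a x s * p s))" for x
  have y_sq: "(y x)^2 \<le> (LINT s|lborel. (a x s * p s)^2)" for x
  proof -
    have "y x = abs_l2 (a x) \<bullet> abs_l2 (\<lambda>s. a x s * p s)"
      by (simp add: y_def abs_l2_inner aL apL)
    then have "(y x)^2 \<le> (norm (abs_l2 (a x)))^2 * (norm (abs_l2 (\<lambda>s. a x s * p s)))^2"
      using Cauchy_Schwarz_ineq[of "abs_l2 (a x)" "abs_l2 (\<lambda>s. a x s * p s)"]
      by (simp add: power2_norm_eq_inner)
    then show ?thesis by (simp add: abs_l2_norm aL apL aval)
  qed
  \<comment> \<open>Integrating factor: \<open>y\<close> is \<open>exp (- x)\<close> times an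
    antiderivative of \<open>q\<close>, from which the differential equation follows by the product
    rule.\<close>
  define q where "q s = exp s * p s" for s
  have aq: "a x s * (a x s * p s) = exp (- x) * (indicator {..x} s * q s)" for x s
    by (auto simp: a_def q_def indicator_def mult.assoc[symmetric] exp_add[symmetric])
  have qint: "set_integrable lborel {..x} q" for x
  proof -
    have "integrable lborel (\<lambda>s. exp x * (a x s * (a x s * p s)))"
      by (intro integrable_mult_right L2_real_mult_integrable aL apL)
    also have "(\<lambda>s. exp x * (a x s * (a x s * p s))) = (\<lambda>s. indicator {..x} s *\<^sub>R q s)"
      unfolding aq by (auto simp: exp_minus fun_eq_iff)
    finally show ?thesis by (simp add: set_integrable_def)
  qed
  define Q where "Q x = (LINT s:{..x}|lborel. q s)" for x
  have yQ: "y x = exp (- x) * Q x" for x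
    unfolding y_def aq Q_def set_lebesgue_integral_def by simp
  have Q: "antideriv Q q"
    unfolding antideriv_def
  proof (intro conjI allI impI)
    show "locally_integrable q"
      unfolding locally_integrable_iff
      using qint set_integrable_subset[of lborel "{..b}" q "{a..b}" for a b] by auto
    fix a b :: real assume ab: "a \<le> b"
    have "(LINT s:{..a} \<union> {a..b}|lborel. q s) = (LINT s:{..a}|lborel. q s) + (LINT s:{a..b}|lborel. q s)"
    proof (rule set_integral_Un_AE)
      have "AE s in lborel. s \<noteq> a" by (rule AE_lborel_singleton)
      then show "AE s in lborel. \<not> (s \<in> {..a} \<and> s \<in> {a..b})" by eventually_elim auto
      show "set_integrable lborel {a..b} q" by (rule set_integrable_subset[OF qint[of b]]) auto
    qed (use qint in auto)
    moreover have "{..a} \<union> {a..b} = {..b}" using ab by auto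
    ultimately show "Q b - Q a = (LINT s:{a..b}|lborel. q s)" by (simp add: Q_def)
  qed
  have "has_weak_deriv (\<lambda>x. exp (- x) * Q x) (\<lambda>x. - exp (- x) * Q x + exp (- x) * q x)"
    by (rule has_weak_deriv_mult[OF antideriv_has_weak_deriv[OF Q]])
      (auto intro!: derivative_eq_intros continuous_intros)
  also have "(\<lambda>x. - exp (- x) * Q x + exp (- x) * q x) = (\<lambda>x. p x - y x)"
    by (simp add: yQ q_def fun_eq_iff mult.assoc[symmetric] exp_add[symmetric])
  also have "(\<lambda>x. exp (- x) * Q x) = y" by (simp add: yQ fun_eq_iff)
  finally have der: "has_weak_deriv y (\<lambda>x. p x - y x)" .
  have [measurable]: "y \<in> borel_measurable borel"
    using der by (auto simp: has_weak_deriv_def intro: locally_integrable_measurable)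
  have "(\<integral>\<^sup>+x. ennreal ((y x)^2) \<partial>lborel) \<le> (\<integral>\<^sup>+x. \<integral>\<^sup>+s. ennreal (indicator {..x} s * exp (s - x)) * ennreal ((p s)^2) \<partial>lborel \<partial>lborel)"
  proof (rule nn_integral_mono)
    fix x
    have "ennreal ((y x)^2) \<le> ennreal (LINT s|lborel. (a x s * p s)^2)" by (rule ennreal_leI[OF y_sq])
    also have "\<dots> = (\<integral>\<^sup>+s. ennreal ((a x s * p s)^2) \<partial>lborel)"
      using apL[of x] by (intro nn_integral_eq_integral[symmetric]) (auto simp: L2_real_iff)
    also have "\<dots> = (\<integral>\<^sup>+s. ennreal (indicator {..x} s * exp (s - x)) * ennreal ((p s)^2) \<partial>lborel)"
      by (simp add: power_mult_distrib a2 ennreal_mult)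
    finally show "ennreal ((y x)^2) \<le> \<dots>" .
  qed
  \<comment> \<open>Tonelli: as a function of \<open>x\<close> on \<open>{s..}\<close> the weight
    \<open>exp (s - x)\<close> has total mass one as well, so the L2 norm of \<open>p\<close>
    remains.\<close>
  also have "\<dots> = (\<integral>\<^sup>+s. \<integral>\<^sup>+x. ennreal (indicator {s..} x * exp (s - x)) * ennreal ((p s)^2) \<partial>lborel \<partial>lborel)"
  proof -
    have "(\<lambda>(x, s). ennreal (indicator {s..} x * exp (s - x)) * ennreal ((p s)^2)) \<in> borel_measurable (lborel \<Otimes>\<^sub>M lborel)"
    proof -
      have "(\<lambda>z. ennreal ((if snd z \<le> fst z then 1 else 0) * exp (snd z - fst z)) * ennreal ((p (snd z))^2))
          \<in> borel_measurable (borel \<Otimes>\<^sub>M borel)"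
        by measurable
      also have "(\<lambda>z. ennreal ((if snd z \<le> fst z then 1 else 0) * exp (snd z - fst z)) * ennreal ((p (snd z))^2))
         = (\<lambda>(x, s). ennreal (indicator {s..} x * exp (s - x)) * ennreal ((p s)^2))"
        by (auto simp: fun_eq_iff indicator_def)
      also have "borel_measurable (borel \<Otimes>\<^sub>M borel) = borel_measurable (lborel \<Otimes>\<^sub>M (lborel :: real measure))"
        by (intro measurable_cong_sets sets_pair_measure_cong) simp_all
      finally show ?thesis .
    qed
    from lborel_pair.Fubini'[OF this]
    have "(\<integral>\<^sup>+s. \<integral>\<^sup>+x. ennreal (indicator {s..} x * exp (s - x)) * ennreal ((p s)^2) \<partial>lborel \<partial>lborel)
       = (\<integral>\<^sup>+x. \<integral>\<^sup>+s. ennreal (indicator {s..} x * exp (s - x)) * ennreal ((p s)^2) \<partial>lborel \<partial>lborel)" .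
    also have "\<dots> = (\<integral>\<^sup>+x. \<integral>\<^sup>+s. ennreal (indicator {..x} s * exp (s - x)) * ennreal ((p s)^2) \<partial>lborel \<partial>lborel)"
      by (intro nn_integral_cong) (auto simp: indicator_def)
    finally show ?thesis by simp
  qed
  also have "\<dots> = (\<integral>\<^sup>+s. ennreal ((p s)^2) \<partial>lborel)"
    by (simp add: nn_integral_multc nn_integral_exp_tail)
  also have "\<dots> < \<infinity>"
    using p by (auto simp: L2_real_iff integrable_iff_bounded)
  finally have "integrable lborel (\<lambda>x. (y x)^2)"
    by (intro integrableI_nonneg) auto
  then have "y \<in> L2" by (simp add: L2_real_iff)
  then show ?thesis using der by blast
qed

lemma first_order_solve: "\<exists>Y. der Y (F - Y)"
proof -
  obtain y where y: "y \<in> L2" "has_weak_deriv y (\<lambda>x. rep_l2 F x - y x)"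
    using first_order_solve_function[OF rep_l2_L2] by blast
  have "der (abs_l2 y) (abs_l2 (\<lambda>x. rep_l2 F x - y x))"
    using y by (subst der_abs) (auto intro: L2_diff rep_l2_L2)
  also have "abs_l2 (\<lambda>x. rep_l2 F x - y x) = F - abs_l2 y"
    using y by (simp add: abs_rep_l2 rep_l2_L2 flip: abs_l2_diff)
  finally show ?thesis by blast
qed

lemma L2_reflect: "f \<in> L2 \<Longrightarrow> (\<lambda>x. f (- x) :: real) \<in> L2"
  using lborel_integrable_reflect[of "\<lambda>x. (f x)^2"] by (auto simp: L2_real_iff)

text \<open>The reflection x \<mapsto> -x changes the sign of the derivative and turns this equation
  into the one already solved.\<close>

lemma first_order_solve': "\<exists>Y. der Y (Y - F)"
proof -
  define p where "p = rep_l2 F"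
  have p: "p \<in> L2" by (simp add: p_def rep_l2_L2)
  obtain y where y: "y \<in> L2" "has_weak_deriv y (\<lambda>x. p (- x) - y x)"
    using first_order_solve_function[OF L2_reflect[OF p]] by blast
  have "der (abs_l2 (\<lambda>x. y (- x))) (abs_l2 (\<lambda>x. y (- x) - p x))"
    using has_weak_deriv_reflect[OF y(2)] by (intro derI L2_diff L2_reflect p y) simp
  also have "abs_l2 (\<lambda>x. y (- x) - p x) = abs_l2 (\<lambda>x. y (- x)) - F"
    using p L2_reflect[OF y(1)] by (simp add: p_def abs_rep_l2 flip: abs_l2_diff)
  finally show ?thesis by blast
qed

section \<open>The operator 1 - d^2 on H^2\<close>

definition dom2 :: "l2 set" where
  "dom2 = {F. \<exists>G H. der F G \<and> der G H}"

definition dd :: "l2 \<Rightarrow> l2" where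
  "dd F = (THE H. \<exists>G. der F G \<and> der G H)"

definition NN :: "l2 \<Rightarrow> l2" where
  "NN F = F - dd F"

lemma dd_eq: "der F G \<Longrightarrow> der G H \<Longrightarrow> dd F = H"
  unfolding dd_def using der_unique by (intro the_equality) blast+

lemma dom2E:
  assumes "F \<in> dom2"
  obtains G where "der F G" "der G (dd F)"
  using assms dd_eq unfolding dom2_def by blast

lemma dom2I: "der F G \<Longrightarrow> der G H \<Longrightarrow> F \<in> dom2"
  unfolding dom2_def by blast

lemma pos_op_NN: "pos_op dom2 NN"
proof
  show "subspace dom2"
    unfolding subspace_def using der_0 der_add der_scale by (auto simp: dom2_def) blast+
  fix F G :: l2 and c :: real
  show "NN (c *\<^sub>R F) = c *\<^sub>R NN F" if "F \<in> dom2"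
    using that by (elim dom2E) (simp add: NN_def dd_eq[OF der_scale der_scale] scaleR_diff_right)
  show "NN F \<bullet> F \<ge> F \<bullet> F" if F: "F \<in> dom2"
  proof -
    obtain F' where F': "der F F'" "der F' (dd F)" using F by (rule dom2E)
    then show ?thesis using der_parts[OF F'(2,1)] by (simp add: NN_def inner_diff_left)
  qed
  show "\<exists>F\<in>dom2. NN F = H" for H
  proof -
    \<comment> \<open>Factor 1 - d^2 = (1 - d)(1 + d): this line solves (1 - d) Y = H, the next one
      (1 + d) F = Y.\<close>
    obtain Y where Y: "der Y (Y - H)" using first_order_solve' by blast
    obtain F where F: "der F (Y - F)" using first_order_solve by blast
    have d2: "der (Y - F) (Y - H - (Y - F))" by (rule der_diff[OF Y F])
    have "NN F = H" by (simp add: NN_def dd_eq[OF F d2])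
    then show ?thesis using dom2I[OF F d2] by blast
  qed
  assume F: "F \<in> dom2" and G: "G \<in> dom2"
  obtain F' where F': "der F F'" "der F' (dd F)" using F by (rule dom2E)
  obtain G' where G': "der G G'" "der G' (dd G)" using G by (rule dom2E)
  show "NN (F + G) = NN F + NN G"
    by (simp add: NN_def dd_eq[OF der_add[OF F'(1) G'(1)] der_add[OF F'(2) G'(2)]])
  show "NN F \<bullet> G = F \<bullet> NN G"
    using der_parts[OF F'(2) G'(1)] der_parts[OF F'(1) G'(2)]
    by (simp add: NN_def inner_diff_left inner_diff_right)
qed

section \<open>Spectral gaps by factorization\<close>

interpretation NN: pos_op dom2 NN by (rule pos_op_NN)

text \<open>The operators T = d + k tanh and T* = - d + k tanh satisfy
  T T* = - d^2 + k^2 - (k^2 - k) sech^2, which is at least k, and T* T = - d^2 + k^2 - (k^2 + k) sech^2;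
  k = 1 and k = 2 give D - \<mu> and C. The kernel of T is spanned by \<^term>\<open>psi_pow k\<close>; if v is
  orthogonal to it, then v = T* y for the solution y of T T* y = T v.\<close>

lemma factor_gap:
  assumes k: "k \<ge> 1" and v: "der v v'" and orth: "v \<bullet> psi_pow k = 0"
  shows "real k * (v \<bullet> v) \<le> (v' + real k *\<^sub>R tm v) \<bullet> (v' + real k *\<^sub>R tm v)"
proof -
  define c where "c = real k"
  have c: "c \<ge> 1" using k by (simp add: c_def)
  \<comment> \<open>\<open>NN + B\<close> is the product of T and its adjoint: \<open>NN\<close>
    already contains 1, hence \<open>c^2 - 1\<close>, and \<open>y - tm (tm y)\<close> is
    multiplication by sech^2.\<close>
  define B where "B y = (c^2 - 1) *\<^sub>R y - (c^2 - c) *\<^sub>R (y - tm (tm y))" for y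
  have B: "bounded_linear B"
    unfolding B_def
    by (intro bounded_linear_sub bounded_linear_ident bounded_linear_compose[OF bounded_linear_scaleR_right]
        bounded_linear_compose[OF tm_bounded])
  have coer: "c * (y \<bullet> y) \<le> (NN y + B y) \<bullet> y" if "y \<in> dom2" for y
  proof -
    have "0 \<le> (c^2 - c) * (tm y \<bullet> tm y)" using c by (simp add: power2_eq_square)
    moreover have "(NN y + B y) \<bullet> y = NN y \<bullet> y + (c - 1) * (y \<bullet> y) + (c^2 - c) * (tm y \<bullet> tm y)"
      by (simp add: B_def inner_add_left inner_diff_left tm_sym algebra_simps)
    ultimately show ?thesis using NN.N_pos[OF that] by (simp add: algebra_simps)
  qed
  let ?T = "v' + c *\<^sub>R tm v"
  obtain y where y: "y \<in> dom2" "NN y + B y = ?T"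
    using NN.coercive_perturbation_surj[OF B _ coer, of ?T] c by auto
  obtain y' where y': "der y y'" "der y' (dd y)" using y(1) by (rule dom2E)
  \<comment> \<open>\<open>z\<close> is the adjoint of T applied to \<open>y\<close>. By
    \<open>Tz\<close> it satisfies T z = T v, so \<open>v - z\<close> lies in the kernel of
    T.\<close>
  define z where "z = c *\<^sub>R tm y - y'"
  have z: "der z (c *\<^sub>R (y - tm (tm y) + tm y') - dd y)"
    unfolding z_def by (intro der_diff der_scale der_tm y')
  have Tz: "c *\<^sub>R (y - tm (tm y) + tm y') - dd y + c *\<^sub>R tm z = ?T"
    unfolding y(2)[symmetric] NN_def B_def z_def
    by (simp add: tm_diff tm_scale algebra_simps power2_eq_square)
  have r: "der (v - z) (v' - (c *\<^sub>R (y - tm (tm y) + tm y') - dd y))"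
    by (intro der_diff v z)
  have "v' - (c *\<^sub>R (y - tm (tm y) + tm y') - dd y) = - (real k *\<^sub>R tm (v - z))"
    using Tz by (simp add: tm_diff algebra_simps c_def)
  with r obtain d where d: "v - z = d *\<^sub>R psi_pow k" using tm_kernel[OF k] by metis
  have "y' \<bullet> psi_pow k = - (y \<bullet> - (real k *\<^sub>R tm (psi_pow k)))" by (rule der_parts[OF y'(1) der_psi_pow[OF k]])
  then have "z \<bullet> psi_pow k = 0" by (simp add: z_def inner_diff_left c_def tm_sym)
  then have "(v - z) \<bullet> psi_pow k = 0" using orth by (simp add: inner_diff_left)
  then have "d = 0" using psi_pow_inner_pos[OF k k] unfolding d by simp
  then have vz: "v = z" using d by simp
  have "v' \<bullet> y = - (v \<bullet> y')" by (rule der_parts[OF v y'(1)])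
  \<comment> \<open>With \<open>v = z\<close>, moving T to the other side gives |v|^2 = <T v, y>.
    Coercivity gives c |y|^2 \<le> |v|^2 and Cauchy-Schwarz |v|^4 \<le> |T v|^2 |y|^2; eliminating
    |y| leaves the claim.\<close>
  then have V: "v \<bullet> v = ?T \<bullet> y"
    by (subst (2) vz) (simp add: z_def inner_add_left inner_diff_right tm_sym)
  have "c * (y \<bullet> y) \<le> v \<bullet> v" using coer[OF y(1)] unfolding y(2) V by simp
  moreover have "(v \<bullet> v)^2 \<le> (?T \<bullet> ?T) * (y \<bullet> y)" unfolding V by (rule Cauchy_Schwarz_ineq)
  moreover define q where "q = ?T \<bullet> ?T"
  ultimately have "c * (y \<bullet> y) \<le> v \<bullet> v" "(v \<bullet> v)^2 \<le> q * (y \<bullet> y)" by simp_all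
  moreover have "q \<ge> 0" by (simp add: q_def)
  ultimately have "c * (v \<bullet> v)^2 \<le> c * (q * (y \<bullet> y))" "q * (c * (y \<bullet> y)) \<le> q * (v \<bullet> v)"
    using c by (intro mult_left_mono; simp)+
  then have "(c * (v \<bullet> v)) * (v \<bullet> v) \<le> q * (v \<bullet> v)" by (simp add: power2_eq_square mult_ac)
  then have "(c * (v \<bullet> v)) * (v \<bullet> v) \<le> (?T \<bullet> ?T) * (v \<bullet> v)" unfolding q_def .
  then have "c * (v \<bullet> v) \<le> ?T \<bullet> ?T"
    by (cases "v = 0") (auto simp: c_def)
  then show ?thesis by (simp add: c_def)
qed

text \<open>Expanding the square, the cross term is the integral of tanh times (v^2)', which by
  parts becomes minus the integral of sech^2 v^2; this is the origin of the linear \<open>c\<close>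
  in the coefficient \<open>c^2 + c\<close>.\<close>

lemma factor_form:
  assumes v: "v \<in> dom2" "der v v'"
  shows "(NN v + (c^2 - 1) *\<^sub>R v - (c^2 + c) *\<^sub>R (v - tm (tm v))) \<bullet> v
    = (v' + c *\<^sub>R tm v) \<bullet> (v' + c *\<^sub>R tm v)"
proof -
  obtain v1 where v1: "der v v1" "der v1 (dd v)" using v(1) by (rule dom2E)
  have v': "der v' (dd v)" using v1 der_unique[OF v(2) v1(1)] by simp
  have 1: "dd v \<bullet> v = - (v' \<bullet> v')" by (rule der_parts[OF v' v(2)])
  have 2: "v' \<bullet> tm v = - (v \<bullet> (v - tm (tm v) + tm v'))" by (rule der_parts[OF v(2) der_tm[OF v(2)]])
  have 3: "v \<bullet> tm v' = v' \<bullet> tm v" by (metis inner_commute tm_sym)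
  have 4: "tm (tm v) \<bullet> v = tm v \<bullet> tm v" "v \<bullet> tm (tm v) = tm v \<bullet> tm v"
    by (simp_all add: tm_sym)
  have 5: "2 * (v' \<bullet> tm v) = tm v \<bullet> tm v - v \<bullet> v"
    using 2 3 4 by (simp add: inner_add_right inner_diff_right)
  have "(v' + c *\<^sub>R tm v) \<bullet> (v' + c *\<^sub>R tm v) = v' \<bullet> v' + c * (2 * (v' \<bullet> tm v)) + c^2 * (tm v \<bullet> tm v)"
    by (simp add: inner_add_left inner_add_right inner_commute power2_eq_square algebra_simps)
  also have "\<dots> = v' \<bullet> v' + c * (tm v \<bullet> tm v - v \<bullet> v) + c^2 * (tm v \<bullet> tm v)" unfolding 5 ..
  finally show ?thesis
    using 1 4 by (simp add: NN_def inner_add_left inner_diff_left algebra_simps)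
qed

lemma psi_pow_dom: "k \<ge> 1 \<Longrightarrow> psi_pow k \<in> dom2"
  and psi_pow_eigen: "k \<ge> 1 \<Longrightarrow> NN (psi_pow k) + ((real k)^2 - 1) *\<^sub>R psi_pow k - ((real k)^2 + real k) *\<^sub>R (psi_pow k - tm (tm (psi_pow k))) = 0"
proof -
  assume k: "k \<ge> 1"
  have d1: "der (psi_pow k) (- (real k *\<^sub>R tm (psi_pow k)))" by (rule der_psi_pow[OF k])
  have d2: "der (- (real k *\<^sub>R tm (psi_pow k))) (- (real k *\<^sub>R (psi_pow k - tm (tm (psi_pow k)) + tm (- (real k *\<^sub>R tm (psi_pow k))))))"
    by (intro der_minus der_scale der_tm d1)
  show "psi_pow k \<in> dom2" by (rule dom2I[OF d1 d2])
  show "NN (psi_pow k) + ((real k)^2 - 1) *\<^sub>R psi_pow k - ((real k)^2 + real k) *\<^sub>R (psi_pow k - tm (tm (psi_pow k))) = 0"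
    unfolding NN_def dd_eq[OF d1 d2]
    by (simp add: tm_minus tm_scale algebra_simps power2_eq_square)
qed

section \<open>The angle between psi and psi^2, and the gaps of C and D\<close>

definition e2 :: l2 where "e2 = psi_pow 2 /\<^sub>R norm (psi_pow 2)"
definition e1 :: l2 where "e1 = psi_pow 1 /\<^sub>R norm (psi_pow 1)"
text \<open>Cosine of the angle between the kernel of C and the ground state of D.\<close>

definition \<theta> :: real where "\<theta> = e2 \<bullet> e1"

lemma psi_pow_norm_pos: "k \<ge> 1 \<Longrightarrow> norm (psi_pow k) > 0"
  using psi_pow_inner_pos[of k k] by auto

lemma inner_normalize:
  assumes "norm x > 0"
  shows "(x /\<^sub>R norm x) \<bullet> (x /\<^sub>R norm x) = 1"
proof -
  have "(x /\<^sub>R norm x) \<bullet> (x /\<^sub>R norm x) = inverse (norm x) * (inverse (norm x) * (norm x)^2)"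
    by (simp add: power2_norm_eq_inner)
  also have "\<dots> = 1" using assms by (simp add: power2_eq_square field_simps)
  finally show ?thesis .
qed

lemma e_unit: "e1 \<bullet> e1 = 1" "e2 \<bullet> e2 = 1"
  unfolding e1_def e2_def by (intro inner_normalize psi_pow_norm_pos; simp)+

lemma \<theta>_pos: "0 < \<theta>" and \<theta>_le: "\<theta>^2 \<le> 1"
proof -
  show "0 < \<theta>"
    using psi_pow_inner_pos[of 2 1] psi_pow_norm_pos[of 1] psi_pow_norm_pos[of 2] by (simp add: \<theta>_def e1_def e2_def)
  show "\<theta>^2 \<le> 1" using Cauchy_Schwarz_ineq[of e2 e1] by (simp add: \<theta>_def e_unit)
qed

text \<open>The operators C and D are \<^term>\<open>\<lambda>u. NN u + AC u\<close> and \<^term>\<open>\<lambda>v. NN v + BD \<mu> v\<close>, since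
  sech^2 = 1 - tanh^2.\<close>

definition AC :: "l2 \<Rightarrow> l2" where
  "AC u = 3 *\<^sub>R u - 6 *\<^sub>R (u - tm (tm u))"

definition BD :: "real \<Rightarrow> l2 \<Rightarrow> l2" where
  "BD \<mu> v = \<mu> *\<^sub>R v - 2 *\<^sub>R (v - tm (tm v))"

text \<open>Orthogonally to psi the form of D - \<mu> is at least 1, by \<open>factor_gap\<close>
  with \<open>k = 1\<close>. A vector orthogonal to psi^2 has at most the fraction
  \<open>1 - \<theta>^2\<close> of its squared norm along psi, so a gap of at least
  \<open>\<theta>^2\<close> remains; half of it absorbs a negative \<mu>.\<close>

lemma gap_D_l2:
  assumes v: "v \<in> dom2" and orth: "v \<bullet> e2 = 0" and \<mu>: "\<mu> \<ge> - (\<theta>^2 / 2)"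
  shows "\<theta>^2 / 2 * (v \<bullet> v) \<le> (NN v + BD \<mu> v) \<bullet> v"
proof -
  obtain v' where v': "der v v'" using v by (rule dom2E)
  define a where "a = v \<bullet> e1"
  define w where "w = v - a *\<^sub>R e1"
  define s where "s = a / norm (psi_pow 1)"
  have se: "a *\<^sub>R e1 = s *\<^sub>R psi_pow 1" by (simp add: e1_def s_def divide_inverse)
  have w': "der w (v' + s *\<^sub>R tm (psi_pow 1))"
    unfolding w_def se using der_diff[OF v' der_scale[OF der_psi_pow[of 1], of s]] by simp
  have we: "w \<bullet> e1 = 0" by (simp add: w_def inner_diff_left e_unit a_def)
  then have "w \<bullet> psi_pow 1 = 0" using psi_pow_norm_pos[of 1] by (simp add: e1_def)
  then have "w \<bullet> w \<le> ((v' + s *\<^sub>R tm (psi_pow 1)) + tm w) \<bullet> ((v' + s *\<^sub>R tm (psi_pow 1)) + tm w)"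
    using factor_gap[OF _ w', of 1] by simp
  \<comment> \<open>d + tanh annihilates psi, so subtracting the component of \<open>v\<close> along
    psi does not change the image.\<close>
  also have "(v' + s *\<^sub>R tm (psi_pow 1)) + tm w = v' + tm v"
    by (simp add: w_def se tm_diff tm_scale)
  also have "(v' + tm v) \<bullet> (v' + tm v) = (NN v - 2 *\<^sub>R (v - tm (tm v))) \<bullet> v"
    using factor_form[OF v v', of 1] by simp
  finally have 1: "w \<bullet> w \<le> (NN v - 2 *\<^sub>R (v - tm (tm v))) \<bullet> v" .
  have ww: "w \<bullet> w = v \<bullet> v - a^2"
    by (simp add: w_def inner_diff_left inner_diff_right e_unit a_def inner_commute power2_eq_square)
  \<comment> \<open>\<open>v\<close> sees only the part of \<open>e1\<close> orthogonal to
    \<open>e2\<close>, whose squared length is \<open>1 - \<theta>^2\<close>.\<close>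
  have "a = v \<bullet> (e1 - \<theta> *\<^sub>R e2)" using orth by (simp add: a_def inner_diff_right)
  then have "a^2 \<le> (v \<bullet> v) * ((e1 - \<theta> *\<^sub>R e2) \<bullet> (e1 - \<theta> *\<^sub>R e2))"
    using Cauchy_Schwarz_ineq by metis
  also have "(e1 - \<theta> *\<^sub>R e2) \<bullet> (e1 - \<theta> *\<^sub>R e2) = 1 - \<theta>^2"
    by (simp add: inner_diff_left inner_diff_right e_unit \<theta>_def inner_commute power2_eq_square)
  finally have "\<theta>^2 * (v \<bullet> v) \<le> w \<bullet> w" unfolding ww by (simp add: algebra_simps)
  moreover have "\<mu> * (v \<bullet> v) \<ge> - (\<theta>^2 / 2) * (v \<bullet> v)" by (rule mult_right_mono[OF \<mu>]) simp
  moreover have "(NN v + BD \<mu> v) \<bullet> v = (NN v - 2 *\<^sub>R (v - tm (tm v))) \<bullet> v + \<mu> * (v \<bullet> v)"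
    by (simp add: BD_def inner_add_left inner_diff_left)
  ultimately show ?thesis using 1 by (simp add: algebra_simps)
qed

lemma gap_ops_l2:
  assumes \<mu>: "\<mu> \<ge> - (\<theta>^2 / 2)"
  shows "gap_ops dom2 NN AC (BD \<mu>) e2 2 (\<theta>^2 / 2)"
proof (intro gap_ops.intro gap_ops_axioms.intro pos_op_NN)
  note bl = bounded_linear_sub bounded_linear_ident bounded_linear_compose[OF bounded_linear_scaleR_right]
    bounded_linear_compose[OF tm_bounded]
  show "bounded_linear AC" "bounded_linear (BD \<mu>)" unfolding AC_def BD_def by (intro bl)+
  show "AC f \<bullet> g = f \<bullet> AC g" "BD \<mu> f \<bullet> g = f \<bullet> BD \<mu> g" for f g
    by (simp_all add: AC_def BD_def inner_diff_left inner_diff_right tm_sym)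
  show "e2 \<in> dom2" unfolding e2_def by (intro NN.dom_scale psi_pow_dom) simp
  show "e2 \<bullet> e2 = 1" by (rule e_unit)
  have "NN (psi_pow 2) + AC (psi_pow 2) = 0" using psi_pow_eigen[of 2] by (simp add: AC_def add_diff_eq)
  moreover have "NN e2 + AC e2 = (1 / norm (psi_pow 2)) *\<^sub>R (NN (psi_pow 2) + AC (psi_pow 2))"
    by (simp add: e2_def AC_def NN.N_scale psi_pow_dom tm_scale scaleR_diff_right scaleR_add_right divide_inverse mult.commute)
  ultimately show "NN e2 + AC e2 = 0" by simp
  show "2 * (f \<bullet> f) \<le> (NN f + AC f) \<bullet> f" if f: "f \<in> dom2" "f \<bullet> e2 = 0" for f
  proof -
    obtain f' where f': "der f f'" using f(1) by (rule dom2E)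
    have "f \<bullet> psi_pow 2 = 0" using f(2) psi_pow_norm_pos[of 2] by (simp add: e2_def)
    then show ?thesis using factor_gap[OF _ f', of 2] factor_form[OF f(1) f', of 2]
      by (simp add: AC_def algebra_simps)
  qed
  show "\<theta>^2 / 2 * (f \<bullet> f) \<le> (NN f + BD \<mu> f) \<bullet> f" if "f \<in> dom2" "f \<bullet> e2 = 0" for f
    by (rule gap_D_l2[OF that \<mu>])
  show "0 < \<theta>^2 / 2" "\<theta>^2 / 2 \<le> 1" using \<theta>_pos \<theta>_le by auto
qed simp

section \<open>The linearized operator\<close>

lemma H2_linear:
  assumes T: "bounded_linear T" and f: "f \<in> H2"
  shows "(\<lambda>x. T (f x)) \<in> H2"
proof -
  obtain g h where gh: "f \<in> L2" "g \<in> L2" "h \<in> L2" "has_weak_deriv f g" "has_weak_deriv g h"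
    using f by (auto simp: H2_def)
  show ?thesis
    unfolding H2_def using L2_linear[OF T gh(1)] L2_linear[OF T gh(2)] L2_linear[OF T gh(3)]
      has_weak_deriv_linear[OF T gh(4)] has_weak_deriv_linear[OF T gh(5)] by blast
qed

lemma H2_add:
  assumes "f \<in> H2" "g \<in> H2"
  shows "(\<lambda>x. f x + g x) \<in> H2"
proof -
  obtain f' f'' where f: "f \<in> L2" "f' \<in> L2" "f'' \<in> L2" "has_weak_deriv f f'" "has_weak_deriv f' f''"
    using assms(1) by (auto simp: H2_def)
  obtain g' g'' where g: "g \<in> L2" "g' \<in> L2" "g'' \<in> L2" "has_weak_deriv g g'" "has_weak_deriv g' g''"
    using assms(2) by (auto simp: H2_def)
  show ?thesis
    unfolding H2_def
    using L2_add[OF f(1) g(1)] L2_add[OF f(2) g(2)] L2_add[OF f(3) g(3)]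
      has_weak_deriv_add[OF f(4) g(4)] has_weak_deriv_add[OF f(5) g(5)] by blast
qed

lemma H2_L2: "f \<in> H2 \<Longrightarrow> f \<in> L2"
  by (simp add: H2_def)

section \<open>Reduction of complex and vector-valued functions to real components\<close>

lemma complex_decompose: "x = of_real (Re x) + \<i> * of_real (Im x)"
  by (simp add: complex_eq)

lemma bounded_linear_ii_of_real: "bounded_linear (\<lambda>x::real. \<i> * of_real x)"
  by (intro bounded_linear_compose[OF bounded_linear_mult_right] bounded_linear_of_real)

lemma L2_complex_iff: "u \<in> L2 \<longleftrightarrow> (\<lambda>x. Re (u x)) \<in> L2 \<and> (\<lambda>x. Im (u x)) \<in> L2"
proof
  assume *: "(\<lambda>x. Re (u x)) \<in> L2 \<and> (\<lambda>x. Im (u x)) \<in> L2"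
  then have "(\<lambda>x. of_real (Re (u x)) + \<i> * of_real (Im (u x)) :: complex) \<in> L2"
    by (intro L2_add L2_linear[OF bounded_linear_of_real] L2_linear[OF bounded_linear_ii_of_real]) auto
  then show "u \<in> L2" by (simp only: complex_decompose[symmetric])
qed (auto intro: L2_linear[OF bounded_linear_Re] L2_linear[OF bounded_linear_Im])

lemma H2_complex_iff: "u \<in> H2 \<longleftrightarrow> (\<lambda>x. Re (u x)) \<in> H2 \<and> (\<lambda>x. Im (u x)) \<in> H2"
proof
  assume *: "(\<lambda>x. Re (u x)) \<in> H2 \<and> (\<lambda>x. Im (u x)) \<in> H2"
  then have "(\<lambda>x. of_real (Re (u x)) + \<i> * of_real (Im (u x)) :: complex) \<in> H2"
    by (intro H2_add H2_linear[OF bounded_linear_of_real] H2_linear[OF bounded_linear_ii_of_real]) auto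
  then show "u \<in> H2" by (simp only: complex_decompose[symmetric])
qed (auto intro: H2_linear[OF bounded_linear_Re] H2_linear[OF bounded_linear_Im])

lemma vec2_decompose: "x = axis 1 (x $ 1) + axis 2 (x $ 2)" for x :: "complex^2"
  by (simp add: vec_eq_iff axis_def forall_2)

lemma bounded_linear_axis: "bounded_linear (axis i :: complex \<Rightarrow> complex^2)"
  unfolding linear_conv_bounded_linear[symmetric]
  by (rule linearI) (auto simp: vec_eq_iff axis_def)

lemma L2_vec_iff: "f \<in> L2 \<longleftrightarrow> (\<lambda>x. f x $ 1) \<in> L2 \<and> (\<lambda>x. f x $ 2) \<in> L2" for f :: fn2
proof
  assume *: "(\<lambda>x. f x $ 1) \<in> L2 \<and> (\<lambda>x. f x $ 2) \<in> L2"
  then have "(\<lambda>x. axis 1 (f x $ 1) + axis 2 (f x $ 2) :: complex^2) \<in> L2"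
    by (intro L2_add L2_linear[OF bounded_linear_axis]) auto
  then show "f \<in> L2" by (simp only: vec2_decompose[symmetric])
qed (auto intro: L2_linear[OF bounded_linear_vec_nth])

lemma H2_vec_iff: "f \<in> H2 \<longleftrightarrow> (\<lambda>x. f x $ 1) \<in> H2 \<and> (\<lambda>x. f x $ 2) \<in> H2" for f :: fn2
proof
  assume *: "(\<lambda>x. f x $ 1) \<in> H2 \<and> (\<lambda>x. f x $ 2) \<in> H2"
  then have "(\<lambda>x. axis 1 (f x $ 1) + axis 2 (f x $ 2) :: complex^2) \<in> H2"
    by (intro H2_add H2_linear[OF bounded_linear_axis]) auto
  then show "f \<in> H2" by (simp only: vec2_decompose[symmetric])
qed (auto intro: H2_linear[OF bounded_linear_vec_nth])

lemma H2_real_iff: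
  assumes f: "f \<in> L2"
  shows "f \<in> H2 \<longleftrightarrow> abs_l2 f \<in> dom2"
proof
  assume "f \<in> H2"
  then obtain g h where "g \<in> L2" "h \<in> L2" "has_weak_deriv f g" "has_weak_deriv g h"
    by (auto simp: H2_def)
  then show "abs_l2 f \<in> dom2"
    using f by (intro dom2I[of "abs_l2 f" "abs_l2 g" "abs_l2 h"]) (auto simp: der_abs)
next
  assume "abs_l2 f \<in> dom2"
  then obtain G where G: "der (abs_l2 f) G" "der G (dd (abs_l2 f))" by (rule dom2E)
  obtain g where g: "g \<in> L2" "G = abs_l2 g" by (rule l2_cases)
  obtain h where h: "h \<in> L2" "dd (abs_l2 f) = abs_l2 h" by (rule l2_cases)
  show "f \<in> H2" using G f g h der_abs unfolding H2_def by auto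
qed

lemma has_weak_deriv_unique_complex:
  fixes u g h :: "real \<Rightarrow> complex"
  assumes "has_weak_deriv u g" "has_weak_deriv u h"
  shows "AE x in lborel. g x = h x"
proof -
  have "AE x in lborel. Re (g x) = Re (h x)" "AE x in lborel. Im (g x) = Im (h x)"
    using has_weak_deriv_linear[OF bounded_linear_Re] has_weak_deriv_linear[OF bounded_linear_Im]
      has_weak_deriv_unique_real assms by blast+
  then show ?thesis by eventually_elim (simp add: complex_eq_iff)
qed

lemma weak_deriv_complex:
  fixes u g :: "real \<Rightarrow> complex"
  assumes "has_weak_deriv u g"
  shows "has_weak_deriv u (weak_deriv u)" "AE x in lborel. weak_deriv u x = g x"
proof -
  show 1: "has_weak_deriv u (weak_deriv u)"
    unfolding weak_deriv_def by (rule someI[of "has_weak_deriv u", OF assms])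
  show "AE x in lborel. weak_deriv u x = g x" by (rule has_weak_deriv_unique_complex[OF 1 assms])
qed

text \<open>The inner \<open>weak_deriv u\<close> is a chosen representative that agrees with
  \<open>g\<close> only almost everywhere, so the second derivative is first moved onto it.
  Measurability is recorded because almost everywhere equality does not provide it.\<close>

lemma weak_deriv2_complex:
  fixes u g h :: "real \<Rightarrow> complex"
  assumes "has_weak_deriv u g" "has_weak_deriv g h"
  shows "weak_deriv (weak_deriv u) \<in> borel_measurable borel"
    "AE x in lborel. weak_deriv (weak_deriv u) x = h x"
proof -
  note 1 = weak_deriv_complex[OF assms(1)]
  have m: "weak_deriv u \<in> borel_measurable borel" "h \<in> borel_measurable borel"
    using 1(1) assms(2) by (auto simp: has_weak_deriv_def intro: locally_integrable_measurable)
  have ae: "AE x in lborel. g x = weak_deriv u x" using 1(2) by (simp add: eq_commute)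
  have "has_weak_deriv (weak_deriv u) h"
    by (rule has_weak_deriv_cong_AE[OF assms(2) ae _ m]) simp
  note 2 = weak_deriv_complex[OF this]
  show "weak_deriv (weak_deriv u) \<in> borel_measurable borel"
    using 2(1) by (auto simp: has_weak_deriv_def intro: locally_integrable_measurable)
  show "AE x in lborel. weak_deriv (weak_deriv u) x = h x" by (rule 2(2))
qed

section \<open>Complex and two-component functions as tuples of real classes\<close>

definition re_im :: "(real \<Rightarrow> complex) \<Rightarrow> l2 \<times> l2" where
  "re_im u = (abs_l2 (\<lambda>x. Re (u x)), abs_l2 (\<lambda>x. Im (u x)))"

lemma L2_complexD: "u \<in> L2 \<Longrightarrow> (\<lambda>x. Re (u x)) \<in> L2" "u \<in> L2 \<Longrightarrow> (\<lambda>x. Im (u x)) \<in> L2"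
  by (simp_all add: L2_complex_iff)

lemma L2_cong_AE:
  fixes f g :: "real \<Rightarrow> 'a::euclidean_space"
  assumes f: "f \<in> L2" and ae: "AE x in lborel. f x = g x" and g: "g \<in> borel_measurable borel"
  shows "g \<in> L2"
proof -
  have i: "integrable lborel (\<lambda>x. (norm (f x))^2)" using f by (simp add: L2_def)
  have "integrable lborel (\<lambda>x. (norm (g x))^2)"
    by (rule integrable_cong_AE_imp[OF i]) (use g ae in \<open>auto elim: eventually_mono\<close>)
  then show ?thesis using g by (simp add: L2_def)
qed

lemma re_im_eq_iff:
  assumes "u \<in> L2" "v \<in> L2"
  shows "re_im u = re_im v \<longleftrightarrow> u =\<^sub>a\<^sub>e v"
proof -
  have "re_im u = re_im v \<longleftrightarrow> (AE x in lborel. Re (u x) = Re (v x)) \<and> (AE x in lborel. Im (u x) = Im (v x))"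
    using assms by (simp add: re_im_def abs_l2_eq_iff L2_complexD ae_eq_def)
  also have "\<dots> \<longleftrightarrow> (AE x in lborel. Re (u x) = Re (v x) \<and> Im (u x) = Im (v x))"
    by (simp add: eventually_conj_iff)
  finally show ?thesis by (simp add: ae_eq_def complex_eq_iff)
qed

lemma re_im_add: "u \<in> L2 \<Longrightarrow> v \<in> L2 \<Longrightarrow> re_im (\<lambda>x. u x + v x) = re_im u + re_im v"
  by (simp add: re_im_def abs_l2_add L2_complexD)

lemma re_im_diff: "u \<in> L2 \<Longrightarrow> v \<in> L2 \<Longrightarrow> re_im (\<lambda>x. u x - v x) = re_im u - re_im v"
  by (simp add: re_im_def abs_l2_diff L2_complexD)

lemma re_im_mult: "u \<in> L2 \<Longrightarrow> re_im (\<lambda>x. c * u x) = cmul c (re_im u)"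
  by (simp add: re_im_def cmul_def abs_l2_scale abs_l2_diff abs_l2_add L2_complexD L2_mult_left add.commute)

lemma psi_sq: "(\<psi> x)^2 = 1 - (tanh x)^2"
  by (simp add: \<psi>_def power_divide sech_square)

lemma psi_sq_bound: "\<bar>(\<psi> x)^2\<bar> \<le> 1"
  using psi_pos[of x] psi_le_1[of x] by (simp add: power_le_one)

lemma L2_real_psi_sq: "f \<in> L2 \<Longrightarrow> (\<lambda>x. (\<psi> x)^2 * f x) \<in> L2"
  by (rule L2_real_bounded_mult[OF _ _ psi_sq_bound]) auto

lemma abs_l2_psi_sq:
  assumes "f \<in> L2"
  shows "abs_l2 (\<lambda>x. (\<psi> x)^2 * f x) = abs_l2 f - tm (tm (abs_l2 f))"
proof -
  have "abs_l2 f - tm (tm (abs_l2 f)) = abs_l2 (\<lambda>x. f x - tanh x * (tanh x * f x))"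
    using assms by (simp add: tm_abs L2_tanh abs_l2_diff)
  also have "(\<lambda>x. f x - tanh x * (tanh x * f x)) = (\<lambda>x. (\<psi> x)^2 * f x)"
    unfolding psi_sq by (simp add: fun_eq_iff algebra_simps power2_eq_square)
  finally show ?thesis ..
qed

lemma L2_complex_psi_sq: "u \<in> L2 \<Longrightarrow> (\<lambda>x. of_real ((\<psi> x)^2) * u x :: complex) \<in> L2"
  by (auto simp: L2_complex_iff simp del: of_real_power intro: L2_real_psi_sq)

lemma re_im_psi_sq: "u \<in> L2 \<Longrightarrow> re_im (\<lambda>x. of_real ((\<psi> x)^2) * u x) = re_im u - map_prod (tm \<circ> tm) (tm \<circ> tm) (re_im u)"
  by (simp add: re_im_def abs_l2_psi_sq L2_complexD del: of_real_power)

lemma re_im_surj: "\<exists>u\<in>L2. re_im u = p"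
proof -
  obtain a b where ab: "fst p = abs_l2 a" "a \<in> L2" "snd p = abs_l2 b" "b \<in> L2"
    by (metis l2_cases)
  have "(\<lambda>x. Complex (a x) (b x)) \<in> L2" using ab by (simp add: L2_complex_iff)
  moreover have "re_im (\<lambda>x. Complex (a x) (b x)) = p" using ab by (simp add: re_im_def prod_eq_iff)
  ultimately show ?thesis by blast
qed

lemma H2_re_im_iff: "u \<in> L2 \<Longrightarrow> u \<in> H2 \<longleftrightarrow> re_im u \<in> dom2 \<times> dom2"
  by (simp add: H2_complex_iff H2_real_iff L2_complexD re_im_def)

lemma norm_re_im:
  assumes "u \<in> L2"
  shows "(norm (re_im u))^2 = (LINT x|lborel. (norm (u x))^2)"
proof -
  have "(norm (re_im u))^2 = (LINT x|lborel. (Re (u x))^2) + (LINT x|lborel. (Im (u x))^2)"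
    using assms by (simp add: re_im_def norm_Pair abs_l2_norm L2_complexD)
  also have "\<dots> = (LINT x|lborel. (Re (u x))^2 + (Im (u x))^2)"
    using L2_complexD[OF assms] by (intro Bochner_Integration.integral_add[symmetric]) (auto simp: L2_real_iff)
  finally show ?thesis by (simp add: cmod_power2)
qed

lemma re_im_weak_deriv2:
  assumes u: "u \<in> H2"
  shows "(\<lambda>x. weak_deriv (weak_deriv u) x) \<in> L2"
    "re_im (weak_deriv (weak_deriv u)) = map_prod dd dd (re_im u)"
proof -
  obtain g h where gh: "u \<in> L2" "g \<in> L2" "h \<in> L2" "has_weak_deriv u g" "has_weak_deriv g h"
    using u by (auto simp: H2_def)
  note w = weak_deriv2_complex[OF gh(4,5)]
  have ae: "AE x in lborel. h x = weak_deriv (weak_deriv u) x" using w(2) by (simp add: eq_commute)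
  show L: "(\<lambda>x. weak_deriv (weak_deriv u) x) \<in> L2" by (rule L2_cong_AE[OF gh(3) ae w(1)])
  have "re_im (weak_deriv (weak_deriv u)) = re_im h"
    using w(2) L gh by (subst re_im_eq_iff) (auto simp: ae_eq_def)
  also have "re_im h = map_prod dd dd (re_im u)"
  proof -
    have "dd (abs_l2 (\<lambda>x. Re (u x))) = abs_l2 (\<lambda>x. Re (h x))"
      by (rule dd_eq[of _ "abs_l2 (\<lambda>x. Re (g x))"])
        (use gh in \<open>auto simp: der_abs L2_complexD intro!: has_weak_deriv_linear[OF bounded_linear_Re]\<close>)
    moreover have "dd (abs_l2 (\<lambda>x. Im (u x))) = abs_l2 (\<lambda>x. Im (h x))"
      by (rule dd_eq[of _ "abs_l2 (\<lambda>x. Im (g x))"])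
        (use gh in \<open>auto simp: der_abs L2_complexD intro!: has_weak_deriv_linear[OF bounded_linear_Im]\<close>)
    ultimately show ?thesis by (simp add: re_im_def)
  qed
  finally show "re_im (weak_deriv (weak_deriv u)) = map_prod dd dd (re_im u)" .
qed

lemma re_im_op_C:
  assumes u: "u \<in> H2"
  shows "op_C u \<in> L2" "re_im (op_C u) = map_prod (\<lambda>F. NN F + AC F) (\<lambda>F. NN F + AC F) (re_im u)"
proof -
  have L: "u \<in> L2" by (rule H2_L2[OF u])
  note w = re_im_weak_deriv2[OF u]
  have eq: "op_C u = (\<lambda>z. 4 * u z - (weak_deriv (weak_deriv u) z + 6 * (of_real ((\<psi> z)^2) * u z)))"
    by (simp add: op_C_def fun_eq_iff algebra_simps)
  show "op_C u \<in> L2"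
    unfolding eq by (intro L2_diff L2_add L2_mult_left L2_complex_psi_sq w L)
  have "re_im (op_C u) = cmul 4 (re_im u) - (map_prod dd dd (re_im u) + cmul 6 (re_im u - map_prod (tm \<circ> tm) (tm \<circ> tm) (re_im u)))"
    unfolding eq
    by (simp only: re_im_diff re_im_add re_im_mult re_im_psi_sq L2_diff L2_add L2_mult_left L2_complex_psi_sq w L)
  moreover have "4 *\<^sub>R F = F + 3 *\<^sub>R F" for F :: l2
    using scaleR_add_left[of 1 3 F] by simp
  ultimately show "re_im (op_C u) = map_prod (\<lambda>F. NN F + AC F) (\<lambda>F. NN F + AC F) (re_im u)"
    by (cases "re_im u") (simp add: cmul_def NN_def AC_def algebra_simps)
qed

lemma re_im_op_D:
  assumes u: "u \<in> H2"
  shows "op_D \<mu> u \<in> L2" "re_im (op_D \<mu> u) = map_prod (\<lambda>F. NN F + BD \<mu> F) (\<lambda>F. NN F + BD \<mu> F) (re_im u)"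
proof -
  have L: "u \<in> L2" by (rule H2_L2[OF u])
  note w = re_im_weak_deriv2[OF u]
  have eq: "op_D \<mu> u = (\<lambda>z. of_real (\<mu> + 1) * u z - (weak_deriv (weak_deriv u) z + 2 * (of_real ((\<psi> z)^2) * u z)))"
    by (simp add: op_D_def fun_eq_iff algebra_simps)
  show "op_D \<mu> u \<in> L2"
    unfolding eq by (intro L2_diff L2_add L2_mult_left L2_complex_psi_sq w L)
  have "re_im (op_D \<mu> u) = cmul (of_real (\<mu> + 1)) (re_im u) - (map_prod dd dd (re_im u) + cmul 2 (re_im u - map_prod (tm \<circ> tm) (tm \<circ> tm) (re_im u)))"
    unfolding eq
    by (simp only: re_im_diff re_im_add re_im_mult re_im_psi_sq L2_diff L2_add L2_mult_left L2_complex_psi_sq w L)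
  then show "re_im (op_D \<mu> u) = map_prod (\<lambda>F. NN F + BD \<mu> F) (\<lambda>F. NN F + BD \<mu> F) (re_im u)"
    by (cases "re_im u") (simp add: cmul_def NN_def BD_def algebra_simps)
qed

text \<open>Identifies \<open>L2\<close> modulo null sets isometrically with the abstract space of
  complexified pairs; it matches \<open>H2\<close> with the domain and \<open>op_L\<close> with
  \<open>system\<close>.\<close>

definition \<Phi> :: "fn2 \<Rightarrow> (l2 \<times> l2) \<times> (l2 \<times> l2)" where
  "\<Phi> f = (re_im (\<lambda>z. f z $ 1), re_im (\<lambda>z. f z $ 2))"

lemma L2_vecD: "f \<in> L2 \<Longrightarrow> (\<lambda>z. f z $ 1) \<in> L2" "f \<in> L2 \<Longrightarrow> (\<lambda>z. f z $ 2) \<in> L2" for f :: fn2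
  by (simp_all add: L2_vec_iff)

lemma \<Phi>_eq_iff:
  assumes "f \<in> L2" "g \<in> L2"
  shows "\<Phi> f = \<Phi> g \<longleftrightarrow> f =\<^sub>a\<^sub>e g"
proof -
  have "\<Phi> f = \<Phi> g \<longleftrightarrow> (AE x in lborel. f x $ 1 = g x $ 1) \<and> (AE x in lborel. f x $ 2 = g x $ 2)"
    using assms by (simp add: \<Phi>_def re_im_eq_iff L2_vecD ae_eq_def)
  also have "\<dots> \<longleftrightarrow> (AE x in lborel. f x $ 1 = g x $ 1 \<and> f x $ 2 = g x $ 2)"
    by (simp add: eventually_conj_iff)
  finally show ?thesis by (simp add: ae_eq_def vec_eq_iff forall_2)
qed

lemma \<Phi>_surj: "\<exists>f\<in>L2. \<Phi> f = x"
proof -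
  obtain u v where uv: "u \<in> L2" "re_im u = fst x" "v \<in> L2" "re_im v = snd x"
    using re_im_surj by metis
  have "(\<lambda>z. vector [u z, v z] :: complex^2) \<in> L2" using uv by (simp add: L2_vec_iff)
  moreover have "\<Phi> (\<lambda>z. vector [u z, v z]) = x" using uv by (simp add: \<Phi>_def)
  ultimately show ?thesis by blast
qed

lemma H2_\<Phi>_iff: "f \<in> L2 \<Longrightarrow> f \<in> H2 \<longleftrightarrow> \<Phi> f \<in> (dom2 \<times> dom2) \<times> (dom2 \<times> dom2)"
  by (simp add: H2_vec_iff H2_re_im_iff L2_vecD \<Phi>_def)

lemma norm_\<Phi>:
  assumes "f \<in> L2"
  shows "L2_norm f = norm (\<Phi> f)"
proof -
  have "(norm (\<Phi> f))^2 = (LINT x|lborel. (norm (f x $ 1))^2) + (LINT x|lborel. (norm (f x $ 2))^2)"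
    using assms by (simp add: \<Phi>_def norm_Pair norm_re_im L2_vecD)
  also have "\<dots> = (LINT x|lborel. (norm (f x $ 1))^2 + (norm (f x $ 2))^2)"
    using L2_vecD[OF assms] by (intro Bochner_Integration.integral_add[symmetric]) (auto simp: L2_def)
  also have "\<dots> = (LINT x|lborel. (norm (f x))^2)"
    by (simp add: norm_vec_def L2_set_def sum_2 UNIV_2)
  finally show ?thesis by (simp add: L2_norm_def real_sqrt_unique)
qed

section \<open>Resolvent set and kernel of the linearized operator\<close>

lemma \<Phi>_shifted:
  assumes G: "gap_ops dom2 NN AC (BD \<mu>) e2 2 \<delta>" and f: "f \<in> H2"
  shows "shifted (op_L \<beta> \<mu>) w f \<in> L2"
    "\<Phi> (shifted (op_L \<beta> \<mu>) w f) = gap_ops.system NN AC (BD \<mu>) w (w + of_real \<beta>) (\<Phi> f)"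
proof -
  interpret G: gap_ops dom2 NN AC "BD \<mu>" e2 2 \<delta> by (rule G)
  define u where "u = (\<lambda>z. f z $ 1)"
  define v where "v = (\<lambda>z. f z $ 2)"
  have uv: "u \<in> H2" "v \<in> H2" "u \<in> L2" "v \<in> L2"
    using f H2_L2 by (auto simp: H2_vec_iff u_def v_def)
  have c: "(\<lambda>z. shifted (op_L \<beta> \<mu>) w f z $ 1) = (\<lambda>z. op_D \<mu> v z - w * u z)"
    "(\<lambda>z. shifted (op_L \<beta> \<mu>) w f z $ 2) = (\<lambda>z. - 1 * op_C u z - (w + of_real \<beta>) * v z)"
    by (simp_all add: shifted_def op_L_def u_def v_def fun_eq_iff algebra_simps)
  note C = re_im_op_C[OF uv(1)] and D = re_im_op_D[OF uv(2), of \<mu>]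
  show "shifted (op_L \<beta> \<mu>) w f \<in> L2"
    unfolding L2_vec_iff c by (intro conjI L2_diff L2_mult_left C D uv)
  have GC: "G.C = (\<lambda>F. NN F + AC F)" and GD: "G.D = (\<lambda>F. NN F + BD \<mu> F)"
    by (simp_all add: G.C_def G.D_def fun_eq_iff)
  have neg: "cmul (- 1) p = - p" for p :: "l2 \<times> l2" by (simp add: cmul_def prod_eq_iff)
  show "\<Phi> (shifted (op_L \<beta> \<mu>) w f) = G.system w (w + of_real \<beta>) (\<Phi> f)"
    unfolding \<Phi>_def c G.system_def GC GD
    by (simp only: re_im_diff re_im_mult L2_mult_left C D uv u_def[symmetric] v_def[symmetric] fst_conv snd_conv neg)
qed

lemma resolvent_set_L:
  assumes G: "gap_ops dom2 NN AC (BD \<mu>) e2 2 \<delta>"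
    and w: "w \<noteq> 0" "w + of_real \<beta> \<noteq> 0"
    and z: "Re z > 0" "Re (z * (w * (w + of_real \<beta>))) \<ge> - (Re z * \<delta>)"
  shows "w \<in> resolvent_set H2 (op_L \<beta> \<mu>)"
proof -
  interpret G: gap_ops dom2 NN AC "BD \<mu>" e2 2 \<delta> by (rule G)
  let ?T = "shifted (op_L \<beta> \<mu>) w" and ?S = "G.system w (w + of_real \<beta>)"
  let ?X = "(dom2 \<times> dom2) \<times> (dom2 \<times> dom2)"
  note T = \<Phi>_shifted[OF G, where \<beta> = \<beta> and w = w]
  \<comment> \<open>The gap \<gamma> of C is 2 here, so the abstract threshold
    \<open>\<delta> * \<gamma> / 2\<close> is \<open>\<delta>\<close>.\<close>
  have "Re (z * (w * (w + of_real \<beta>))) \<ge> - (Re z * \<delta> * 2 / 2)" using z(2) by simp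
  note R = G.resolvent[OF w z(1) this]
  obtain K where K: "\<And>x. x \<in> ?X \<Longrightarrow> norm x \<le> K * norm (?S x)" using R by blast
  have surj: "\<exists>x\<in>?X. ?S x = g" for g using R by blast
  have dom: "\<Phi> f \<in> ?X" if "f \<in> H2" for f using H2_\<Phi>_iff[OF H2_L2[OF that]] that by blast
  show ?thesis
    unfolding resolvent_set_def
  proof (intro CollectI conjI ballI impI)
    fix f g assume f: "f \<in> H2" and g: "g \<in> H2" and eq: "?T f =\<^sub>a\<^sub>e ?T g"
    then have "?S (\<Phi> f) = ?S (\<Phi> g)" using \<Phi>_eq_iff[OF T(1)[OF f] T(1)[OF g]] T(2) by simp
    then have "?S (\<Phi> f - \<Phi> g) = 0" using G.system_diff[OF dom[OF f] dom[OF g]] by simp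
    moreover have "\<Phi> f - \<Phi> g \<in> ?X"
      using dom[OF f] dom[OF g] by (auto simp: mem_Times_iff intro: NN.dom_diff)
    ultimately have "\<Phi> f = \<Phi> g" using K[of "\<Phi> f - \<Phi> g"] by simp
    then show "f =\<^sub>a\<^sub>e g" using \<Phi>_eq_iff[OF H2_L2[OF f] H2_L2[OF g]] by simp
  next
    fix g :: fn2 assume g: "g \<in> L2"
    obtain x where x: "x \<in> ?X" "?S x = \<Phi> g" using surj by blast
    obtain f where f: "f \<in> L2" "\<Phi> f = x" using \<Phi>_surj by blast
    have fH: "f \<in> H2" using H2_\<Phi>_iff[OF f(1)] f(2) x(1) by simp
    have "\<Phi> (?T f) = \<Phi> g" using T(2)[OF fH] f(2) x(2) by simp
    then have "?T f =\<^sub>a\<^sub>e g" using \<Phi>_eq_iff[OF T(1)[OF fH] g] by simp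
    then show "\<exists>f\<in>H2. ?T f =\<^sub>a\<^sub>e g" using fH by blast
  next
    show "\<exists>K. \<forall>f\<in>H2. L2_norm f \<le> K * L2_norm (?T f)"
    proof (intro exI[of _ K] ballI)
      fix f :: fn2 assume f: "f \<in> H2"
      show "L2_norm f \<le> K * L2_norm (?T f)"
        using K[OF dom[OF f]] unfolding norm_\<Phi>[OF H2_L2[OF f]] norm_\<Phi>[OF T(1)[OF f]] T(2)[OF f] .
    qed
  qed
qed

text \<open>The translational mode: the derivative of the soliton (tanh z, 0).\<close>

definition mode :: fn2 where
  "mode z = vector [of_real (\<psi> z ^ 2), 0]"

lemma mode_L2: "mode \<in> L2" and \<Phi>_mode: "\<Phi> mode = ((psi_pow 2, 0), 0)"
proof -
  have "(\<lambda>z. \<psi> z ^ 2) \<in> L2" by (rule psi_power_L2) simp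
  then show "mode \<in> L2"
    by (simp add: mode_def[abs_def] L2_vec_iff L2_complex_iff L2_real_0 del: of_real_power)
  have "abs_l2 (\<lambda>_. 0) = 0" by (simp add: zero_l2.abs_eq)
  then show "\<Phi> mode = ((psi_pow 2, 0), 0)"
    by (simp add: \<Phi>_def re_im_def mode_def psi_pow_def zero_prod_def del: of_real_power)
qed

text \<open>\<open>chain\<close> treats preimages of an arbitrary multiple of the mode. With
  multiple 0 it determines the eigenspace; with any multiple it is the induction step showing that
  no power has a larger kernel.\<close>

lemma simple_eigenvalue_L:
  assumes G: "gap_ops dom2 NN AC (BD \<mu>) e2 2 \<delta>" and \<beta>: "\<beta> > 0"
  shows "simple_eigenvalue H2 (op_L \<beta> \<mu>) 0"
proof -
  interpret G: gap_ops dom2 NN AC "BD \<mu>" e2 2 \<delta> by (rule G)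
  let ?T = "shifted (op_L \<beta> \<mu>) 0" and ?S = "G.system 0 (0 + of_real \<beta>)"
  let ?X = "(dom2 \<times> dom2) \<times> (dom2 \<times> dom2)"
  note T = \<Phi>_shifted[OF G, where \<beta> = \<beta> and w = 0]
  define E where "E = {f \<in> L2. \<exists>c. f =\<^sub>a\<^sub>e (\<lambda>z. c *s mode z)}"
  have scaled: "(\<lambda>z. c *s mode z) \<in> L2" "\<Phi> (\<lambda>z. c *s mode z) = (cvec c (psi_pow 2), 0)" for c
  proof -
    note m = L2_vecD[OF mode_L2]
    show "(\<lambda>z. c *s mode z) \<in> L2" by (simp add: L2_vec_iff L2_mult_left m)
    have "\<Phi> (\<lambda>z. c *s mode z) = (cmul c (fst (\<Phi> mode)), cmul c (snd (\<Phi> mode)))"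
      by (simp add: \<Phi>_def re_im_mult m)
    then show "\<Phi> (\<lambda>z. c *s mode z) = (cvec c (psi_pow 2), 0)"
      unfolding \<Phi>_mode by (simp add: cmul_def cvec_def zero_prod_def)
  qed
  have E: "f \<in> E \<longleftrightarrow> (\<exists>c. \<Phi> f = (cvec c (psi_pow 2), 0))" if "f \<in> L2" for f
    using that \<Phi>_eq_iff[OF that scaled(1)] scaled(2) by (simp add: E_def)
  have zero: "(\<lambda>_. 0) \<in> (L2 :: fn2 set)" "\<Phi> (\<lambda>_. 0) = 0"
    using scaled[of 0] by (simp_all add: zero_prod_def)
  have pk2: "psi_pow 2 \<in> dom2" by (rule psi_pow_dom) simp
  have e2psi_pow: "e2 = (1 / norm (psi_pow 2)) *\<^sub>R psi_pow 2" by (simp add: e2_def divide_inverse)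
  have pke2: "psi_pow 2 = norm (psi_pow 2) *\<^sub>R e2" using psi_pow_norm_pos[of 2] by (simp add: e2_def)
  have sc: "r *\<^sub>R psi_pow 2 = (r * norm (psi_pow 2)) *\<^sub>R e2" for r by (subst pke2) simp
  have D0: "G.D 0 = 0" using G.D_scale[OF NN.dom_0, of 0] by simp
  have Cpk: "G.C (psi_pow 2) = 0" by (subst pke2) (simp add: G.C_scale G.e_dom)
  have chain: "?S x = 0 \<and> (\<exists>c. x = (cvec c (psi_pow 2), 0))"
    if x: "x \<in> ?X" and S: "?S x = (cvec c (psi_pow 2), 0)" for x c
  proof -
    obtain p1 p2 q1 q2 where pq: "x = ((p1, p2), (q1, q2))" by (metis prod.exhaust)
    have d: "p1 \<in> dom2" "p2 \<in> dom2" "q1 \<in> dom2" "q2 \<in> dom2" using x by (auto simp: pq)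
    have eqs: "G.D q1 = (Re c * norm (psi_pow 2)) *\<^sub>R e2" "G.D q2 = (Im c * norm (psi_pow 2)) *\<^sub>R e2"
      "G.C p1 + \<beta> *\<^sub>R q1 = 0" "G.C p2 + \<beta> *\<^sub>R q2 = 0"
      using S by (auto simp: pq sc[symmetric] G.system_def cmul_def cvec_def zero_prod_def neg_eq_iff_add_eq_0)
    have b: "\<beta> \<noteq> 0" using \<beta> by simp
    note k1 = G.kernel_chain[OF d(1,3) b eqs(1,3)] and k2 = G.kernel_chain[OF d(2,4) b eqs(2,4)]
    have "?S x = 0" using k1 k2 eqs D0
      by (simp add: pq G.system_def cmul_def zero_prod_def)
    moreover have "x = (cvec (Complex ((p1 \<bullet> e2) / norm (psi_pow 2)) ((p2 \<bullet> e2) / norm (psi_pow 2))) (psi_pow 2), 0)"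
      using k1 k2 by (simp add: pq cvec_def zero_prod_def e2psi_pow)
    ultimately show ?thesis by blast
  qed
  have E_H2: "f \<in> H2 \<and> ?S (\<Phi> f) = 0" if f: "f \<in> E" for f
  proof -
    have fL: "f \<in> L2" using f by (simp add: E_def)
    obtain c where c: "\<Phi> f = (cvec c (psi_pow 2), 0)" using E[OF fL] f by blast
    have "f \<in> H2" using H2_\<Phi>_iff[OF fL] c G.cvec_dom[OF pk2] NN.dom_0 by (simp add: zero_prod_def)
    moreover have "?S (\<Phi> f) = 0"
      by (simp add: c G.system_def cmul_def cvec_def zero_prod_def D0 G.C_scale pk2 Cpk)
    ultimately show ?thesis ..
  qed
  have dom: "\<Phi> f \<in> ?X" if "f \<in> H2" for f using H2_\<Phi>_iff[OF H2_L2[OF that]] that by blast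
  have T_zero: "?T f =\<^sub>a\<^sub>e (\<lambda>_. 0) \<longleftrightarrow> ?S (\<Phi> f) = 0" if "f \<in> H2" for f
    using \<Phi>_eq_iff[OF T(1)[OF that] zero(1)] T(2)[OF that] zero(2) by simp
  have eig: "eigenspace H2 (op_L \<beta> \<mu>) 0 = E"
  proof (rule set_eqI)
    fix f
    have "f \<in> E" if "f \<in> H2" "?S (\<Phi> f) = 0" for f
      using chain[OF dom[OF that(1)], of 0] that E[OF H2_L2[OF that(1)]] by (auto simp: zero_prod_def)
    then show "f \<in> eigenspace H2 (op_L \<beta> \<mu>) 0 \<longleftrightarrow> f \<in> E"
      using E_H2 T_zero unfolding eigenspace_def by blast
  qed
  have pow: "power_kernel H2 (op_L \<beta> \<mu>) 0 n \<subseteq> E" for n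
  proof (induction n)
    case 0
    show ?case
    proof
      fix f assume "f \<in> power_kernel H2 (op_L \<beta> \<mu>) 0 0"
      then have f: "f \<in> L2" "f =\<^sub>a\<^sub>e (\<lambda>_. 0)" by auto
      then have "\<Phi> f = (cvec 0 (psi_pow 2), 0)" using \<Phi>_eq_iff[OF f(1) zero(1)] zero(2) by (simp add: zero_prod_def)
      then show "f \<in> E" using E[OF f(1)] by blast
    qed
  next
    case (Suc n)
    show ?case
    proof
      fix f assume "f \<in> power_kernel H2 (op_L \<beta> \<mu>) 0 (Suc n)"
      then have f: "f \<in> H2" "?T f \<in> E" using Suc by auto
      then obtain c where "?S (\<Phi> f) = (cvec c (psi_pow 2), 0)" using E[OF T(1)[OF f(1)]] T(2)[OF f(1)] by auto
      then show "f \<in> E" using chain[OF dom[OF f(1)]] E[OF H2_L2[OF f(1)]] by blast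
    qed
  qed
  \<comment> \<open>The power 0 contributes only functions that vanish almost everywhere;
    \<open>E\<close> is reached at the first power.\<close>
  have "E \<subseteq> power_kernel H2 (op_L \<beta> \<mu>) 0 (Suc 0)"
    using E_H2 T_zero T(1) by auto
  then have gen: "generalized_eigenspace H2 (op_L \<beta> \<mu>) 0 = E"
    unfolding generalized_eigenspace_def using pow by blast
  have "\<not> mode =\<^sub>a\<^sub>e (\<lambda>_. 0)"
    using \<Phi>_eq_iff[OF mode_L2 zero(1)] psi_pow_norm_pos[of 2] by (auto simp: \<Phi>_mode zero zero_prod_def)
  then have "one_dimensional E"
    unfolding one_dimensional_def E_def using mode_L2 by blast
  then show ?thesis by (simp add: simple_eigenvalue_def eig gen)
qed

section \<open>Location of the spectrum\<close>

lemma rotation_exists: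
  assumes "\<delta> > 0" "Im \<kappa> = 0 \<Longrightarrow> Re \<kappa> \<ge> - \<delta>"
  shows "\<exists>z. Re z > 0 \<and> Re (z * \<kappa>) \<ge> - (Re z * \<delta>)"
proof (cases "Im \<kappa> = 0")
  case True
  then show ?thesis using assms by (intro exI[of _ 1]) simp
next
  case False
  \<comment> \<open>The witness is the multiplier required by \<open>resolvent_set_L\<close>. Its
    real part \<open>\<bar>Im \<kappa>\<bar>\<close> is positive as \<kappa> is not real, and its
    imaginary part is chosen so that \<open>Re (z * \<kappa>)\<close> becomes the product shown
    here.\<close>
  have "0 \<le> \<bar>Im \<kappa>\<bar> * (Re \<kappa> + \<bar>Re \<kappa>\<bar>)" by (intro mult_nonneg_nonneg) auto
  also have "\<dots> = Re (Complex \<bar>Im \<kappa>\<bar> (- (sgn (Im \<kappa>) * \<bar>Re \<kappa>\<bar>)) * \<kappa>)"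
    by (simp add: algebra_simps abs_sgn)
  moreover have "0 \<le> \<bar>Im \<kappa>\<bar> * \<delta>" using assms(1) by simp
  ultimately show ?thesis
    using False by (intro exI[of _ "Complex \<bar>Im \<kappa>\<bar> (- (sgn (Im \<kappa>) * \<bar>Re \<kappa>\<bar>))"]) simp
qed

theorem theorem3:
  fixes \<beta> :: real
  assumes "\<beta> > 0"
  shows "\<exists>\<mu>\<^sub>0>0. \<exists>\<Lambda>>0. \<forall>\<mu>\<in>{-\<mu>\<^sub>0..3}.
           spectrum H2 (op_L \<beta> \<mu>) \<subseteq> {0} \<union> {w. Re w < -\<Lambda>} \<and>
           simple_eigenvalue H2 (op_L \<beta> \<mu>) 0"
proof -
  \<comment> \<open>One constant serves both as the gap of D and as the bound
    \<open>\<mu>\<^sub>0\<close> for negative \<mu>.\<close>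
  define \<delta> where "\<delta> = \<theta>^2 / 2"
  have \<delta>: "\<delta> > 0" using \<theta>_pos by (simp add: \<delta>_def)
  \<comment> \<open>\<open>\<beta> / 4\<close> keeps \<open>2 * Re w + \<beta>\<close> and
    \<open>Re w + \<beta>\<close> positive when \<open>Re w \<ge> - \<Lambda>\<close>;
    \<open>\<delta> / \<beta>\<close> keeps w (w + \<beta>) above -\<delta> for real
    \<open>w\<close> in that range.\<close>
  define \<Lambda> where "\<Lambda> = min (\<beta> / 4) (\<delta> / \<beta>)"
  have \<Lambda>: "\<Lambda> > 0" "\<Lambda> \<le> \<beta> / 4" "\<Lambda> * \<beta> \<le> \<delta>"
    using assms \<delta> by (auto simp: \<Lambda>_def min_def field_simps)
  have "spectrum H2 (op_L \<beta> \<mu>) \<subseteq> {0} \<union> {w. Re w < -\<Lambda>} \<and> simple_eigenvalue H2 (op_L \<beta> \<mu>) 0"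
    if "\<mu> \<in> {-\<delta>..3}" for \<mu>
  proof
    have G: "gap_ops dom2 NN AC (BD \<mu>) e2 2 \<delta>"
      unfolding \<delta>_def by (rule gap_ops_l2) (use that in \<open>simp add: \<delta>_def\<close>)
    show "simple_eigenvalue H2 (op_L \<beta> \<mu>) 0" by (rule simple_eigenvalue_L[OF G assms])
    show "spectrum H2 (op_L \<beta> \<mu>) \<subseteq> {0} \<union> {w. Re w < -\<Lambda>}"
    proof (rule ccontr)
      assume "\<not> ?thesis"
      then obtain w where w: "w \<notin> resolvent_set H2 (op_L \<beta> \<mu>)" "w \<noteq> 0" "Re w \<ge> - \<Lambda>"
        unfolding spectrum_def by force
      have "Re (w + of_real \<beta>) > 0" using w(3) \<Lambda> assms by simp
      then have m: "w + of_real \<beta> \<noteq> 0" by (metis less_irrefl zero_complex.simps(1))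
      \<comment> \<open>The imaginary part of the product is
        \<open>Im w * (2 * Re w + \<beta>)\<close> with positive second factor, so only real
        \<open>w\<close> has to be examined.\<close>
      have "Re (w * (w + of_real \<beta>)) \<ge> - \<delta>" if "Im (w * (w + of_real \<beta>)) = 0"
      proof -
        have "Im w * (2 * Re w + \<beta>) = 0" using that by (simp add: algebra_simps)
        moreover have "2 * Re w + \<beta> > 0" using w(3) \<Lambda> assms by simp
        ultimately have im: "Im w = 0" by simp
        have "- \<delta> \<le> Re w * (Re w + \<beta>)"
        proof (cases "Re w \<ge> 0")
          case True
          then have "0 \<le> Re w * (Re w + \<beta>)" using assms by (intro mult_nonneg_nonneg) auto
          then show ?thesis using \<delta> by simp
        next
          case False
          have "- (\<Lambda> * \<beta>) \<le> Re w * \<beta>" using mult_right_mono[OF w(3), of \<beta>] assms by simp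
          moreover have "0 \<le> Re w * Re w" by simp
          ultimately have "- \<delta> \<le> Re w * Re w + Re w * \<beta>" using \<Lambda>(3) by linarith
          then show ?thesis by (simp add: distrib_left)
        qed
        then show ?thesis using im by simp
      qed
      then obtain z where "Re z > 0" "Re (z * (w * (w + of_real \<beta>))) \<ge> - (Re z * \<delta>)"
        using rotation_exists[OF \<delta>] by blast
      then show False using resolvent_set_L[OF G w(2) m] w(1) by blast
    qed
  qed
  then show ?thesis using \<delta> \<Lambda>(1) by blast
qed

end
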